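(* Let $N\ge2$, $r,s\ge1$ be integers and let $\rho>0$. Let $S_n$ be the cumulative profit after $n$ turns to the ensemble of $N$ players playing the nonrandom pattern $(A')^rB^s$ repeatedly (as defined in the context), with arbitrary initial capitals. Let $\mu_{[r,s]}^{(N)}$ and $(\sigma_{[r,s]}^{(N)})^2$ be the mean and variance parameters given by the explicit formulas in the context. Then $$\frac{S_n}{n}\to\mu_{[r,s]}^{(N)}\quad\text{almost surely as }n\to\infty,$$ and, if $(\sigma_{[r,s]}^{(N)})^2>0$, $$\frac{S_n-n\mu_{[r,s]}^{(N)}}{\sqrt{n(\sigma_{[r,s]}^{(N)})^2}}\to_d N(0,1).$$
   Context: The model. There are $N\ge2$ players, each having an integer capital. Put $$p_0:=\frac{\rho^2}{1+\rho^2},\qquad p_1=p_2:=\frac1{1+\rho},\qquad q_j:=1-p_j\quad(j=0,1,2).$$ Game $B$: one of the $N$ players is selected uniformly at random; if his current capital is congruent to $j$ (mod 3), $j\in\{0,1,2\}$, he wins one unit with probability $p_j$ and loses one unit with probability $q_j$. Game $A'$: two distinct players are selected uniformly at random without replacement, and the first transfers one unit of his capital to the second. In the nonrandom pattern $[r,s]$, game $A'$ is played $r$ times, then game $B$ is played $s$ times, and this pattern of $r+s$ turns is repeated forever, random choices at different turns being independent given the current capitals. $S_n$ (with $S_0:=0$) is the total change in the sum of all $N$ players' capitals over the first $n$ turns (each play of $B$ contributes $\pm1$, each play of $A'$ contributes $0$). Mean parameter. Let $$T:=\sqrt{(1+\rho^2)(1+4\rho+\rho^2)},\qquad a_r:=\frac{1-(1-3/N)^r}{3},$$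 $$e_1^\circ:=-\frac12+\frac{(1-\rho)T}{2(1+\rho)(1+\rho^2)},\qquad e_2^\circ:=-\frac12-\frac{(1-\rho)T}{2(1+\rho)(1+\rho^2)},\qquad e_i:=1-\frac{1-e_i^\circ}{N}\ (i=1,2),$$ \begin{align*} E_{r,s}:=\;&3a_r\{[2+(3a_r-1)(e_1^s+e_2^s-2e_1^se_2^s)-(e_1^s+e_2^s)](1-\rho)(1+\rho)T\\ &\quad+a_r(e_2^s-e_1^s)[5(1+\rho)^2(1+\rho^2)-4\rho^2]\}(1-\rho)^2,\\ D_{r,s}:=\;&4(r+s)[1+(3a_r-1)e_1^s][1+(3a_r-1)e_2^s](1+\rho+\rho^2)^2T. \end{align*} Then $\mu_{[r,s]}^{(N)}:=N E_{r,s}/D_{r,s}$. Variance parameter. Let $\Sigma_N:=\{0,1,2\}^N$ (vectors of capitals mod 3). Let $\boldsymbol B$ be the $\Sigma_N\times\Sigma_N$ matrix with $\boldsymbol B(\boldsymbol x,\boldsymbol y)=N^{-1}p_{x_i}$ if $y_i=x_i+1$ (mod 3) and $y_j=x_j$ for $j\ne i$; $\boldsymbol B(\boldsymbol x,\boldsymbol y)=N^{-1}q_{x_i}$ if $y_i=x_i-1$ (mod 3) and $y_j=x_j$ for $j\ne i$; and $0$ otherwise. Let $\boldsymbol A$ be the matrix with $\boldsymbol A(\boldsymbol x,\boldsymbol y)=[N(N-1)]^{-1}$ if for some $i\ne j$ we have $y_i=x_i-1$ (mod 3), $y_j=x_j+1$ (mod 3), $y_k=x_k$ for $k\ne i,j$;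 and $0$ otherwise. Let $\dot{\boldsymbol B}$ be obtained from $\boldsymbol B$ by multiplying the entries corresponding to losses ($y_i=x_i-1$) by $-1$, and let $\ddot{\boldsymbol B}:=\boldsymbol B$ (entries multiplied by the squared payoffs). Let $\boldsymbol\pi$ be the unique stationary distribution (row vector) of $\boldsymbol A^r\boldsymbol B^s$, $\boldsymbol\Pi$ the square matrix each of whose rows is $\boldsymbol\pi$, $\boldsymbol Z:=(\boldsymbol I-(\boldsymbol A^r\boldsymbol B^s-\boldsymbol\Pi))^{-1}$, and $\boldsymbol 1$ the column vector of ones. Then \begin{align*} (\sigma_{[r,s]}^{(N)})^2:=\frac1{r+s}\Big\{&\sum_{v=0}^{s-1}\big[\boldsymbol\pi\boldsymbol A^r\boldsymbol B^v\ddot{\boldsymbol B}\boldsymbol 1-(\boldsymbol\pi\boldsymbol A^r\boldsymbol B^v\dot{\boldsymbol B}\boldsymbol 1)^2\big]\\ &+2\sum_{0\le u<v\le s-1}\boldsymbol\pi\boldsymbol A^r\boldsymbol B^u\dot{\boldsymbol B}(\boldsymbol B^{v-u-1}-\boldsymbol\Pi\boldsymbol A^r\boldsymbol B^v)\dot{\boldsymbol B}\boldsymbol 1\\ &+2\sum_{u=0}^{s-1}\sum_{v=0}^{s-1}\boldsymbol\pi\boldsymbol A^r\boldsymbol B^u\dot{\boldsymbol B}\boldsymbol B^{s-u-1}(\boldsymbol Z-\boldsymbol\Pi)\boldsymbol A^r\boldsymbol B^v\dot{\boldsymbol B}\boldsymbol 1\Big\}. \end{align*} $\to_d$ denotes convergence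 in distribution and $N(0,1)$ the standard normal law. *)

theory Defs
  imports "HOL-Probability.Probability" "HOL-Library.Numeral_Type"
begin

text \<open>
  The players are the elements of a finite type \<open>'n\<close>, so the number of players is \<open>CARD('n)\<close>.
  Residues modulo 3 are elements of the type \<open>3\<close>, whose arithmetic is modulo 3;
  \<open>of_int :: int \<Rightarrow> 3\<close> is reduction modulo 3.
\<close>

definition win_prob :: "real \<Rightarrow> 3 \<Rightarrow> real" where
  "win_prob \<rho> j = (if j = 0 then \<rho>\<^sup>2 / (1 + \<rho>\<^sup>2) else 1 / (1 + \<rho>))"

definition game_B :: "real \<Rightarrow> ('n::finite \<Rightarrow> int) \<Rightarrow> ('n \<Rightarrow> int) pmf" where
  "game_B \<rho> x =
     do {
       i \<leftarrow> pmf_of_set UNIV;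
       win \<leftarrow> bernoulli_pmf (win_prob \<rho> (of_int (x i)));
       return_pmf (x(i := (if win then x i + 1 else x i - 1)))
     }"

definition game_A' :: "('n::finite \<Rightarrow> int) \<Rightarrow> ('n \<Rightarrow> int) pmf" where
  "game_A' x =
     do {
       (i, j) \<leftarrow> pmf_of_set {(i, j). i \<noteq> j};
       return_pmf (x(i := x i - 1, j := x j + 1))
     }"

text \<open>Turns are numbered from 0: turn \<open>n\<close> leads from the capitals after \<open>n\<close> turns to those
  after \<open>n + 1\<close> turns.\<close>

definition turn :: "real \<Rightarrow> nat \<Rightarrow> nat \<Rightarrow> nat \<Rightarrow> ('n::finite \<Rightarrow> int) \<Rightarrow> ('n \<Rightarrow> int) pmf" where
  "turn \<rho> r s n x = (if n mod (r + s) < r then game_A' x else game_B \<rho> x)"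

text \<open>\<open>X n\<close> is the vector of capitals after \<open>n\<close> turns. The last clause is the Markov property
  with the transition law of turn \<open>n\<close>, written for finite paths so that no conditioning on null
  events occurs. The law of \<open>X 0\<close> is arbitrary; deterministic initial capitals are included.\<close>

definition pattern_process ::
  "'a measure \<Rightarrow> real \<Rightarrow> nat \<Rightarrow> nat \<Rightarrow> (nat \<Rightarrow> 'a \<Rightarrow> 'n::finite \<Rightarrow> int) \<Rightarrow> bool" where
  "pattern_process M \<rho> r s X \<longleftrightarrow>
     prob_space M \<and>
     (\<forall>n. X n \<in> M \<rightarrow>\<^sub>M count_space UNIV) \<and>
     (\<forall>n x. measure M {\<omega> \<in> space M. \<forall>k\<le>Suc n. X k \<omega> = x k} =
            measure M {\<omega> \<in> space M. \<forall>k\<le>n. X k \<omega> = x k} * pmf (turn \<rho> r s n (x n)) (x (Suc n)))"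

definition cumulative_profit :: "(nat \<Rightarrow> 'a \<Rightarrow> 'n::finite \<Rightarrow> int) \<Rightarrow> nat \<Rightarrow> 'a \<Rightarrow> int" where
  "cumulative_profit X n \<omega> = (\<Sum>i\<in>UNIV. X n \<omega> i) - (\<Sum>i\<in>UNIV. X 0 \<omega> i)"

definition T_param :: "real \<Rightarrow> real" where
  "T_param \<rho> = sqrt ((1 + \<rho>\<^sup>2) * (1 + 4 * \<rho> + \<rho>\<^sup>2))"

definition a_param :: "nat \<Rightarrow> nat \<Rightarrow> real" where
  "a_param N r = (1 - (1 - 3 / real N) ^ r) / 3"

definition e1_circ :: "real \<Rightarrow> real" where
  "e1_circ \<rho> = - 1 / 2 + (1 - \<rho>) * T_param \<rho> / (2 * (1 + \<rho>) * (1 + \<rho>\<^sup>2))"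

definition e2_circ :: "real \<Rightarrow> real" where
  "e2_circ \<rho> = - 1 / 2 - (1 - \<rho>) * T_param \<rho> / (2 * (1 + \<rho>) * (1 + \<rho>\<^sup>2))"

definition e1 :: "nat \<Rightarrow> real \<Rightarrow> real" where
  "e1 N \<rho> = 1 - (1 - e1_circ \<rho>) / real N"

definition e2 :: "nat \<Rightarrow> real \<Rightarrow> real" where
  "e2 N \<rho> = 1 - (1 - e2_circ \<rho>) / real N"

definition E_param :: "nat \<Rightarrow> real \<Rightarrow> nat \<Rightarrow> nat \<Rightarrow> real" where
  "E_param N \<rho> r s =
     (let a = a_param N r; T = T_param \<rho>; x = e1 N \<rho> ^ s; y = e2 N \<rho> ^ s in
      3 * a *
        ((2 + (3 * a - 1) * (x + y - 2 * x * y) - (x + y)) * (1 - \<rho>) * (1 + \<rho>) * T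
         + a * (y - x) * (5 * (1 + \<rho>)\<^sup>2 * (1 + \<rho>\<^sup>2) - 4 * \<rho>\<^sup>2))
      * (1 - \<rho>)\<^sup>2)"

definition D_param :: "nat \<Rightarrow> real \<Rightarrow> nat \<Rightarrow> nat \<Rightarrow> real" where
  "D_param N \<rho> r s =
     (let a = a_param N r; T = T_param \<rho>; x = e1 N \<rho> ^ s; y = e2 N \<rho> ^ s in
      4 * real (r + s) * (1 + (3 * a - 1) * x) * (1 + (3 * a - 1) * y)
        * (1 + \<rho> + \<rho>\<^sup>2)\<^sup>2 * T)"

definition mean_param :: "nat \<Rightarrow> real \<Rightarrow> nat \<Rightarrow> nat \<Rightarrow> real" where
  "mean_param N \<rho> r s = real N * E_param N \<rho> r s / D_param N \<rho> r s"

text \<open>The power \<open>^\<close> on \<open>real^'m^'m\<close> would be componentwise.\<close>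

primrec matpow :: "real^'m^'m \<Rightarrow> nat \<Rightarrow> real^'m^'m" where
  "matpow A 0 = mat 1"
| "matpow A (Suc n) = A ** matpow A n"

text \<open>In the following two sums at most one summand is nonzero, because \<open>x i - 1\<close>, \<open>x i\<close> and
  \<open>x i + 1\<close> are distinct modulo 3.\<close>

definition B_mat :: "real \<Rightarrow> real^('n::finite \<Rightarrow> 3)^('n \<Rightarrow> 3)" where
  "B_mat \<rho> = (\<chi> x y. \<Sum>i\<in>UNIV.
     if y = x(i := x i + 1) then win_prob \<rho> (x i) / real CARD('n)
     else if y = x(i := x i - 1) then (1 - win_prob \<rho> (x i)) / real CARD('n)
     else 0)"

definition B_dot :: "real \<Rightarrow> real^('n::finite \<Rightarrow> 3)^('n \<Rightarrow> 3)" where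
  "B_dot \<rho> = (\<chi> x y. \<Sum>i\<in>UNIV.
     if y = x(i := x i + 1) then win_prob \<rho> (x i) / real CARD('n)
     else if y = x(i := x i - 1) then - ((1 - win_prob \<rho> (x i)) / real CARD('n))
     else 0)"

text \<open>The squared payoffs are all 1.\<close>

definition B_ddot :: "real \<Rightarrow> real^('n::finite \<Rightarrow> 3)^('n \<Rightarrow> 3)" where
  "B_ddot \<rho> = B_mat \<rho>"

definition A_mat :: "real^('n::finite \<Rightarrow> 3)^('n \<Rightarrow> 3)" where
  "A_mat = (\<chi> x y.
     if \<exists>i j. i \<noteq> j \<and> y = x(i := x i - 1, j := x j + 1)
     then 1 / (real CARD('n) * (real CARD('n) - 1)) else 0)"

definition stationary_distribution :: "real^'m^'m \<Rightarrow> real^'m \<Rightarrow> bool" where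
  "stationary_distribution P \<pi> \<longleftrightarrow>
     (\<forall>x. 0 \<le> \<pi> $ x) \<and> (\<Sum>x\<in>UNIV. \<pi> $ x) = 1 \<and> \<pi> v* P = \<pi>"

definition pattern_mat :: "real \<Rightarrow> nat \<Rightarrow> nat \<Rightarrow> real^('n::finite \<Rightarrow> 3)^('n \<Rightarrow> 3)" where
  "pattern_mat \<rho> r s = matpow A_mat r ** matpow (B_mat \<rho>) s"

definition stat_vec :: "real \<Rightarrow> nat \<Rightarrow> nat \<Rightarrow> real^('n::finite \<Rightarrow> 3)" where
  "stat_vec \<rho> r s = (THE \<pi>. stationary_distribution (pattern_mat \<rho> r s) \<pi>)"

definition Pi_mat :: "real \<Rightarrow> nat \<Rightarrow> nat \<Rightarrow> real^('n::finite \<Rightarrow> 3)^('n \<Rightarrow> 3)" where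
  "Pi_mat \<rho> r s = (\<chi> x. stat_vec \<rho> r s)"

definition Z_mat :: "real \<Rightarrow> nat \<Rightarrow> nat \<Rightarrow> real^('n::finite \<Rightarrow> 3)^('n \<Rightarrow> 3)" where
  "Z_mat \<rho> r s = matrix_inv (mat 1 - (pattern_mat \<rho> r s - Pi_mat \<rho> r s))"

text \<open>In \<open>variance_param\<close>, \<open>m Q\<close> is the scalar \<open>\<pi> Q 1\<close>, where \<open>1\<close> is the column vector of ones.
  The first argument only fixes the type of players.\<close>

definition variance_param :: "'n::finite itself \<Rightarrow> real \<Rightarrow> nat \<Rightarrow> nat \<Rightarrow> real" where
  "variance_param _ \<rho> r s =
     (let m = (\<lambda>Q :: real^('n \<Rightarrow> 3)^('n \<Rightarrow> 3). stat_vec \<rho> r s \<bullet> (Q *v 1));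
          Ar = matpow A_mat r;
          Bp = matpow (B_mat \<rho>);
          B' = B_dot \<rho>;
          B'' = B_ddot \<rho>;
          Pm = Pi_mat \<rho> r s;
          Z = Z_mat \<rho> r s
      in (1 / real (r + s)) *
         ((\<Sum>v<s. m (Ar ** Bp v ** B'') - (m (Ar ** Bp v ** B'))\<^sup>2)
          + 2 * (\<Sum>v<s. \<Sum>u<v.
                   m (Ar ** Bp u ** B' ** (Bp (v - u - 1) - Pm ** Ar ** Bp v) ** B'))
          + 2 * (\<Sum>u<s. \<Sum>v<s.
                   m (Ar ** Bp u ** B' ** Bp (s - u - 1) ** (Z - Pm) ** Ar ** Bp v ** B'))))"

end

theory Submission
  imports Defs
begin

text \<open>
  The pair of cumulative profit and residues modulo 3 is a Markov chain, so
  \<open>E[exp (z S\<^sub>n) f(R\<^sub>n)]\<close> evolves by applying to \<open>f\<close>, turn by turn, the transition operators with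
  gains weighted by \<open>exp z\<close> and losses by \<open>exp (- z)\<close>. Solving two Poisson equations for the
  period chain \<open>A\<^sup>r B\<^sup>s\<close> yields \<open>w = 1 + z h + z\<^sup>2 g\<close> which the operator of a whole period maps to
  \<open>exp (m z + V z\<^sup>2) w + O(z\<^sup>3)\<close>, where \<open>m\<close> and \<open>2 V\<close> are the mean and variance parameters per
  period. Purely imaginary \<open>z\<close> of order \<open>1 / sqrt n\<close> gives the convergence of characteristic functions;
  small real \<open>z\<close> gives exponential bounds on large deviations, whence the strong law by
  Borel-Cantelli. The explicit mean follows because the residue of a single player is itself a
  three-state Markov chain, and the drift of game \<open>B\<close> is a combination of two eigenfunctions
  of that chain.
\<close>

subsection \<open>Stationary distributions and the Poisson equation\<close>

text \<open>No exact eigenvalue is followed in \<open>z\<close>: an error O(z^3) per period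
  suffices. With |z| of order n^(-1/2), about n such errors add up to O(n^(-1/2)); for real z they
  are absorbed into a larger quadratic term of the exponent. Uniqueness of the stationary law and
  solvability of both Poisson equations rest on one property of the period matrix, namely that its
  harmonic functions are constant; a maximum principle along explicit paths of play provides it. The
  mean and variance parameters appear as the solvability conditions of these two equations. The
  capitals range over an infinite set and may start at random, which is why their law is reduced to
  that of profit and residues: the profit starts at 0 and moves by at most 1 per turn, so every law
  has finite support and all expectations are finite sums.\<close>

lemma sum_vector_matrix_mult:
  fixes P :: "real^'m^'m" and v :: "real^'m"
  assumes "P *v 1 = 1"
  shows "(\<Sum>j\<in>UNIV. (v v* P) $ j) = (\<Sum>i\<in>UNIV. v $ i)"
proof -
  have "(\<Sum>j\<in>UNIV. (v v* P) $ j) = (\<Sum>j\<in>UNIV. \<Sum>i\<in>UNIV. P $ i $ j * v $ i)"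
    by (simp add: vector_matrix_mult_def mult.commute)
  also have "\<dots> = (\<Sum>i\<in>UNIV. (P *v 1) $ i * v $ i)"
    by (subst sum.swap) (simp add: matrix_vector_mult_def sum_distrib_right)
  finally show ?thesis by (simp add: assms)
qed

text \<open>The matrix I - P kills the vector of ones, so it and its transpose have determinant 0,
  which gives a nonzero left fixed vector. Its entries may have mixed signs, hence the passage to
  absolute values before normalising.\<close>

lemma exists_stationary_distribution:
  fixes P :: "real^'m^'m"
  assumes nonneg: "\<And>i j. 0 \<le> P $ i $ j" and rows: "P *v 1 = 1"
  shows "\<exists>\<pi>. stationary_distribution P \<pi>"
proof -
  have "(mat 1 - P) *v 1 = 0"
    by (simp add: matrix_vector_mult_diff_rdistrib rows)
  hence "\<not> invertible (mat 1 - P)"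
    by (metis invertible_def matrix_left_invertible_ker zero_neq_one)
  hence "\<not> invertible (transpose (mat 1 - P))"
    by (simp add: invertible_det_nz)
  then obtain v where v: "transpose (mat 1 - P) *v v = 0" "v \<noteq> 0"
    by (metis invertible_left_inverse matrix_left_invertible_ker)
  hence vP: "v v* P = v"
    by (simp add: vector_matrix_mult_diff_distrib vector_matrix_mult_diff_rdistrib transpose_matrix_vector)
  define a :: "real^'m" where "a = (\<chi> i. \<bar>v $ i\<bar>)"
  \<comment> \<open>\<open>\<bar>v\<bar> \<le> \<bar>v\<bar>P\<close> entrywise, and both sides have the same total mass.\<close>
  have le: "a $ j \<le> (a v* P) $ j" for j
  proof -
    have "\<bar>v $ j\<bar> = \<bar>(v v* P) $ j\<bar>" by (simp add: vP)
    also have "\<dots> \<le> (a v* P) $ j"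
      unfolding vector_matrix_mult_def a_def
      by (simp add: order_trans[OF sum_abs] abs_mult nonneg)
    finally show ?thesis by (simp add: a_def)
  qed
  have "(a v* P) $ j = a $ j" for j
  proof -
    have "(\<Sum>j\<in>UNIV. (a v* P) $ j - a $ j) = 0"
      by (simp add: sum_subtractf sum_vector_matrix_mult[OF rows])
    hence "(a v* P) $ j - a $ j = 0"
      using le by (subst (asm) sum_nonneg_eq_0_iff) auto
    thus ?thesis by simp
  qed
  hence aP: "a v* P = a" by (simp add: vec_eq_iff)
  define c where "c = (\<Sum>i\<in>UNIV. a $ i)"
  have "c > 0"
  proof -
    obtain i where "v $ i \<noteq> 0" using v(2) by (auto simp: vec_eq_iff)
    thus ?thesis unfolding c_def a_def by (intro sum_pos2[of _ i]) auto
  qed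
  have "stationary_distribution P ((1 / c) *\<^sub>R a)"
    unfolding stationary_distribution_def
  proof (intro conjI allI)
    show "0 \<le> ((1 / c) *\<^sub>R a) $ x" for x using \<open>c > 0\<close> by (simp add: a_def)
    show "(\<Sum>x\<in>UNIV. ((1 / c) *\<^sub>R a) $ x) = 1"
      using \<open>c > 0\<close> by (simp add: c_def flip: sum_divide_distrib)
    show "((1 / c) *\<^sub>R a) v* P = (1 / c) *\<^sub>R a"
      using aP by (simp add: vec_eq_iff vector_matrix_mult_def flip: sum_divide_distrib)
  qed
  thus ?thesis by blast
qed

text \<open>The second assumption stands in for irreducibility: the eigenspace of P for the
  eigenvalue 1 consists of the constants.\<close>

locale stationary_chain =
  fixes P :: "real^'m^'m" and \<pi> :: "real^'m"
  assumes rows: "P *v 1 = 1"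
    and harmonic_const: "\<And>f i j. P *v f = f \<Longrightarrow> f $ i = f $ j"
    and stationary: "stationary_distribution P \<pi>"
begin

definition Proj :: "real^'m^'m" where "Proj = (\<chi> x. \<pi>)"
text \<open>Its inverse is the fundamental matrix of the chain, the \<open>Z_mat\<close> of the
  theorem when P is the period matrix.\<close>

definition W :: "real^'m^'m" where "W = mat 1 - (P - Proj)"

lemma Proj_mult: "Proj *v f = (\<pi> \<bullet> f) *\<^sub>R 1"
  by (simp add: Proj_def vec_eq_iff matrix_vector_mult_def inner_vec_def)

lemma pi_one: "\<pi> \<bullet> 1 = 1"
  using stationary by (simp add: stationary_distribution_def inner_vec_def)

lemma pi_P: "\<pi> \<bullet> (P *v f) = \<pi> \<bullet> f"
  using stationary by (simp add: stationary_distribution_def dot_lmul_matrix[symmetric])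

lemma W_mult: "W *v f = f - P *v f + (\<pi> \<bullet> f) *\<^sub>R 1"
  by (simp add: W_def matrix_vector_mult_diff_rdistrib Proj_mult)

lemma pi_W: "\<pi> \<bullet> (W *v f) = \<pi> \<bullet> f"
  by (simp add: W_mult inner_diff_right inner_add_right pi_P pi_one)

text \<open>W preserves \<pi>-means, so a kernel vector has mean 0 and is therefore harmonic; being
  constant with mean 0, it vanishes.\<close>

lemma invertible_W: "invertible W"
proof -
  have "f = 0" if "W *v f = 0" for f
  proof -
    have 0: "\<pi> \<bullet> f = 0" using pi_W[of f] that by simp
    hence "P *v f = f" using that by (simp add: W_mult)
    hence "f = (f $ undefined) *\<^sub>R 1" by (simp add: vec_eq_iff harmonic_const)
    thus "f = 0" using 0 pi_one by (metis inner_scaleR_right mult.right_neutral scale_zero_left)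
  qed
  thus ?thesis by (simp add: invertible_left_inverse matrix_left_invertible_ker)
qed

lemma W_inv: "W *v (matrix_inv W *v f) = f"
proof -
  have "W ** matrix_inv W = mat 1"
    using someI_ex[OF invertible_W[unfolded invertible_def]] by (simp add: matrix_inv_def)
  thus ?thesis by (simp add: matrix_vector_mul_assoc)
qed

lemma pi_inv: "\<pi> \<bullet> (matrix_inv W *v f) = \<pi> \<bullet> f"
  using pi_W[of "matrix_inv W *v f"] by (simp add: W_inv)

lemma pi_poisson: "\<pi> \<bullet> ((matrix_inv W - Proj) *v f) = 0"
  by (simp add: matrix_vector_mult_diff_rdistrib inner_diff_right pi_inv Proj_mult pi_one)

text \<open>\<open>matrix_inv W - Proj\<close> is the deviation matrix. It produces functions of
  \<pi>-mean 0, on which W acts as I - P.\<close>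

lemma poisson:
  fixes f defines "h \<equiv> (matrix_inv W - Proj) *v f"
  shows "h + (\<pi> \<bullet> f) *\<^sub>R 1 = P *v h + f"
proof -
  have "W *v h = f - (\<pi> \<bullet> f) *\<^sub>R 1"
    by (simp add: h_def matrix_vector_mult_diff_rdistrib matrix_vector_mult_diff_distrib W_inv
        Proj_mult matrix_vector_mult_scaleR W_mult[of 1] rows pi_one)
  moreover have "\<pi> \<bullet> h = 0" by (simp add: h_def pi_poisson)
  ultimately show ?thesis by (simp add: W_mult algebra_simps)
qed

text \<open>Every stationary \<pi>' satisfies \<pi>' W = \<pi>, an equation whose right side does
  not depend on \<pi>' and whose matrix is invertible.\<close>

lemma stationary_unique:
  assumes "stationary_distribution P \<pi>'"
  shows "\<pi>' = \<pi>"
proof -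
  have eq: "\<pi>' \<bullet> (W *v f) = \<pi> \<bullet> f" for f
  proof -
    have "\<pi>' \<bullet> (P *v f) = \<pi>' \<bullet> f" "\<pi>' \<bullet> 1 = 1"
      using assms by (simp_all add: stationary_distribution_def dot_lmul_matrix[symmetric])
        (simp add: inner_vec_def)
    thus ?thesis by (simp add: W_mult inner_diff_right inner_add_right)
  qed
  have "\<pi>' \<bullet> f = \<pi> \<bullet> f" for f
    using eq[of "matrix_inv W *v f"] by (simp add: W_inv pi_inv)
  thus ?thesis by (metis vector_eq_rdot)
qed

lemma the_stationary: "(THE \<pi>'. stationary_distribution P \<pi>') = \<pi>"
  using stationary stationary_unique by blast

end

subsection \<open>The two games as operators\<close>

lemma residue_distinct: "(x::3) + 1 \<noteq> x - 1" "x - 1 \<noteq> x + 1" "x + 1 \<noteq> x" "x - 1 \<noteq> x"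
proof -
  have 1: "(1::3) \<noteq> 0" "(1::3) \<noteq> -1" "(2::3) \<noteq> 0" by simp_all
  show "x + 1 \<noteq> x - 1" "x - 1 \<noteq> x + 1" "x + 1 \<noteq> x" "x - 1 \<noteq> x"
    using 1 by (auto simp: algebra_simps)
qed

text \<open>Gains are weighted by \<open>u\<close> and losses by \<open>v\<close>: the weights \<open>1, 1\<close> give \<open>B\<close>, the weights
  \<open>1, -1\<close> its dotted version, and \<open>exp z, exp (- z)\<close> the generating function of the profit.\<close>

definition bet ::
  "real \<Rightarrow> 'b \<Rightarrow> 'b \<Rightarrow> (('n::finite \<Rightarrow> 3) \<Rightarrow> 'b::real_algebra_1) \<Rightarrow> ('n \<Rightarrow> 3) \<Rightarrow> 'b" where
  "bet \<rho> u v f x = (\<Sum>i\<in>UNIV. win_prob \<rho> (x i) *\<^sub>R (u * f (x(i := x i + 1)))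
      + (1 - win_prob \<rho> (x i)) *\<^sub>R (v * f (x(i := x i - 1)))) /\<^sub>R real CARD('n)"

definition transfer :: "(('n::finite \<Rightarrow> 3) \<Rightarrow> 'b::real_vector) \<Rightarrow> ('n \<Rightarrow> 3) \<Rightarrow> 'b" where
  "transfer f x = (\<Sum>(i, j)\<in>{(i, j). i \<noteq> j}. f (x(i := x i - 1, j := x j + 1)))
      /\<^sub>R real (card {(i, j :: 'n). i \<noteq> j})"

lemma card_offdiagonal: "card {(i, j :: 'n::finite). i \<noteq> j} = CARD('n) * (CARD('n) - 1)"
proof -
  have "{(i, j :: 'n). i \<noteq> j} = UNIV - (\<lambda>i. (i, i)) ` UNIV" by auto
  moreover have "card (UNIV - (\<lambda>i::'n. (i, i)) ` UNIV) = CARD('n \<times> 'n) - CARD('n)"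
    by (subst card_Diff_subset) (auto simp: card_image inj_on_def)
  ultimately show ?thesis by (simp add: card_cartesian_product algebra_simps)
qed

lemma win_prob_bounds: "0 < win_prob \<rho> j" "win_prob \<rho> j < 1" if "\<rho> > 0"
  using that by (auto simp: win_prob_def field_simps add_pos_pos)

lemma sum_two_targets:
  fixes g :: "('n::finite \<Rightarrow> 3) \<Rightarrow> real"
  shows "(\<Sum>y\<in>UNIV. (if y = x(i := x i + 1) then a else if y = x(i := x i - 1) then b else 0) * g y)
    = a * g (x(i := x i + 1)) + b * g (x(i := x i - 1))"
proof -
  have ne: "x(i := x i + 1) \<noteq> x(i := x i - 1)"
    using residue_distinct by (metis fun_upd_same)
  have "(\<Sum>y\<in>UNIV. (if y = x(i := x i + 1) then a else if y = x(i := x i - 1) then b else 0) * g y)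
    = (\<Sum>y\<in>UNIV. (if y = x(i := x i + 1) then a * g y else 0) + (if y = x(i := x i - 1) then b * g y else 0))"
    using ne by (intro sum.cong) auto
  thus ?thesis by (simp add: sum.distrib)
qed

lemma B_mat_mult: "(B_mat \<rho> *v f) $ x = bet \<rho> 1 1 (($) f) x"
proof -
  have "(B_mat \<rho> *v f) $ x = (\<Sum>i\<in>UNIV. \<Sum>y\<in>UNIV. (if y = x(i := x i + 1)
      then win_prob \<rho> (x i) / real CARD('a) else if y = x(i := x i - 1)
      then (1 - win_prob \<rho> (x i)) / real CARD('a) else 0) * f $ y)"
    unfolding matrix_vector_mult_def B_mat_def
    by (subst sum.swap) (simp add: sum_distrib_right)
  thus ?thesis
    unfolding sum_two_targets bet_def
    by (simp add: sum_distrib_left divide_inverse_commute algebra_simps)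
qed

lemma B_dot_mult: "(B_dot \<rho> *v f) $ x = bet \<rho> 1 (-1) (($) f) x"
proof -
  have "(B_dot \<rho> *v f) $ x = (\<Sum>i\<in>UNIV. \<Sum>y\<in>UNIV. (if y = x(i := x i + 1)
      then win_prob \<rho> (x i) / real CARD('a) else if y = x(i := x i - 1)
      then - ((1 - win_prob \<rho> (x i)) / real CARD('a)) else 0) * f $ y)"
    unfolding matrix_vector_mult_def B_dot_def
    by (subst sum.swap) (simp add: sum_distrib_right)
  thus ?thesis
    unfolding sum_two_targets bet_def
    by (simp add: sum_distrib_left divide_inverse_commute algebra_simps)
qed

text \<open>Modulo 3 the shifts -1, 0 and +1 are distinct, so the target reveals who gave and who
  received. Hence the existence condition in \<open>A_mat\<close> assigns each target the weight of
  exactly one pair.\<close>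

lemma transfer_target_inj:
  fixes x :: "'n \<Rightarrow> 3"
  shows "inj_on (\<lambda>(i, j). x(i := x i - 1, j := x j + 1)) {(i, j). i \<noteq> j}"
proof (rule inj_onI, clarify)
  fix i j k l :: 'n
  assume ij: "i \<noteq> j" and kl: "k \<noteq> l"
    and eq: "x(i := x i - 1, j := x j + 1) = x(k := x k - 1, l := x l + 1)"
  have "j = l"
  proof (rule ccontr)
    assume "j \<noteq> l"
    from fun_cong[OF eq, of j] this show False
      using residue_distinct[of "x j"] ij by (auto split: if_splits)
  qed
  moreover have "i = k"
  proof (rule ccontr)
    assume "i \<noteq> k"
    from fun_cong[OF eq, of i] this show False
      using residue_distinct[of "x i"] ij by (auto split: if_splits)
  qed
  ultimately show "i = k \<and> j = l" by simp
qed

lemma A_mat_mult: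
  assumes "2 \<le> CARD('n::finite)"
  shows "(A_mat *v f) $ x = transfer (($) f) (x :: 'n \<Rightarrow> 3)"
proof -
  let ?D = "{(i, j :: 'n). i \<noteq> j}"
  let ?t = "\<lambda>(i, j). x(i := x i - 1, j := x j + 1)"
  have "(\<exists>i j. i \<noteq> j \<and> y = x(i := x i - 1, j := x j + 1)) \<longleftrightarrow> y \<in> ?t ` ?D" for y
    by auto
  hence "(A_mat *v f) $ x = (\<Sum>y\<in>UNIV. if y \<in> ?t ` ?D then f $ y / real (card ?D) else 0)"
    unfolding matrix_vector_mult_def A_mat_def
    using assms by (auto intro!: sum.cong simp: card_offdiagonal of_nat_diff)
  also have "\<dots> = (\<Sum>y\<in>?t ` ?D. f $ y / real (card ?D))"
    by (simp add: sum.If_cases)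
  also have "\<dots> = (\<Sum>p\<in>?D. f $ (?t p) / real (card ?D))"
    by (subst sum.reindex[OF transfer_target_inj]) simp
  finally show ?thesis
    by (simp add: transfer_def sum_distrib_left divide_inverse_commute case_prod_unfold)
qed

lemma A_mat_nonneg: "0 \<le> A_mat $ x $ (y :: 'n::finite \<Rightarrow> 3)"
  by (cases "CARD('n)") (auto simp: A_mat_def)

lemma B_mat_nonneg: "0 < \<rho> \<Longrightarrow> 0 \<le> B_mat \<rho> $ x $ y"
  unfolding B_mat_def using win_prob_bounds[of \<rho>]
  by (auto intro!: sum_nonneg simp: less_imp_le)

lemma transfer_const:
  assumes "2 \<le> CARD('n::finite)"
  shows "transfer (\<lambda>_ :: 'n \<Rightarrow> 3. c) x = c"
proof -
  have "card {(i, j :: 'n). i \<noteq> j} \<noteq> 0" using assms by (simp add: card_offdiagonal)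
  thus ?thesis by (simp add: transfer_def case_prod_unfold sum_constant_scaleR del: sum_constant)
qed

lemma bet_const: "bet \<rho> 1 1 (\<lambda>_. c) x = c"
  by (simp add: bet_def sum_constant_scaleR del: sum_constant flip: scaleR_left_distrib)

lemma one_vec_app: "($) 1 = (\<lambda>_. 1)"
  by (simp add: fun_eq_iff)

lemma A_mat_one: "2 \<le> CARD('n::finite) \<Longrightarrow> A_mat *v (1 :: real^('n \<Rightarrow> 3)) = 1"
  by (simp add: vec_eq_iff A_mat_mult one_vec_app transfer_const)

lemma B_mat_one: "B_mat \<rho> *v 1 = 1"
  by (simp add: vec_eq_iff B_mat_mult one_vec_app bet_const)

lemma matpow_one: "Q *v 1 = 1 \<Longrightarrow> matpow Q n *v 1 = 1"
  by (induction n) (simp_all flip: matrix_vector_mul_assoc)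

lemma matpow_nonneg:
  assumes "\<And>i j. 0 \<le> (Q :: real^'m^'m) $ i $ j"
  shows "0 \<le> matpow Q n $ i $ j"
  by (induction n arbitrary: i j)
     (auto simp: mat_def matrix_matrix_mult_def assms intro!: sum_nonneg)

section \<open>Maximum principle and constancy of harmonic functions\<close>

lemma average_eq_bound:
  fixes w g :: "'b \<Rightarrow> real"
  assumes "finite S" "\<And>i. i \<in> S \<Longrightarrow> 0 < w i" "\<And>i. i \<in> S \<Longrightarrow> g i \<le> c"
    and "(\<Sum>i\<in>S. w i * g i) = c * sum w S" "k \<in> S"
  shows "g k = c"
proof -
  have "(\<Sum>i\<in>S. w i * (c - g i)) = 0"
    using assms(4) by (simp add: right_diff_distrib sum_subtractf sum_distrib_left mult.commute)
  moreover have "0 \<le> w i * (c - g i)" if "i \<in> S" for i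
    using assms(2,3)[OF that] by simp
  ultimately have "w k * (c - g k) = 0"
    using assms(1,5) by (simp add: sum_nonneg_eq_0_iff)
  thus ?thesis using assms(2)[OF assms(5)] by simp
qed

lemma A_mat_max:
  fixes f :: "real^('n::finite \<Rightarrow> 3)"
  assumes N: "2 \<le> CARD('n)" and le: "\<And>y. f $ y \<le> c" and eq: "(A_mat *v f) $ x = c"
    and "i \<noteq> j"
  shows "f $ (x(i := x i - 1, j := x j + 1)) = c"
proof -
  let ?D = "{(i, j :: 'n). i \<noteq> j}"
  have "card ?D > 0" using N by (simp add: card_offdiagonal)
  hence "(\<Sum>p\<in>?D. 1 * f $ (case p of (i, j) \<Rightarrow> x(i := x i - 1, j := x j + 1))) = c * sum (\<lambda>_. 1) ?D"
    using eq by (auto simp: A_mat_mult[OF N] transfer_def field_simps case_prod_unfold)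
  from average_eq_bound[OF _ _ _ this, of "(i, j)"] show ?thesis
    using le \<open>i \<noteq> j\<close> by auto
qed

lemma B_mat_max:
  fixes f :: "real^('n::finite \<Rightarrow> 3)"
  assumes \<rho>: "0 < \<rho>" and le: "\<And>y. f $ y \<le> c" and eq: "(B_mat \<rho> *v f) $ x = c"
  shows "f $ (x(i := x i + 1)) = c" "f $ (x(i := x i - 1)) = c"
proof -
  \<comment> \<open>Player and outcome together form one index set, so that the bet becomes a single
    average with strictly positive weights.\<close>
  define w where "w = (\<lambda>(i :: 'n, b). if b then win_prob \<rho> (x i) else 1 - win_prob \<rho> (x i))"
  define g where "g = (\<lambda>(i :: 'n, b). f $ (if b then x(i := x i + 1) else x(i := x i - 1)))"
  have sum2: "sum F UNIV = (\<Sum>i\<in>UNIV. F (i, True) + F (i, False))" for F :: "'n \<times> bool \<Rightarrow> real"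
    unfolding UNIV_Times_UNIV[symmetric] sum.cartesian_product' by (simp add: UNIV_bool add.commute)
  have "(\<Sum>p\<in>UNIV. w p * g p) = c * sum w UNIV"
    using eq by (simp add: B_mat_mult bet_def sum2 w_def g_def field_simps)
  hence "g (i, b) = c" for b
    using average_eq_bound[of UNIV w g c "(i, b)"] le win_prob_bounds[OF \<rho>]
    by (auto simp: w_def g_def split: prod.splits)
  from this[of True] this[of False]
  show "f $ (x(i := x i + 1)) = c" "f $ (x(i := x i - 1)) = c" by (simp_all add: g_def)
qed

lemma matpow_mult_le:
  fixes f :: "real^'m"
  assumes "Q *v 1 = 1" "\<And>i j. 0 \<le> (Q :: real^'m^'m) $ i $ j" "\<And>y. f $ y \<le> c"
  shows "(matpow Q n *v f) $ y \<le> c"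
proof -
  have "(matpow Q n *v f) $ y \<le> (matpow Q n *v (c *\<^sub>R 1)) $ y"
    unfolding matrix_vector_mult_def
    by (auto intro!: sum_mono mult_left_mono matpow_nonneg assms)
  thus ?thesis by (simp add: matrix_vector_mult_scaleR matpow_one assms)
qed

text \<open>The path followed is the one on which the same player wins, or loses, all
  \<open>n\<close> bets. The functions obtained by fewer bets are still bounded by \<open>c\<close>,
  so the maximum principle applies at every step.\<close>

lemma B_pow_max:
  fixes f :: "real^('n::finite \<Rightarrow> 3)"
  assumes \<rho>: "0 < \<rho>" and le: "\<And>y. f $ y \<le> c"
  shows "(matpow (B_mat \<rho>) n *v f) $ x = c \<Longrightarrow> f $ (x(i := x i + of_nat n)) = c"
    and "(matpow (B_mat \<rho>) n *v f) $ x = c \<Longrightarrow> f $ (x(i := x i - of_nat n)) = c"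
proof (induction n arbitrary: x)
  case (Suc n)
  {
    case 1
    hence "(B_mat \<rho> *v (matpow (B_mat \<rho>) n *v f)) $ x = c"
      by (simp add: matrix_vector_mul_assoc)
    note step = B_mat_max(1)[OF \<rho> matpow_mult_le[OF B_mat_one B_mat_nonneg[OF \<rho>] le] this]
    have "f $ ((x(i := x i + 1))(i := (x(i := x i + 1)) i + of_nat n)) = c"
      by (rule Suc.IH(1)[OF step])
    moreover have "(x(i := x i + 1))(i := (x(i := x i + 1)) i + of_nat n) = x(i := x i + of_nat (Suc n))"
      by (simp add: add.assoc)
    ultimately show ?case by metis
  next
    case 2
    hence "(B_mat \<rho> *v (matpow (B_mat \<rho>) n *v f)) $ x = c"
      by (simp add: matrix_vector_mul_assoc)
    note step = B_mat_max(2)[OF \<rho> matpow_mult_le[OF B_mat_one B_mat_nonneg[OF \<rho>] le] this]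
    have "f $ ((x(i := x i - 1))(i := (x(i := x i - 1)) i - of_nat n)) = c"
      by (rule Suc.IH(2)[OF step])
    moreover have "(x(i := x i - 1))(i := (x(i := x i - 1)) i - of_nat n) = x(i := x i - of_nat (Suc n))"
      by (simp add: diff_diff_add)
    ultimately show ?case by metis
  }
qed simp_all

lemma A_pow_max:
  fixes f :: "real^('n::finite \<Rightarrow> 3)"
  assumes N: "2 \<le> CARD('n)" and le: "\<And>y. f $ y \<le> c" and "i \<noteq> j"
    and "(matpow A_mat n *v f) $ x = c"
  shows "f $ (x(i := x i - of_nat n, j := x j + of_nat n)) = c"
  using assms(4)
proof (induction n arbitrary: x)
  case (Suc n)
  hence *: "(A_mat *v (matpow A_mat n *v f)) $ x = c"
    by (simp add: matrix_vector_mul_assoc)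
  let ?y = "x(i := x i - 1, j := x j + 1)"
  have "f $ (?y(i := ?y i - of_nat n, j := ?y j + of_nat n)) = c"
    by (rule Suc.IH[OF A_mat_max[OF N matpow_mult_le[OF A_mat_one[OF N] A_mat_nonneg le] * \<open>i \<noteq> j\<close>]])
  moreover have "?y(i := ?y i - of_nat n, j := ?y j + of_nat n)
      = x(i := x i - of_nat (Suc n), j := x j + of_nat (Suc n))"
    using \<open>i \<noteq> j\<close> by (auto simp: fun_eq_iff)
  ultimately show ?case by metis
qed simp

lemma pattern_mat_one: "2 \<le> CARD('n::finite) \<Longrightarrow> pattern_mat \<rho> r s *v (1 :: real^('n \<Rightarrow> 3)) = 1"
  by (simp add: pattern_mat_def matpow_one A_mat_one B_mat_one flip: matrix_vector_mul_assoc)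

lemma pattern_mat_nonneg: "0 < \<rho> \<Longrightarrow> 0 \<le> pattern_mat \<rho> r s $ x $ y"
  by (auto simp: pattern_mat_def matrix_matrix_mult_def intro!: sum_nonneg mult_nonneg_nonneg
      matpow_nonneg A_mat_nonneg B_mat_nonneg)

text \<open>Two periods can move a single player by \<open>2\<close>, that is, by \<open>-1\<close>: the transfers of the second
  period undo those of the first, and so do all bets of the second period but one.\<close>

lemma harmonic_max_step:
  fixes f :: "real^('n::finite \<Rightarrow> 3)"
  assumes N: "2 \<le> CARD('n)" and s: "1 \<le> s" and \<rho>: "0 < \<rho>"
    and harmonic: "pattern_mat \<rho> r s *v f = f" and le: "\<And>y. f $ y \<le> c" and x: "f $ x = c"
  shows "f $ (x(i := x i - 1)) = c"
proof -
  obtain j where ij: "i \<noteq> j"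
  proof -
    have "UNIV \<noteq> {i}"
    proof
      assume *: "UNIV = {i}"
      show False using N by (simp add: *)
    qed
    hence "\<exists>j. i \<noteq> j" by auto
    thus ?thesis using that by blast
  qed
  note leB = matpow_mult_le[OF B_mat_one B_mat_nonneg[OF \<rho>] le]
  have period: "(matpow (B_mat \<rho>) s *v f) $ (y(k := y k - of_nat r, l := y l + of_nat r)) = c"
    if "f $ y = c" "k \<noteq> l" for y k l
    by (rule A_pow_max[OF N leB that(2)])
       (use harmonic that(1) in \<open>simp add: pattern_mat_def matrix_vector_mul_assoc\<close>)
  \<comment> \<open>The state after one period in which \<open>i\<close> gave \<open>r\<close> units
    to \<open>j\<close> and then won all \<open>s\<close> bets.\<close>
  define y where "y = x(i := x i - of_nat r + of_nat s, j := x j + of_nat r)"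
  have y: "f $ y = c"
    using B_pow_max(1)[OF \<rho> le period[OF x ij], of i] ij by (simp add: y_def fun_upd_twist)
  \<comment> \<open>In the second period \<open>j\<close> returns the \<open>r\<close> units; one
    more win and s - 1 losses then leave player \<open>i\<close> at s + 1 - (s - 1) = 2 above
    \<open>x i\<close>.\<close>
  let ?z = "x(i := x i + of_nat s)"
  obtain s' where s': "s = Suc s'" using s by (cases s) auto
  have "(matpow (B_mat \<rho>) s *v f) $ ?z = c"
    using period[OF y, of j i] ij by (simp add: y_def fun_upd_twist)
  hence "(B_mat \<rho> *v (matpow (B_mat \<rho>) s' *v f)) $ ?z = c"
    by (simp add: s' matrix_vector_mul_assoc)
  from B_mat_max(1)[OF \<rho> matpow_mult_le[OF B_mat_one B_mat_nonneg[OF \<rho>] le] this, of i]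
  have "(matpow (B_mat \<rho>) s' *v f) $ (x(i := x i + of_nat s + 1)) = c" by simp
  from B_pow_max(2)[OF \<rho> le this, of i]
  have "f $ (x(i := x i + 2)) = c" by (simp add: s' algebra_simps)
  moreover have "(2::3) = - 1" by simp
  ultimately show ?thesis by (metis diff_conv_add_uminus)
qed

text \<open>The set where the maximum is attained is nonempty and closed under lowering one
  coordinate by 1. Modulo 3 this lets every coordinate take every value, and changing the
  coordinates one by one reaches every state.\<close>

lemma harmonic_const:
  fixes f :: "real^('n::finite \<Rightarrow> 3)"
  assumes N: "2 \<le> CARD('n)" and s: "1 \<le> s" and \<rho>: "0 < \<rho>"
    and harmonic: "pattern_mat \<rho> r s *v f = f"
  shows "f $ x = f $ y"
proof -
  define c where "c = Max (range (($) f))"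
  have le: "f $ y \<le> c" for y by (simp add: c_def)
  have "c \<in> range (($) f)" unfolding c_def by (rule Max_in) auto
  then obtain x0 where x0: "f $ x0 = c" by auto
  note step = harmonic_max_step[OF N s \<rho> harmonic le]
  have shift: "f $ (x(i := x i - of_nat n)) = c" if "f $ x = c" for x i n
  proof (induction n)
    case (Suc n)
    let ?y = "x(i := x i - of_nat n)"
    have "?y(i := ?y i - 1) = x(i := x i - of_nat (Suc n))" by (simp add: diff_diff_add add.commute)
    thus ?case using step[OF Suc, of i] by metis
  qed (use that in simp)
  have val: "f $ (x(i := a)) = c" if "f $ x = c" for x i a
  proof -
    \<comment> \<open>Lowering \<open>x i\<close> by 1 this many times reaches
      \<open>a\<close>.\<close>
    obtain k :: int where "x i - a = of_int k" "0 \<le> k"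
      by (cases "x i - a" rule: bit1.cases) auto
    hence "a = x i - of_nat (nat k)" by (simp add: algebra_simps)
    thus ?thesis using shift[OF that, of i] by metis
  qed
  have "f $ (\<lambda>i. if i \<in> S then x i else x0 i) = c" if "finite S" for S x
    using that
  proof induction
    case (insert k S)
    have "(\<lambda>i. if i \<in> insert k S then x i else x0 i) = (\<lambda>i. if i \<in> S then x i else x0 i)(k := x k)"
      by auto
    thus ?case using val[OF insert.IH] by simp
  qed (simp add: x0)
  from this[OF finite, of UNIV] show ?thesis by simp
qed

subsection \<open>Second-order expansions\<close>

text \<open>The coefficients are real because they will be entries of real matrix-vector products.
  The filter says nothing at z = 0, hence the condition \<open>z \<noteq> 0\<close> on the estimates
  derived from such expansions.\<close>

definition jet2 :: "(complex \<Rightarrow> complex) \<Rightarrow> real \<Rightarrow> real \<Rightarrow> real \<Rightarrow> bool" where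
  "jet2 F a b c \<longleftrightarrow> (\<lambda>z. F z - (of_real a + of_real b * z + of_real c * z\<^sup>2)) \<in> O[at 0](\<lambda>z. z ^ 3)"

lemma powers_bigo: "k \<ge> 3 \<Longrightarrow> (\<lambda>z::complex. z ^ k) \<in> O[at 0](\<lambda>z. z ^ 3)"
proof (rule bigoI[of _ 1])
  assume "k \<ge> 3"
  have "eventually (\<lambda>z::complex. norm z < 1) (at 0)"
    by (auto simp: eventually_at intro!: exI[of _ 1])
  thus "\<forall>\<^sub>F z::complex in at 0. norm (z ^ k) \<le> 1 * norm (z ^ 3)"
    by eventually_elim (auto simp: norm_power \<open>k \<ge> 3\<close> intro!: power_decreasing)
qed

text \<open>Covers the terms of degree 3 and 4 left over when two quadratic polynomials are
  multiplied or one is squared inside the exponential series.\<close>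

lemma cubic_bigo: "(\<lambda>z. of_real a * z ^ 3 + of_real b * z ^ 4) \<in> O[at (0::complex)](\<lambda>z. z ^ 3)"
proof -
  have "(\<lambda>z::complex. of_real c * z ^ k) \<in> O[at 0](\<lambda>z. z ^ 3)" if "3 \<le> k" for c k
    by (cases "c = 0") (use powers_bigo[OF that] in simp_all)
  thus ?thesis by (intro sum_in_bigo(1)) simp_all
qed

lemma jet2_poly: "jet2 (\<lambda>z. of_real a + of_real b * z + of_real c * z\<^sup>2) a b c"
  by (simp add: jet2_def)

lemma jet2_add: "jet2 F a b c \<Longrightarrow> jet2 G a' b' c' \<Longrightarrow> jet2 (\<lambda>z. F z + G z) (a + a') (b + b') (c + c')"
  unfolding jet2_def by (drule (1) sum_in_bigo(1)) (simp add: algebra_simps)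

lemma jet2_sum:
  assumes "\<And>i. i \<in> S \<Longrightarrow> jet2 (F i) (a i) (b i) (c i)"
  shows "jet2 (\<lambda>z. \<Sum>i\<in>S. F i z) (sum a S) (sum b S) (sum c S)"
proof (cases "finite S")
  case True
  thus ?thesis using assms
  proof induction
    case empty
    show ?case by (simp add: jet2_def)
  next
    case (insert i S)
    thus ?case by (simp add: jet2_add)
  qed
qed (simp add: jet2_def)

lemma tendsto_imp_bigo_1: "(f \<longlongrightarrow> c) F \<Longrightarrow> f \<in> O[F](\<lambda>_. 1 :: complex)"
  for f :: "complex \<Rightarrow> complex"
  by (rule bigoI_tendsto[of _ _ c]) simp_all

lemma jet2_bigo_1:
  assumes "jet2 F a b c" shows "F \<in> O[at 0](\<lambda>_. 1)"
proof -
  have 1: "(\<lambda>z. F z - (of_real a + of_real b * z + of_real c * z\<^sup>2)) \<in> O[at 0](\<lambda>_. 1)"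
    using assms unfolding jet2_def
    by (rule landau_o.big_trans) (rule tendsto_imp_bigo_1, (rule tendsto_intros)+)
  have 2: "(\<lambda>z. of_real a + of_real b * z + of_real c * z\<^sup>2) \<in> O[at (0::complex)](\<lambda>_. 1)"
    by (rule tendsto_imp_bigo_1, (rule tendsto_intros)+)
  show ?thesis using sum_in_bigo(1)[OF 1 2] by simp
qed

text \<open>With p and q the quadratic parts, F G - p q = (F - p) G + p (G - q), and p q exceeds its
  own quadratic part by terms of degree 3 and 4.\<close>

lemma jet2_mult:
  assumes F: "jet2 F a b c" and G: "jet2 G a' b' c'"
  shows "jet2 (\<lambda>z. F z * G z) (a * a') (a * b' + b * a') (a * c' + b * b' + c * a')"
proof -
  define p where "p = (\<lambda>z::complex. of_real a + of_real b * z + of_real c * z\<^sup>2)"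
  define q where "q = (\<lambda>z::complex. of_real a' + of_real b' * z + of_real c' * z\<^sup>2)"
  have p1: "p \<in> O[at 0](\<lambda>_. 1)"
    unfolding p_def by (rule tendsto_imp_bigo_1, (rule tendsto_intros)+)
  have 1: "(\<lambda>z. (F z - p z) * G z) \<in> O[at 0](\<lambda>z. z ^ 3 * 1)"
    using F jet2_bigo_1[OF G] unfolding jet2_def p_def by (intro landau_o.big.mult) auto
  have 2: "(\<lambda>z. p z * (G z - q z)) \<in> O[at 0](\<lambda>z. 1 * z ^ 3)"
    using G p1 unfolding jet2_def q_def by (intro landau_o.big.mult) auto
  have 3: "(\<lambda>z. of_real (b * c' + c * b') * z ^ 3 + of_real (c * c') * z ^ 4) \<in> O[at (0::complex)](\<lambda>z. z ^ 3)"
    by (rule cubic_bigo)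
  have "(\<lambda>z. (F z - p z) * G z + p z * (G z - q z)
      + (of_real (b * c' + c * b') * z ^ 3 + of_real (c * c') * z ^ 4)) \<in> O[at 0](\<lambda>z. z ^ 3)"
    using sum_in_bigo(1)[OF sum_in_bigo(1)[OF 1[simplified] 2[simplified]] 3] .
  thus ?thesis
    unfolding jet2_def
    by (rule back_subst[of "\<lambda>f. f \<in> _"])
       (simp add: fun_eq_iff p_def q_def algebra_simps power2_eq_square power3_eq_cube power4_eq_xxxx)
qed

lemma jet2_cmult: "jet2 F a b c \<Longrightarrow> jet2 (\<lambda>z. r *\<^sub>R F z) (r * a) (r * b) (r * c)"
  using jet2_mult[OF jet2_poly[of r 0 0], of F a b c] by (simp add: scaleR_conv_of_real)

lemma exp_taylor2: "norm (exp w - (1 + w + w\<^sup>2 / 2)) \<le> exp (norm w) * norm (w :: complex) ^ 3"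
proof -
  have "norm (exp w - (\<Sum>i\<le>2. w ^ i / fact i)) \<le> exp \<bar>Re w\<bar> * norm w ^ Suc 2 / fact 2"
    by (rule Taylor_exp)
  also have "\<dots> \<le> exp (norm w) * norm w ^ 3"
  proof -
    have "exp \<bar>Re w\<bar> * norm w ^ Suc 2 / fact 2 \<le> exp \<bar>Re w\<bar> * norm w ^ 3 / 1"
      by (intro frac_le) (auto simp: eval_nat_numeral)
    also have "\<dots> \<le> exp (norm w) * norm w ^ 3 / 1"
      by (intro divide_right_mono mult_right_mono) (auto simp: abs_Re_le_cmod)
    finally show ?thesis by simp
  qed
  finally show ?thesis by (simp add: eval_nat_numeral)
qed

text \<open>For |z| < 1 the exponent is at most (|m| + |v|) |z| in modulus, so the Taylor remainder
  of exp is cubic in z. The square of the linear term contributes m^2 / 2 to the last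
  coefficient.\<close>

lemma jet2_exp: "jet2 (\<lambda>z. exp (of_real m * z + of_real v * z\<^sup>2)) 1 m (m\<^sup>2 / 2 + v)"
proof -
  have lin: "(\<lambda>z. exp (of_real m * z + of_real v * z\<^sup>2) - (1 + (of_real m * z + of_real v * z\<^sup>2)
      + (of_real m * z + of_real v * z\<^sup>2)\<^sup>2 / 2)) \<in> O[at 0](\<lambda>z::complex. z ^ 3)"
  proof (rule bigoI)
    have "eventually (\<lambda>z::complex. norm z < 1) (at 0)"
      by (auto simp: eventually_at intro!: exI[of _ 1])
    thus "\<forall>\<^sub>F z::complex in at 0. norm (exp (of_real m * z + of_real v * z\<^sup>2)
        - (1 + (of_real m * z + of_real v * z\<^sup>2) + (of_real m * z + of_real v * z\<^sup>2)\<^sup>2 / 2))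
        \<le> (exp (\<bar>m\<bar> + \<bar>v\<bar>) * (\<bar>m\<bar> + \<bar>v\<bar>) ^ 3) * norm (z ^ 3)"
    proof eventually_elim
      case (elim z)
      let ?w = "of_real m * z + of_real v * z\<^sup>2 :: complex"
      have "norm ?w \<le> \<bar>m\<bar> * norm z + \<bar>v\<bar> * norm z ^ 2"
        by (rule norm_triangle_le) (simp add: norm_mult norm_power)
      also have "\<dots> \<le> \<bar>m\<bar> * norm z + \<bar>v\<bar> * norm z"
        using elim by (intro add_left_mono mult_left_mono) (auto simp: power2_eq_square mult_left_le)
      finally have w: "norm ?w \<le> (\<bar>m\<bar> + \<bar>v\<bar>) * norm z" by (simp add: algebra_simps)
      also have "\<dots> \<le> \<bar>m\<bar> + \<bar>v\<bar>" using elim by (intro mult_left_le) auto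
      finally have w': "norm ?w \<le> \<bar>m\<bar> + \<bar>v\<bar>" .
      have "norm (exp ?w - (1 + ?w + ?w\<^sup>2 / 2)) \<le> exp (norm ?w) * norm ?w ^ 3" by (rule exp_taylor2)
      also have "\<dots> \<le> exp (\<bar>m\<bar> + \<bar>v\<bar>) * ((\<bar>m\<bar> + \<bar>v\<bar>) * norm z) ^ 3"
        using w w' by (intro mult_mono power_mono) auto
      finally show ?case by (simp add: power_mult_distrib norm_power mult.assoc)
    qed
  qed
  have "(\<lambda>z. of_real (m * v) * z ^ 3 + of_real (v\<^sup>2 / 2) * z ^ 4) \<in> O[at (0::complex)](\<lambda>z. z ^ 3)"
    by (rule cubic_bigo)
  from sum_in_bigo(1)[OF lin this] show ?thesis
    unfolding jet2_def
    by (rule back_subst[of "\<lambda>f. f \<in> _"])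
       (simp add: fun_eq_iff algebra_simps power2_eq_square power3_eq_cube power4_eq_xxxx add_divide_distrib)
qed

section \<open>Expansions carried through transfers and bets\<close>

definition jet2_vec :: "(complex \<Rightarrow> 'm \<Rightarrow> complex) \<Rightarrow> real^'m \<Rightarrow> real^'m \<Rightarrow> bool" where
  "jet2_vec F h g \<longleftrightarrow> (\<forall>x. jet2 (\<lambda>z. F z x) 1 (h $ x) (g $ x))"

lemma jet2_vec_transfer:
  fixes F :: "complex \<Rightarrow> ('n::finite \<Rightarrow> 3) \<Rightarrow> complex"
  assumes N: "2 \<le> CARD('n)" and F: "jet2_vec F h g"
  shows "jet2_vec (\<lambda>z. transfer (F z)) (A_mat *v h) (A_mat *v g)"
  unfolding jet2_vec_def
proof
  fix x :: "'n \<Rightarrow> 3"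
  have "jet2 (\<lambda>z. transfer (F z) x) (transfer (\<lambda>_. 1) x) (transfer (($) h) x) (transfer (($) g) x)"
    using F unfolding transfer_def real_scaleR_def jet2_vec_def case_prod_unfold
    by (intro jet2_cmult jet2_sum) auto
  thus "jet2 (\<lambda>z. transfer (F z) x) 1 ((A_mat *v h) $ x) ((A_mat *v g) $ x)"
    by (simp add: A_mat_mult[OF N] transfer_const[OF N])
qed

text \<open>In exp (\<plusminus>z) = 1 \<plusminus> z + z^2 / 2 + ... the linear terms carry the
  signs of the payoffs and so turn \<open>B_mat\<close> into \<open>B_dot\<close>; the quadratic
  terms are half the squared payoffs and average to 1/2. At order 0 constants are preserved, so the
  constant coefficient stays 1.\<close>

lemma jet2_vec_bet:
  fixes F :: "complex \<Rightarrow> ('n::finite \<Rightarrow> 3) \<Rightarrow> complex"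
  assumes F: "jet2_vec F h g"
  shows "jet2_vec (\<lambda>z. bet \<rho> (exp z) (exp (- z)) (F z))
    (B_mat \<rho> *v h + B_dot \<rho> *v 1) (B_mat \<rho> *v g + B_dot \<rho> *v h + (1/2) *\<^sub>R 1)"
  unfolding jet2_vec_def
proof
  fix x :: "'n \<Rightarrow> 3"
  have up: "jet2 exp 1 1 (1/2)" and down: "jet2 (\<lambda>z. exp (- z)) 1 (-1) (1/2)"
    using jet2_exp[of 1 0] jet2_exp[of "-1" 0] by simp_all
  let ?p = "\<lambda>i. win_prob \<rho> (x i)"
  let ?u = "\<lambda>i. x(i := x i + 1)" and ?d = "\<lambda>i. x(i := x i - 1)"
  let ?c = "inverse (real CARD('n))"
  have "jet2 (\<lambda>z. bet \<rho> (exp z) (exp (- z)) (F z) x)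
    (?c * (\<Sum>i\<in>UNIV. ?p i * (1 * 1) + (1 - ?p i) * (1 * 1)))
    (?c * (\<Sum>i\<in>UNIV. ?p i * (1 * h $ ?u i + 1 * 1) + (1 - ?p i) * (1 * h $ ?d i + (-1) * 1)))
    (?c * (\<Sum>i\<in>UNIV. ?p i * (1 * g $ ?u i + 1 * h $ ?u i + 1/2 * 1)
        + (1 - ?p i) * (1 * g $ ?d i + (-1) * h $ ?d i + 1/2 * 1)))"
    using F unfolding bet_def jet2_vec_def
    by (intro jet2_cmult jet2_sum jet2_add jet2_mult up down) auto
  moreover have "?c * (\<Sum>i\<in>UNIV. ?p i * (1 * 1) + (1 - ?p i) * (1 * 1)) = 1" by simp
  moreover have "?c * (\<Sum>i\<in>UNIV. ?p i * (1 * h $ ?u i + 1 * 1) + (1 - ?p i) * (1 * h $ ?d i + (-1) * 1))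
      = (B_mat \<rho> *v h + B_dot \<rho> *v 1) $ x"
    by (simp only: vector_add_component B_mat_mult B_dot_mult bet_def real_scaleR_def one_index
        flip: distrib_left sum.distrib) (simp add: algebra_simps)
  moreover have "?c * (\<Sum>i\<in>UNIV. ?p i * (1 * g $ ?u i + 1 * h $ ?u i + 1/2 * 1)
        + (1 - ?p i) * (1 * g $ ?d i + (-1) * h $ ?d i + 1/2 * 1))
      = (B_mat \<rho> *v g + B_dot \<rho> *v h + (1/2) *\<^sub>R 1) $ x"
  proof -
    have half: "(1/2::real) = ?c * (\<Sum>i\<in>(UNIV::'n set). 1/2)" by simp
    show ?thesis
      unfolding vector_add_component vector_scaleR_component B_mat_mult B_dot_mult bet_def one_index real_scaleR_def mult_1_right
      by (subst (3) half, simp only: flip: distrib_left sum.distrib) (simp add: algebra_simps)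
  qed
  ultimately show "jet2 (\<lambda>z. bet \<rho> (exp z) (exp (- z)) (F z) x) 1 ((B_mat \<rho> *v h + B_dot \<rho> *v 1) $ x)
    ((B_mat \<rho> *v g + B_dot \<rho> *v h + (1/2) *\<^sub>R 1) $ x)" by simp
qed

lemma jet2_vec_transfer_pow:
  fixes F :: "complex \<Rightarrow> ('n::finite \<Rightarrow> 3) \<Rightarrow> complex"
  assumes N: "2 \<le> CARD('n)" and F: "jet2_vec F h g"
  shows "jet2_vec (\<lambda>z. (transfer ^^ k) (F z)) (matpow A_mat k *v h) (matpow A_mat k *v g)"
  by (induction k) (use F jet2_vec_transfer[OF N] in \<open>simp_all flip: matrix_vector_mul_assoc\<close>)

text \<open>\<open>H k\<close> is the first-order coefficient after k bets. In the summand with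
  index v, \<open>B_dot\<close> has v factors \<open>B_mat\<close> outside it and acts on the result
  of the k - 1 - v bets inside it, whose first-order coefficient is
  \<open>H (k - 1 - v)\<close>.\<close>

lemma jet2_vec_bet_pow:
  fixes h g :: "real^('n::finite \<Rightarrow> 3)" and \<rho> :: real and F :: "complex \<Rightarrow> _"
  defines "H \<equiv> \<lambda>k. matpow (B_mat \<rho>) k *v h + (\<Sum>v<k. matpow (B_mat \<rho>) v *v (B_dot \<rho> *v 1))"
  assumes F: "jet2_vec F h g"
  shows "jet2_vec (\<lambda>z. (bet \<rho> (exp z) (exp (- z)) ^^ k) (F z)) (H k)
    (matpow (B_mat \<rho>) k *v g + (\<Sum>v<k. matpow (B_mat \<rho>) v *v (B_dot \<rho> *v H (k - 1 - v)))
      + (real k / 2) *\<^sub>R 1)"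
proof (induction k)
  case 0
  show ?case using F by (simp add: H_def)
next
  case (Suc k)
  note step = jet2_vec_bet[OF Suc]
  let ?B = "B_mat \<rho> :: real^('n \<Rightarrow> 3)^('n \<Rightarrow> 3)"
  \<comment> \<open>Splits off v = 0 and pulls the outermost factor \<open>B_mat\<close> out of the
    rest, which matches the recursion of one further bet.\<close>
  have shift: "(\<Sum>v<Suc k. matpow ?B v *v f v) = f 0 + ?B *v (\<Sum>v<k. matpow ?B v *v f (Suc v))" for f
    by (subst sum.lessThan_Suc_shift)
       (simp add: linear_sum[OF matrix_vector_mul_linear] flip: matrix_vector_mul_assoc)
  have 1: "?B *v H k + B_dot \<rho> *v 1 = H (Suc k)"
    unfolding H_def shift
    by (simp add: matrix_vector_right_distrib flip: matrix_vector_mul_assoc)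
  have 2: "?B *v (matpow ?B k *v g + (\<Sum>v<k. matpow ?B v *v (B_dot \<rho> *v H (k - 1 - v)))
      + (real k / 2) *\<^sub>R 1) + B_dot \<rho> *v H k + (1/2) *\<^sub>R 1
     = matpow ?B (Suc k) *v g + (\<Sum>v<Suc k. matpow ?B v *v (B_dot \<rho> *v H (Suc k - 1 - v)))
      + (real (Suc k) / 2) *\<^sub>R 1"
    unfolding shift
    by (simp add: matrix_vector_right_distrib matrix_vector_mult_scaleR B_mat_one
        add_divide_distrib scaleR_left_distrib flip: matrix_vector_mul_assoc)
  have 3: "(\<lambda>z. (bet \<rho> (exp z) (exp (- z)) ^^ Suc k) (F z))
      = (\<lambda>z. bet \<rho> (exp z) (exp (- z)) ((bet \<rho> (exp z) (exp (- z)) ^^ k) (F z)))"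
    by simp
  show ?case unfolding 3 1[symmetric] 2[symmetric] by (rule step)
qed

subsection \<open>Perturbation of the period matrix\<close>

text \<open>\<open>stat_vec\<close> is a definite description: some stationary law is found, and
  uniqueness identifies it with \<open>stat_vec\<close>.\<close>

lemma stationary_chain_pattern:
  assumes "2 \<le> CARD('n::finite)" "1 \<le> s" "0 < \<rho>"
  shows "stationary_chain (pattern_mat \<rho> r s :: real^('n \<Rightarrow> 3)^('n \<Rightarrow> 3)) (stat_vec \<rho> r s)"
proof -
  obtain \<pi> where \<pi>: "stationary_distribution (pattern_mat \<rho> r s :: real^('n \<Rightarrow> 3)^('n \<Rightarrow> 3)) \<pi>"
    using exists_stationary_distribution pattern_mat_nonneg[OF assms(3)] pattern_mat_one[OF assms(1)]
    by blast
  interpret stationary_chain "pattern_mat \<rho> r s" \<pi>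
    using \<pi> pattern_mat_one[OF assms(1)] harmonic_const[OF assms] by unfold_locales
  show ?thesis
    unfolding stat_vec_def the_stationary by unfold_locales
qed

text \<open>Substitution v = u + k + 1.\<close>

lemma sum_triangle_shift:
  fixes T :: "nat \<Rightarrow> nat \<Rightarrow> real"
  shows "(\<Sum>u<s. \<Sum>k<s - 1 - u. T u k) = (\<Sum>v<s. \<Sum>u<v. T u (v - u - 1))"
proof (induction s)
  case (Suc s)
  have "(\<Sum>u<Suc s. \<Sum>k<Suc s - 1 - u. T u k) = (\<Sum>u<s. \<Sum>k<Suc (s - 1 - u). T u k)"
    by (simp add: Suc_diff_Suc cong: sum.cong_simp)
  also have "\<dots> = (\<Sum>u<s. \<Sum>k<s - 1 - u. T u k) + (\<Sum>u<s. T u (s - u - 1))"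
    by (simp add: sum.distrib diff_commute)
  finally show ?case using Suc by simp
qed simp

lemma square_sum_triangle:
  fixes a :: "nat \<Rightarrow> real"
  shows "(\<Sum>v<s. a v)\<^sup>2 = (\<Sum>v<s. (a v)\<^sup>2) + 2 * (\<Sum>v<s. \<Sum>u<v. a u * a v)"
  by (induction s) (simp_all add: power2_sum sum_distrib_left sum_distrib_right algebra_simps)

text \<open>Expected profit of one period as a function of the residues at its start.\<close>

definition period_profit :: "real \<Rightarrow> nat \<Rightarrow> nat \<Rightarrow> real^('n::finite \<Rightarrow> 3)" where
  "period_profit \<rho> r s = matpow A_mat r *v (\<Sum>v<s. matpow (B_mat \<rho>) v *v (B_dot \<rho> *v 1))"

definition period_mean :: "'n::finite itself \<Rightarrow> real \<Rightarrow> nat \<Rightarrow> nat \<Rightarrow> real" where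
  "period_mean _ \<rho> r s = (stat_vec \<rho> r s :: real^('n \<Rightarrow> 3)) \<bullet> period_profit \<rho> r s"

lemmas mult_vec_sum = linear_sum[OF matrix_vector_mul_linear]
lemmas mult_vec_assoc = matrix_vector_mul_assoc[symmetric]

text \<open>The part of \<open>H\<close> that contains \<open>h\<close> gives the double sum with Z
  - \<Pi>, because \<open>h\<close> is Z - \<Pi> applied to the period profit; the accumulated part
  gives the sum over powers of \<open>B_mat\<close>. The subtracted products of means complete the
  square of the mean per period, and each of the s bets contributes 1 through its squared
  payoff.\<close>

lemma variance_identity:
  fixes h :: "real^('n::finite \<Rightarrow> 3)" and \<rho> :: real and r s :: nat
  assumes N: "2 \<le> CARD('n)" and s: "1 \<le> s" and \<rho>: "0 < \<rho>"
  defines "\<pi> \<equiv> stat_vec \<rho> r s :: real^('n \<Rightarrow> 3)"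
    and "h \<equiv> (Z_mat \<rho> r s - Pi_mat \<rho> r s) *v period_profit \<rho> r s"
    and "H \<equiv> \<lambda>k. matpow (B_mat \<rho>) k *v h + (\<Sum>v<k. matpow (B_mat \<rho>) v *v (B_dot \<rho> *v 1))"
  shows "real (r + s) * variance_param TYPE('n) \<rho> r s
    = 2 * (\<pi> \<bullet> (matpow A_mat r *v (\<Sum>v<s. matpow (B_mat \<rho>) v *v (B_dot \<rho> *v H (s - 1 - v)))))
      + real s - (period_mean TYPE('n) \<rho> r s)\<^sup>2"
proof -
  interpret stationary_chain "pattern_mat \<rho> r s" "stat_vec \<rho> r s :: real^('n \<Rightarrow> 3)"
    by (rule stationary_chain_pattern) fact+
  let ?A = "matpow A_mat r :: real^('n \<Rightarrow> 3)^('n \<Rightarrow> 3)"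
  let ?B = "matpow (B_mat \<rho> :: real^('n \<Rightarrow> 3)^('n \<Rightarrow> 3))"
  let ?b = "B_dot \<rho> *v 1 :: real^('n \<Rightarrow> 3)"
  define m where "m = (\<lambda>v. \<pi> \<bullet> (?A *v (?B v *v ?b)))"
  define T where "T = (\<lambda>u k. \<pi> \<bullet> (?A *v (?B u *v (B_dot \<rho> *v (?B k *v ?b)))))"
  have Proj: "Pi_mat \<rho> r s = Proj" by (simp add: Pi_mat_def Proj_def)
  have ones: "?A *v (?B v *v (B_ddot \<rho> *v 1)) = 1" for v
    by (simp add: B_ddot_def matpow_one A_mat_one N B_mat_one)
  have mean: "period_mean TYPE('n) \<rho> r s = (\<Sum>v<s. m v)"
    by (simp add: period_mean_def period_profit_def m_def \<pi>_def mult_vec_sum inner_sum_right)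
  have "(\<Sum>v<s. \<pi> \<bullet> (?A *v (?B v *v (B_dot \<rho> *v H (s - 1 - v)))))
      = (\<Sum>u<s. \<pi> \<bullet> (?A *v (?B u *v (B_dot \<rho> *v (?B (s - 1 - u) *v h)))))
        + (\<Sum>u<s. \<Sum>k<s - 1 - u. T u k)"
    unfolding H_def T_def
    by (simp add: matrix_vector_right_distrib inner_add_right sum.distrib mult_vec_sum inner_sum_right)
  note H = this[unfolded sum_triangle_shift]
  have h: "h = (\<Sum>v<s. (Z_mat \<rho> r s - Proj) *v (?A *v (?B v *v ?b)))"
    by (simp add: h_def period_profit_def Proj mult_vec_sum)
  have 3: "(\<Sum>v<s. \<pi> \<bullet> ((?A ** ?B u ** B_dot \<rho> ** ?B (s - u - 1) ** (Z_mat \<rho> r s - Pi_mat \<rho> r s)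
        ** ?A ** ?B v ** B_dot \<rho>) *v 1)) = \<pi> \<bullet> (?A *v (?B u *v (B_dot \<rho> *v (?B (s - 1 - u) *v h))))" for u
    by (simp add: mult_vec_assoc h mult_vec_sum inner_sum_right Proj diff_commute)
  \<comment> \<open>\<open>Proj\<close> has rank one, so the term containing \<open>Pi_mat\<close>
    factors into a product of two means.\<close>
  have 2: "\<pi> \<bullet> ((?A ** ?B u ** B_dot \<rho> ** (?B (v - u - 1) - Pi_mat \<rho> r s ** ?A ** ?B v) ** B_dot \<rho>) *v 1)
      = T u (v - u - 1) - m u * m v" for u v
    by (simp add: mult_vec_assoc matrix_vector_mult_diff_rdistrib matrix_vector_mult_diff_distrib
        inner_diff_right T_def m_def Proj Proj_mult \<pi>_def matrix_vector_mult_scaleR)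
  have 1: "\<pi> \<bullet> ((?A ** ?B v ** B_ddot \<rho>) *v 1) - (\<pi> \<bullet> ((?A ** ?B v ** B_dot \<rho>) *v 1))\<^sup>2 = 1 - (m v)\<^sup>2" for v
    by (simp add: mult_vec_assoc ones m_def \<pi>_def pi_one)
  have "real (r + s) * variance_param TYPE('n) \<rho> r s
    = (\<Sum>v<s. 1 - (m v)\<^sup>2) + 2 * (\<Sum>v<s. \<Sum>u<v. T u (v - u - 1) - m u * m v)
      + 2 * (\<Sum>u<s. \<pi> \<bullet> (?A *v (?B u *v (B_dot \<rho> *v (?B (s - 1 - u) *v h)))))"
    using s unfolding variance_param_def Let_def \<pi>_def[symmetric] 1 2 3 by simp
  thus ?thesis
    unfolding mean square_sum_triangle
    by (simp add: mult_vec_sum inner_sum_right sum_subtractf algebra_simps H[unfolded diff_diff_left plus_1_eq_Suc])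
qed

text \<open>With c and d the first- and second-order terms a period adds, comparing coefficients of
  z and z^2 requires P h + c = h + m 1 and P g + d = g + m h + (V + m^2 / 2) 1. Both are Poisson
  equations; the constants they admit are the \<pi>-means of c and of d - m h.\<close>

lemma perturbed_eigenvector:
  fixes \<rho> :: real and r s :: nat
  assumes N: "2 \<le> CARD('n::finite)" and s: "1 \<le> s" and \<rho>: "0 < \<rho>"
  defines "m \<equiv> period_mean TYPE('n::finite) \<rho> r s"
    and "V \<equiv> real (r + s) * variance_param TYPE('n::finite) \<rho> r s / 2"
  shows "\<exists>h g :: real^('n::finite \<Rightarrow> 3). \<forall>x. (\<lambda>z. (transfer ^^ r) ((bet \<rho> (exp z) (exp (- z)) ^^ s)
          (\<lambda>x. 1 + of_real (h $ x) * z + of_real (g $ x) * z\<^sup>2)) x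
        - exp (of_real m * z + of_real V * z\<^sup>2) * (1 + of_real (h $ x) * z + of_real (g $ x) * z\<^sup>2))
      \<in> O[at 0](\<lambda>z::complex. z ^ 3)"
proof -
  interpret stationary_chain "pattern_mat \<rho> r s" "stat_vec \<rho> r s :: real^('n \<Rightarrow> 3)"
    by (rule stationary_chain_pattern) fact+
  let ?\<pi> = "stat_vec \<rho> r s :: real^('n \<Rightarrow> 3)"
  let ?A = "matpow A_mat r :: real^('n \<Rightarrow> 3)^('n \<Rightarrow> 3)"
  let ?B = "matpow (B_mat \<rho> :: real^('n \<Rightarrow> 3)^('n \<Rightarrow> 3))"
  define c :: "real^('n \<Rightarrow> 3)" where "c = period_profit \<rho> r s"
  define h where "h = (matrix_inv W - Proj) *v c"
  have Proj: "Pi_mat \<rho> r s = Proj" by (simp add: Pi_mat_def Proj_def)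
  have Z: "Z_mat \<rho> r s = matrix_inv W" by (simp add: Z_mat_def W_def Proj)
  define H where "H = (\<lambda>k. ?B k *v h + (\<Sum>v<k. ?B v *v (B_dot \<rho> *v 1)))"
  define d where "d = ?A *v (\<Sum>v<s. ?B v *v (B_dot \<rho> *v H (s - 1 - v))) + (real s / 2) *\<^sub>R 1"
  define g where "g = (matrix_inv W - Proj) *v (d - m *\<^sub>R h)"
  have m: "m = ?\<pi> \<bullet> c" by (simp add: m_def period_mean_def c_def)
  \<comment> \<open>The solvability condition at second order. As \<open>h\<close> has \<pi>-mean 0,
    it only involves the mean of \<open>d\<close>, which the variance identity evaluates.\<close>
  have pd: "?\<pi> \<bullet> (d - m *\<^sub>R h) = V + m\<^sup>2 / 2"
    using variance_identity[OF N s \<rho>, of r] pi_poisson[of c]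
    by (simp add: V_def d_def inner_add_right inner_diff_right pi_one m_def c_def H_def h_def Proj Z
        add_divide_distrib diff_divide_distrib)
  have Pg: "pattern_mat \<rho> r s *v g + d = g + m *\<^sub>R h + (V + m\<^sup>2 / 2) *\<^sub>R 1"
    using poisson[of "d - m *\<^sub>R h"] pd
    by (simp add: g_def algebra_simps)
  have Ph: "pattern_mat \<rho> r s *v h + c = h + m *\<^sub>R 1"
    using poisson[of c] by (simp add: h_def m)
  define w where "w = (\<lambda>z x. 1 + of_real (h $ x) * z + of_real (g $ x) * z\<^sup>2 :: complex)"
  have jw: "jet2_vec w h g"
    using jet2_poly[of 1] by (simp add: jet2_vec_def w_def)
  have "jet2_vec (\<lambda>z. (transfer ^^ r) ((bet \<rho> (exp z) (exp (- z)) ^^ s) (w z)))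
     (pattern_mat \<rho> r s *v h + c) (pattern_mat \<rho> r s *v g + d)"
    using jet2_vec_transfer_pow[OF N jet2_vec_bet_pow[OF jw, where \<rho> = \<rho> and k = s], where k = r]
    by (simp add: pattern_mat_def matrix_vector_right_distrib c_def period_profit_def d_def H_def
        mult_vec_assoc add.assoc matpow_one A_mat_one[OF N] matrix_vector_mult_scaleR)
  hence 1: "jet2 (\<lambda>z. (transfer ^^ r) ((bet \<rho> (exp z) (exp (- z)) ^^ s) (w z)) x)
     1 (h $ x + m) (g $ x + m * h $ x + (V + m\<^sup>2 / 2))" for x
    by (simp add: jet2_vec_def Pg Ph)
  have 2: "jet2 (\<lambda>z. exp (of_real m * z + of_real V * z\<^sup>2) * w z x) 1 (h $ x + m)
      (g $ x + m * h $ x + (V + m\<^sup>2 / 2))" for x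
    using jet2_mult[OF jet2_exp[of m V], of "\<lambda>z. w z x" 1 "h $ x" "g $ x"] jw
    by (simp add: jet2_vec_def add_ac)
  show ?thesis
  proof (intro exI allI)
    fix x
    show "(\<lambda>z. (transfer ^^ r) ((bet \<rho> (exp z) (exp (- z)) ^^ s)
          (\<lambda>x. 1 + of_real (h $ x) * z + of_real (g $ x) * z\<^sup>2)) x
        - exp (of_real m * z + of_real V * z\<^sup>2) * (1 + of_real (h $ x) * z + of_real (g $ x) * z\<^sup>2))
      \<in> O[at 0](\<lambda>z::complex. z ^ 3)"
      using sum_in_bigo(2)[OF 1[of x, unfolded jet2_def] 2[of x, unfolded jet2_def]]
      by (simp add: w_def)
  qed
qed

subsection \<open>The mean\<close>

text \<open>Additive functions of the players' residues. Together with the constants they form a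
  space that both games map to itself, so the mean can be computed inside it.\<close>

definition player_sum :: "(3 \<Rightarrow> real) \<Rightarrow> real^('n::finite \<Rightarrow> 3)" where
  "player_sum f = (\<chi> x. \<Sum>i\<in>UNIV. f (x i))"

lemma sum_fun_upd:
  fixes x :: "'n::finite \<Rightarrow> 'b" and f :: "'b \<Rightarrow> 'c::ab_group_add"
  shows "(\<Sum>k\<in>UNIV. f ((x(i := a)) k)) = (\<Sum>k\<in>UNIV. f (x k)) + f a - f (x i)"
proof -
  have "(\<Sum>k\<in>UNIV. f ((x(i := a)) k)) = f a + (\<Sum>k\<in>UNIV - {i}. f (x k))"
    by (subst sum.remove[of _ i]) auto
  moreover have "(\<Sum>k\<in>UNIV. f (x k)) = f (x i) + (\<Sum>k\<in>UNIV - {i}. f (x k))"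
    by (subst sum.remove[of _ i]) auto
  ultimately show ?thesis by simp
qed

lemma player_sum_upd:
  "player_sum f $ (x(i := a)) = player_sum f $ x + f a - f (x i)"
  unfolding player_sum_def vec_lambda_beta by (rule sum_fun_upd)

lemma player_sum_linear:
  "player_sum (\<lambda>j. a * f j + b * g j) = a *\<^sub>R player_sum f + b *\<^sub>R player_sum g"
  by (simp add: player_sum_def vec_eq_iff sum.distrib sum_distrib_left)

lemma player_sum_const: "player_sum (\<lambda>_. c) = (real CARD('n) * c) *\<^sub>R (1 :: real^('n::finite \<Rightarrow> 3))"
  by (simp add: player_sum_def vec_eq_iff)

definition single_B :: "real \<Rightarrow> (3 \<Rightarrow> real) \<Rightarrow> 3 \<Rightarrow> real" where
  "single_B \<rho> f j = win_prob \<rho> j * f (j + 1) + (1 - win_prob \<rho> j) * f (j - 1)"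

lemma B_mat_player_sum:
  "B_mat \<rho> *v (player_sum f :: real^('n::finite \<Rightarrow> 3))
    = (1 - 1 / real CARD('n)) *\<^sub>R player_sum f + (1 / real CARD('n)) *\<^sub>R player_sum (single_B \<rho> f)"
  unfolding vec_eq_iff
proof
  fix x :: "'n \<Rightarrow> 3"
  let ?N = "real CARD('n)" and ?S = "player_sum f $ x"
  have "(B_mat \<rho> *v player_sum f) $ x = inverse ?N * (\<Sum>i\<in>UNIV. ?S + single_B \<rho> f (x i) - f (x i))"
    by (simp add: B_mat_mult bet_def player_sum_upd single_B_def algebra_simps)
  also have "\<dots> = inverse ?N * (?N * ?S + player_sum (single_B \<rho> f) $ x - ?S)"
    by (simp add: sum.distrib sum_subtractf player_sum_def)
  also have "\<dots> = ((1 - 1 / ?N) *\<^sub>R player_sum f + (1 / ?N) *\<^sub>R player_sum (single_B \<rho> f)) $ x"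
    by (simp add: field_simps)
  finally show "(B_mat \<rho> *v player_sum f) $ x = \<dots>" .
qed

lemma sum_residues: "(\<Sum>k\<in>UNIV. f k) = f (j::3) + f (j + 1) + f (j - 1)" for f :: "3 \<Rightarrow> real"
proof -
  have ne: "j \<noteq> j + 1" "j \<noteq> j - 1" "j + 1 \<noteq> j - 1" using residue_distinct by metis+
  hence "card {j, j + 1, j - 1} = 3" by simp
  hence UNIV: "(UNIV :: 3 set) = {j, j + 1, j - 1}" by (intro card_subset_eq[symmetric]) auto
  show ?thesis unfolding UNIV using ne by simp
qed

text \<open>Each player gives with probability 1/N and receives with probability 1/N. The three
  residues x - 1, x, x + 1 exhaust all residues, so f (x - 1) + f (x + 1) - 2 f x is the sum of f
  minus 3 f x: a transfer contracts additive functions towards constants by the factor 1 -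
  3/N.\<close>

lemma A_mat_player_sum:
  assumes N: "2 \<le> CARD('n::finite)"
  shows "A_mat *v (player_sum f :: real^('n \<Rightarrow> 3))
    = (1 - 3 / real CARD('n)) *\<^sub>R player_sum f + (\<Sum>k\<in>UNIV. f k) *\<^sub>R 1"
  unfolding vec_eq_iff
proof
  fix x :: "'n \<Rightarrow> 3"
  let ?N = "real CARD('n)" and ?S = "player_sum f $ x"
  define D where "D = {(i, j :: 'n). i \<noteq> j}"
  define G where "G = (\<lambda>i j. player_sum f $ (x(i := x i - 1, j := x j + 1)))"
  define u where "u = (\<lambda>i. f (x i - 1) - f (x i))"
  define v where "v = (\<lambda>i. f (x i + 1) - f (x i))"
  have card: "real (card D) = ?N * (?N - 1)"
    using N by (simp add: D_def card_offdiagonal of_nat_diff)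
  have D: "D = (SIGMA i:UNIV. UNIV - {i})" by (auto simp: D_def)
  have D': "(\<Sum>(i, j)\<in>D. F i j) = (\<Sum>j\<in>UNIV. \<Sum>i\<in>UNIV - {j}. F i j)" for F :: "'n \<Rightarrow> 'n \<Rightarrow> real"
  proof -
    have "(\<Sum>(i, j)\<in>D. F i j) = (\<Sum>(j, i)\<in>(SIGMA i:UNIV. UNIV - {i}). F i j)"
      by (rule sum.reindex_bij_witness[of _ prod.swap prod.swap]) (auto simp: D)
    thus ?thesis by (simp add: sum.Sigma)
  qed
  have "(\<Sum>(i, j)\<in>D. G i j) = (\<Sum>(i, j)\<in>D. ?S + u i + v j)"
    by (rule sum.cong) (auto simp: D_def G_def player_sum_upd u_def v_def)
  also have "\<dots> = real (card D) * ?S + (\<Sum>(i, j)\<in>D. u i) + (\<Sum>(i, j)\<in>D. v j)"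
    by (simp add: case_prod_unfold sum.distrib)
  also have "(\<Sum>(i, j)\<in>D. u i) = (?N - 1) * (\<Sum>i\<in>UNIV. u i)"
    using N unfolding D by (subst sum.Sigma[symmetric]) (auto simp: card_Diff_subset of_nat_diff sum_distrib_left)
  also have "(\<Sum>(i, j)\<in>D. v j) = (?N - 1) * (\<Sum>j\<in>UNIV. v j)"
    using N unfolding D' by (auto simp: card_Diff_subset of_nat_diff sum_distrib_left)
  finally have "(\<Sum>(i, j)\<in>D. G i j)
      = real (card D) * ?S + (?N - 1) * (\<Sum>i\<in>UNIV. u i + v i)"
    by (simp add: sum.distrib algebra_simps)
  also have "(\<Sum>i\<in>UNIV. u i + v i) = ?N * (\<Sum>k\<in>UNIV. f k) - 3 * ?S"
  proof -
    have "u i + v i = (\<Sum>k\<in>UNIV. f k) - 3 * f (x i)" for i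
      by (subst sum_residues[of f "x i"]) (simp add: u_def v_def)
    thus ?thesis by (simp add: sum_subtractf player_sum_def sum_distrib_left)
  qed
  finally have sum_eq: "(\<Sum>(i, j)\<in>D. G i j)
      = real (card D) * ?S + (?N - 1) * (?N * (\<Sum>k\<in>UNIV. f k) - 3 * ?S)" .
  have "?N \<noteq> 0" "?N - 1 \<noteq> 0" using N by auto
  hence "(A_mat *v player_sum f) $ x = ?S + (\<Sum>k\<in>UNIV. f k) - 3 / ?N * ?S"
    unfolding A_mat_mult[OF N] transfer_def D_def[symmetric] G_def[symmetric] sum_eq card
    by (simp add: divide_simps) (simp add: algebra_simps)
  thus "(A_mat *v player_sum f) $ x
      = ((1 - 3 / real CARD('n)) *\<^sub>R player_sum f + (\<Sum>k\<in>UNIV. f k) *\<^sub>R 1) $ x"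
    by (simp add: algebra_simps)
qed

text \<open>N times \<open>a_param N k\<close> is the geometric sum of (1 - 3/N)^i over i < k, the
  accumulated constants of k transfers.\<close>

lemma A_pow_player_sum:
  assumes N: "2 \<le> CARD('n::finite)"
  shows "matpow A_mat k *v (player_sum f :: real^('n \<Rightarrow> 3))
    = (1 - 3 / real CARD('n)) ^ k *\<^sub>R player_sum f
      + (real CARD('n) * a_param CARD('n) k * (\<Sum>k\<in>UNIV. f k)) *\<^sub>R 1"
proof (induction k)
  case (Suc k)
  let ?N = "real CARD('n)" and ?\<sigma> = "\<Sum>k\<in>UNIV. f k"
  have "matpow A_mat (Suc k) *v (player_sum f :: real^('n \<Rightarrow> 3))
    = (1 - 3 / ?N) ^ Suc k *\<^sub>R player_sum f
      + (((1 - 3 / ?N) ^ k + ?N * a_param CARD('n) k) * ?\<sigma>) *\<^sub>R 1"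
    by (simp add: mult_vec_assoc Suc matrix_vector_right_distrib matrix_vector_mult_scaleR
        A_mat_player_sum[OF N] A_mat_one[OF N] scaleR_right_distrib algebra_simps)
  also have "(1 - 3 / ?N) ^ k + ?N * a_param CARD('n) k = ?N * a_param CARD('n) (Suc k)"
    using N by (simp add: a_param_def field_simps)
  finally show ?case by (simp add: mult.assoc)
qed (simp add: a_param_def)

text \<open>On an eigenfunction the bets of a period act as the factor e^s, and the transfers act
  affinely with slope w = (1 - 3/N)^r. Stationarity thus becomes the scalar equation L = e^s (w L +
  q) for the stationary mean L.\<close>

lemma eigenfunction_mean:
  fixes f :: "3 \<Rightarrow> real" and \<rho> :: real and r s :: nat
  assumes N: "2 \<le> CARD('n::finite)" and s: "1 \<le> s" and \<rho>: "0 < \<rho>"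
    and eigen: "B_mat \<rho> *v (player_sum f :: real^('n \<Rightarrow> 3)) = e *\<^sub>R player_sum f"
    and e: "e \<noteq> 1" and we: "(1 - 3 / real CARD('n)) ^ r * e ^ s \<noteq> 1"
  shows "(stat_vec \<rho> r s :: real^('n \<Rightarrow> 3)) \<bullet>
      (matpow A_mat r *v (\<Sum>v<s. matpow (B_mat \<rho>) v *v player_sum f))
    = (1 - e ^ s) / (1 - e) * (real CARD('n) * a_param CARD('n) r * (\<Sum>k\<in>UNIV. f k))
      / (1 - (1 - 3 / real CARD('n)) ^ r * e ^ s)"
proof -
  interpret stationary_chain "pattern_mat \<rho> r s" "stat_vec \<rho> r s :: real^('n \<Rightarrow> 3)"
    by (rule stationary_chain_pattern) fact+
  let ?\<pi> = "stat_vec \<rho> r s :: real^('n \<Rightarrow> 3)"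
  define L where "L = ?\<pi> \<bullet> player_sum f"
  define w where "w = (1 - 3 / real CARD('n)) ^ r"
  define q where "q = real CARD('n) * a_param CARD('n) r * (\<Sum>k\<in>UNIV. f k)"
  have pow: "matpow (B_mat \<rho>) v *v (player_sum f :: real^('n \<Rightarrow> 3)) = e ^ v *\<^sub>R player_sum f" for v
    by (induction v) (simp_all add: mult_vec_assoc matrix_vector_mult_scaleR eigen mult.commute)
  have A: "?\<pi> \<bullet> (matpow A_mat r *v player_sum f) = w * L + q"
    by (simp add: A_pow_player_sum[OF N] inner_add_right pi_one L_def w_def q_def)
  have "e ^ s * (w * L + q) = L"
    using pi_P[of "player_sum f"]
    by (simp add: pattern_mat_def mult_vec_assoc pow matrix_vector_mult_scaleR A flip: L_def)
  moreover have we': "1 - w * e ^ s \<noteq> 0" using we by (simp add: w_def)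
  ultimately have L: "L = e ^ s * q / (1 - w * e ^ s)"
    by (simp add: nonzero_eq_divide_eq algebra_simps)
  have "?\<pi> \<bullet> (matpow A_mat r *v (\<Sum>v<s. matpow (B_mat \<rho>) v *v player_sum f))
      = (\<Sum>v<s. e ^ v) * (w * L + q)"
    by (simp add: pow mult_vec_sum matrix_vector_mult_scaleR inner_sum_right A sum_distrib_right)
  also have "(\<Sum>v<s. e ^ v) = (1 - e ^ s) / (1 - e)"
    using geometric_sum[OF e, of s] by (metis minus_diff_eq minus_divide_divide)
  also have "w * L + q = q / (1 - w * e ^ s)"
    using we' unfolding L by (simp add: field_simps)
  finally show ?thesis by (simp add: w_def q_def)
qed

section \<open>Eigenfunctions of the one-player chain and the drift\<close>

definition drift :: "real \<Rightarrow> 3 \<Rightarrow> real" where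
  "drift \<rho> j = 2 * win_prob \<rho> j - 1"

lemma B_dot_one: "B_dot \<rho> *v (1 :: real^('n::finite \<Rightarrow> 3)) = (1 / real CARD('n)) *\<^sub>R player_sum (drift \<rho>)"
  by (simp add: vec_eq_iff B_dot_mult bet_def player_sum_def drift_def field_simps)

lemma residue_cases: "(j::3) = 0 \<or> j = 1 \<or> j = 2"
proof -
  have "card {0, 1, 2 :: 3} = 3" by simp
  hence "{0, 1, 2 :: 3} = UNIV" by (intro card_subset_eq) auto
  thus ?thesis by blast
qed

text \<open>The difference \<open>e1_circ \<rho> - e2_circ \<rho>\<close> of two eigenvalues of the
  one-player chain. For positive \<rho> it vanishes only at \<rho> = 1.\<close>

definition gap :: "real \<Rightarrow> real" where
  "gap \<rho> = (1 - \<rho>) * T_param \<rho> / ((1 + \<rho>) * (1 + \<rho>\<^sup>2))"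

lemma e_circ_gap: "e1_circ \<rho> = - 1 / 2 + gap \<rho> / 2" "e2_circ \<rho> = - 1 / 2 - gap \<rho> / 2"
  by (simp_all add: e1_circ_def e2_circ_def gap_def)

lemma T_param_square: "0 < \<rho> \<Longrightarrow> (T_param \<rho>)\<^sup>2 = (1 + \<rho>\<^sup>2) * (1 + 4 * \<rho> + \<rho>\<^sup>2)"
  by (simp add: T_param_def add_nonneg_nonneg)

lemma T_param_pos: "0 < \<rho> \<Longrightarrow> 0 < T_param \<rho>"
  by (simp add: T_param_def add_pos_pos)

lemma one_plus_square_nonzero: "1 + (\<rho>::real)\<^sup>2 \<noteq> 0"
  by (metis add_nonneg_eq_0_iff zero_le_one zero_le_power2 zero_neq_one)

lemma gap_square:
  "0 < \<rho> \<Longrightarrow> (gap \<rho>)\<^sup>2 = (1 - \<rho>)\<^sup>2 * (1 + 4 * \<rho> + \<rho>\<^sup>2) / ((1 + \<rho>)\<^sup>2 * (1 + \<rho>\<^sup>2))"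
  using one_plus_square_nonzero[of \<rho>]
  by (simp add: gap_def power_divide power_mult_distrib T_param_square power2_eq_square[of "1 + \<rho>\<^sup>2"])

text \<open>Places both \<open>e1_circ \<rho>\<close> and \<open>e2_circ \<rho>\<close> in the
  interval [-1, 0].\<close>

lemma gap_bound:
  assumes "0 < \<rho>" shows "\<bar>gap \<rho>\<bar> \<le> 1"
proof -
  have "(1 - \<rho>)\<^sup>2 * (1 + 4 * \<rho> + \<rho>\<^sup>2) \<le> (1 + \<rho>)\<^sup>2 * (1 + \<rho>\<^sup>2)"
  proof -
    have "(1 + \<rho>)\<^sup>2 * (1 + \<rho>\<^sup>2) - (1 - \<rho>)\<^sup>2 * (1 + 4 * \<rho> + \<rho>\<^sup>2) = 8 * \<rho>\<^sup>2" by algebra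
    thus ?thesis by (smt (verit) zero_le_power2)
  qed
  hence "(gap \<rho>)\<^sup>2 \<le> 1"
    using assms by (simp add: gap_square divide_le_eq zero_less_mult_iff add_pos_pos)
  thus ?thesis by (simp add: abs_square_le_1)
qed

text \<open>The polynomial t^2 + t + (1 - gap^2) / 4 has the roots \<open>e1_circ \<rho>\<close> and
  \<open>e2_circ \<rho>\<close>; with t - 1 it makes up the characteristic polynomial of the
  one-player chain. The drift is already annihilated without the factor t - 1 because it has mean 0
  under the stationary law of that chain: game \<open>B\<close> alone is fair.\<close>

lemma drift_quadratic:
  assumes \<rho>: "0 < \<rho>"
  shows "single_B \<rho> (single_B \<rho> (drift \<rho>)) j + single_B \<rho> (drift \<rho>) j + (1 - (gap \<rho>)\<^sup>2) / 4 * drift \<rho> j = 0"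
proof -
  have 3: "(1::3) + 1 = 2" "(2::3) + 1 = 0" "(0::3) - 1 = 2" "(1::3) - 1 = 0" "(2::3) - 1 = 1" "(0::3) + 1 = 1" by simp_all
  have ne: "1 + \<rho> \<noteq> 0" "1 + \<rho>\<^sup>2 \<noteq> 0" using \<rho> one_plus_square_nonzero by auto
  have w: "win_prob \<rho> 0 = \<rho>\<^sup>2 / (1 + \<rho>\<^sup>2)" "win_prob \<rho> 1 = 1 / (1 + \<rho>)" "win_prob \<rho> 2 = 1 / (1 + \<rho>)"
    "1 - \<rho>\<^sup>2 / (1 + \<rho>\<^sup>2) = 1 / (1 + \<rho>\<^sup>2)" "1 - 1 / (1 + \<rho>) = \<rho> / (1 + \<rho>)"
    using ne by (simp_all add: win_prob_def field_simps)
  define D where "D = drift \<rho>"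
  define G where "G = single_B \<rho> D"
  have g: "(1 - (gap \<rho>)\<^sup>2) / 4 = 2 * \<rho>\<^sup>2 / ((1 + \<rho>)\<^sup>2 * (1 + \<rho>\<^sup>2))"
    unfolding gap_square[OF \<rho>] using ne by (simp add: divide_simps) algebra
  have D: "D 0 = (\<rho>\<^sup>2 - 1) / (1 + \<rho>\<^sup>2)" "D 1 = (1 - \<rho>) / (1 + \<rho>)" "D 2 = (1 - \<rho>) / (1 + \<rho>)"
    using ne unfolding D_def drift_def w by (simp_all add: field_simps)
  have G: "G 0 = (1 - \<rho>) / (1 + \<rho>)"
    "G 1 = (1 - \<rho>) * ((1 + \<rho>\<^sup>2) - \<rho> * (1 + \<rho>)\<^sup>2) / ((1 + \<rho>)\<^sup>2 * (1 + \<rho>\<^sup>2))"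
    "G 2 = (1 - \<rho>) * (\<rho> * (1 + \<rho>\<^sup>2) - (1 + \<rho>)\<^sup>2) / ((1 + \<rho>)\<^sup>2 * (1 + \<rho>\<^sup>2))"
    using ne unfolding G_def single_B_def 3 w D by (simp_all add: divide_simps; algebra)+
  have "single_B \<rho> G j + G j + 2 * \<rho>\<^sup>2 / ((1 + \<rho>)\<^sup>2 * (1 + \<rho>\<^sup>2)) * D j = 0"
    if "j = 0 \<or> j = 1 \<or> j = 2"
    using that
  proof (elim disjE)
    assume "j = 0"
    show ?thesis
      using ne unfolding \<open>j = 0\<close> single_B_def 3 w G D by (simp add: divide_simps) algebra
  next
    assume "j = 1"
    show ?thesis
      using ne unfolding \<open>j = 1\<close> single_B_def 3 w G D by (simp add: divide_simps) algebra
  next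
    assume "j = 2"
    show ?thesis
      using ne unfolding \<open>j = 2\<close> single_B_def 3 w G D by (simp add: divide_simps) algebra
  qed
  thus ?thesis using residue_cases[of j] by (simp add: g G_def D_def)
qed

lemma sum_UNIV_3: "(\<Sum>k\<in>UNIV. f k) = f (0::3) + f 1 + f 2" for f :: "3 \<Rightarrow> real"
proof -
  have "(0::3) - 1 = 2" by simp
  thus ?thesis using sum_residues[of f 0] by (metis add_0)
qed

lemma sum_drift:
  assumes "0 < \<rho>"
  shows "(\<Sum>k\<in>UNIV. drift \<rho> k) = (1 - \<rho>) ^ 3 / ((1 + \<rho>) * (1 + \<rho>\<^sup>2))"
  using assms one_plus_square_nonzero[of \<rho>]
  by (simp add: sum_UNIV_3 drift_def win_prob_def divide_simps)
     (simp add: algebra_simps power2_eq_square power3_eq_cube)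

text \<open>Residues 1 and 2 share one win probability and hence one drift. Consequently the sum of
  an eigenfunction is the sum of the drift times 1 minus the other eigenvalue.\<close>

lemma sum_single_B_drift: "(\<Sum>k\<in>UNIV. single_B \<rho> (drift \<rho>) k) = (\<Sum>k\<in>UNIV. drift \<rho> k)"
proof -
  have 3: "(1::3) + 1 = 2" "(2::3) + 1 = 0" "(0::3) - 1 = 2" "(1::3) - 1 = 0" "(2::3) - 1 = 1" "(0::3) + 1 = 1"
    by simp_all
  have "win_prob \<rho> 1 = win_prob \<rho> 2" "drift \<rho> 1 = drift \<rho> 2" by (simp_all add: win_prob_def drift_def)
  thus ?thesis unfolding sum_UNIV_3 single_B_def 3 by (simp add: algebra_simps)
qed

text \<open>Source of the factor \<open>(1 + \<rho> + \<rho>\<^sup>2)\<^sup>2\<close> in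
  \<open>D_param\<close>.\<close>

lemma one_minus_e_circ_prod:
  assumes "0 < \<rho>"
  shows "(1 - e1_circ \<rho>) * (1 - e2_circ \<rho>) = 2 * (1 + \<rho> + \<rho>\<^sup>2)\<^sup>2 / ((1 + \<rho>)\<^sup>2 * (1 + \<rho>\<^sup>2))"
proof -
  have "(1 - e1_circ \<rho>) * (1 - e2_circ \<rho>) = (9 - (gap \<rho>)\<^sup>2) / 4"
    unfolding e_circ_gap by (simp add: field_simps power2_eq_square)
  also have "\<dots> = 2 * (1 + \<rho> + \<rho>\<^sup>2)\<^sup>2 / ((1 + \<rho>)\<^sup>2 * (1 + \<rho>\<^sup>2))"
    unfolding gap_square[OF assms] using assms one_plus_square_nonzero[of \<rho>]
    by (simp add: divide_simps) algebra
  finally show ?thesis .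
qed

lemma e_bounds:
  assumes "2 \<le> N" "0 < \<rho>"
  shows "0 \<le> e1 N \<rho>" "e1 N \<rho> < 1" "0 \<le> e2 N \<rho>" "e2 N \<rho> < 1"
proof -
  have "\<bar>gap \<rho>\<bar> \<le> 1" by (rule gap_bound) fact
  hence "1 \<le> 1 - e1_circ \<rho>" "1 - e1_circ \<rho> \<le> 2" "1 \<le> 1 - e2_circ \<rho>" "1 - e2_circ \<rho> \<le> 2"
    unfolding e_circ_gap by linarith+
  moreover have "2 \<le> real N" using assms by simp
  ultimately show "0 \<le> e1 N \<rho>" "e1 N \<rho> < 1" "0 \<le> e2 N \<rho>" "e2 N \<rho> < 1"
    unfolding e1_def e2_def by (simp_all add: divide_le_eq)
qed

text \<open>These are the denominators of the mean. For N = 2 the base 1 - 3/N is negative, hence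
  the detour through absolute values.\<close>

lemma one_minus_we_pos:
  assumes "2 \<le> N" "0 < \<rho>" "1 \<le> r"
  shows "0 < 1 - (1 - 3 / real N) ^ r * e1 N \<rho> ^ s" "0 < 1 - (1 - 3 / real N) ^ r * e2 N \<rho> ^ s"
proof -
  have "\<bar>1 - 3 / real N\<bar> < 1" using assms by (auto simp: abs_less_iff divide_less_eq)
  hence w: "\<bar>1 - 3 / real N\<bar> ^ r < 1" using assms by (simp add: power_less_one_iff)
  have "(1 - 3 / real N) ^ r * e ^ s < 1" if "0 \<le> e" "e < 1" for e :: real
  proof -
    have "(1 - 3 / real N) ^ r * e ^ s \<le> \<bar>1 - 3 / real N\<bar> ^ r * e ^ s"
      using that by (intro mult_right_mono) (simp_all flip: power_abs)
    also have "\<dots> \<le> \<bar>1 - 3 / real N\<bar> ^ r * 1"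
      using that by (intro mult_left_mono power_le_one) auto
    finally show ?thesis using w by simp
  qed
  with e_bounds[OF assms(1,2)]
  show "0 < 1 - (1 - 3 / real N) ^ r * e1 N \<rho> ^ s" "0 < 1 - (1 - 3 / real N) ^ r * e2 N \<rho> ^ s"
    by simp_all
qed

text \<open>The quadratic relation factors as (P - e)(P - e') b = 0 for the drift b and the
  one-player operator P, so (P - e') b is an eigenfunction for e. As a given player bets only with
  probability 1/N, the eigenvalue becomes 1 - (1 - e) / N.\<close>

lemma B_mat_eigen:
  fixes \<rho> :: real
  assumes \<rho>: "0 < \<rho>"
  shows "B_mat \<rho> *v (player_sum (\<lambda>j. single_B \<rho> (drift \<rho>) j - e2_circ \<rho> * drift \<rho> j) :: real^('n::finite \<Rightarrow> 3))
      = e1 CARD('n) \<rho> *\<^sub>R player_sum (\<lambda>j. single_B \<rho> (drift \<rho>) j - e2_circ \<rho> * drift \<rho> j)" (is ?th1)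
    and "B_mat \<rho> *v (player_sum (\<lambda>j. single_B \<rho> (drift \<rho>) j - e1_circ \<rho> * drift \<rho> j) :: real^('n::finite \<Rightarrow> 3))
      = e2 CARD('n) \<rho> *\<^sub>R player_sum (\<lambda>j. single_B \<rho> (drift \<rho>) j - e1_circ \<rho> * drift \<rho> j)" (is ?th2)
proof -
  let ?b = "drift \<rho>"
  have *: "B_mat \<rho> *v (player_sum (\<lambda>j. single_B \<rho> ?b j - e' * ?b j) :: real^('n \<Rightarrow> 3))
      = (1 - (1 - e) / real CARD('n)) *\<^sub>R player_sum (\<lambda>j. single_B \<rho> ?b j - e' * ?b j)"
    if "e + e' = -1" "e * e' = (1 - (gap \<rho>)\<^sup>2) / 4" for e e'
  proof -
    let ?r = "\<lambda>j. single_B \<rho> ?b j - e' * ?b j"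
    have "single_B \<rho> ?r j = e * ?r j" for j
    proof -
      have "single_B \<rho> ?r j = single_B \<rho> (single_B \<rho> ?b) j - e' * single_B \<rho> ?b j"
        unfolding single_B_def[of \<rho> ?r] single_B_def[of \<rho> "single_B \<rho> ?b"]
        unfolding single_B_def[of \<rho> ?b j] by (simp add: algebra_simps)
      also have "\<dots> = e * ?r j"
        using drift_quadratic[OF \<rho>, of j] that by algebra
      finally show ?thesis .
    qed
    hence "single_B \<rho> ?r = (\<lambda>j. e * ?r j + 0 * ?r j)" by (simp add: fun_eq_iff)
    hence "player_sum (single_B \<rho> ?r) = (e *\<^sub>R player_sum ?r :: real^('n \<Rightarrow> 3))"
      by (simp only: player_sum_linear) simp
    thus ?thesis
      by (simp add: B_mat_player_sum flip: scaleR_left_distrib) (simp add: field_simps)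
  qed
  show ?th1 unfolding e1_def
    by (rule *) (simp_all add: e_circ_gap field_simps power2_eq_square)
  show ?th2 unfolding e2_def
    by (rule *) (simp_all add: e_circ_gap field_simps power2_eq_square)
qed

text \<open>Here x, y, w stand for e1^s, e2^s and (1 - 3/N)^r. The square root T enters only through
  \<open>gap\<close>, which changes sign when the two eigenvalues are exchanged. So the symmetric
  part of the coefficients is rational in \<rho> and the antisymmetric part carries 1/T: these are
  the two summands of \<open>E_param\<close>.\<close>

lemma mean_algebra:
  fixes \<rho> x y w N :: real
  assumes \<rho>: "0 < \<rho>" "\<rho> \<noteq> 1" and wx: "1 - w * x \<noteq> 0" and wy: "1 - w * y \<noteq> 0"
  defines "a \<equiv> (1 - w) / 3" and "T \<equiv> T_param \<rho>" and "\<sigma> \<equiv> (1 - \<rho>) ^ 3 / ((1 + \<rho>) * (1 + \<rho>\<^sup>2))"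
  shows "((1 - x) / (1 - e1_circ \<rho>) * (a * (\<sigma> - e2_circ \<rho> * \<sigma>)) / (1 - w * x)
        - (1 - y) / (1 - e2_circ \<rho>) * (a * (\<sigma> - e1_circ \<rho> * \<sigma>)) / (1 - w * y)) / gap \<rho>
    = (3 * a * ((2 + (3 * a - 1) * (x + y - 2 * x * y) - (x + y)) * (1 - \<rho>) * (1 + \<rho>) * T
         + a * (y - x) * (5 * (1 + \<rho>)\<^sup>2 * (1 + \<rho>\<^sup>2) - 4 * \<rho>\<^sup>2)) * (1 - \<rho>)\<^sup>2)
      / (4 * (1 + (3 * a - 1) * x) * (1 + (3 * a - 1) * y) * (1 + \<rho> + \<rho>\<^sup>2)\<^sup>2 * T)"
proof -
  define d where "d = gap \<rho>"
  define u where "u = 1 - e1_circ \<rho>"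
  define v where "v = 1 - e2_circ \<rho>"
  define K where "K = (1 + \<rho> + \<rho>\<^sup>2)\<^sup>2"
  define F where "F = 5 * (1 + \<rho>)\<^sup>2 * (1 + \<rho>\<^sup>2) - 4 * \<rho>\<^sup>2"
  have pos: "0 < T" "0 < K" "0 < 1 + \<rho>" "0 < 1 + \<rho>\<^sup>2"
  proof -
    have "0 < 1 + \<rho> + \<rho>\<^sup>2" using \<rho> by (intro add_pos_pos) auto
    thus "0 < K" unfolding K_def by (rule zero_less_power)
  qed (use \<rho> T_param_pos[of \<rho>] in \<open>auto simp: T_def intro!: add_pos_pos\<close>)
  have d: "d \<noteq> 0" using pos \<rho> by (simp add: d_def gap_def flip: T_def)
  have uv: "u = 3 / 2 - d / 2" "v = 3 / 2 + d / 2" by (simp_all add: u_def v_def e_circ_gap d_def)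
  have "\<bar>d\<bar> \<le> 1" using gap_bound \<rho> by (simp add: d_def)
  hence nz: "u \<noteq> 0" "v \<noteq> 0" unfolding uv by linarith+
  have Q: "u * v = 2 * K / ((1 + \<rho>)\<^sup>2 * (1 + \<rho>\<^sup>2))"
    using one_minus_e_circ_prod[OF \<rho>(1)] by (simp add: u_def v_def K_def)
  \<comment> \<open>Origin of the polynomial \<open>F\<close> in \<open>E_param\<close>: below, u^2
    + v^2 = (9 + d^2) / 2.\<close>
  have sq: "9 + d\<^sup>2 = 2 * F / ((1 + \<rho>)\<^sup>2 * (1 + \<rho>\<^sup>2))"
    unfolding d_def gap_square[OF \<rho>(1)] F_def using pos
    by (simp add: divide_simps) algebra
  \<comment> \<open>The coefficients of the two eigenfunctions, split into symmetric and antisymmetric part.\<close>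
  define k1 where "k1 = v * \<sigma> / (u * d)"
  define k2 where "k2 = - (u * \<sigma> / (v * d))"
  have plus: "k1 + k2 = 3 * (1 - \<rho>) ^ 3 * (1 + \<rho>) / (2 * K)"
  proof -
    have "k1 + k2 = \<sigma> * (v\<^sup>2 - u\<^sup>2) / (u * v * d)"
      using nz d by (simp add: k1_def k2_def field_simps power2_eq_square)
    also have "v\<^sup>2 - u\<^sup>2 = 3 * d" unfolding uv by (simp add: power2_eq_square field_simps)
    finally have "k1 + k2 = 3 * \<sigma> / (u * v)" using d by simp
    thus ?thesis unfolding Q \<sigma>_def using pos by (simp add: divide_simps) (simp add: power2_eq_square)
  qed
  have minus: "k1 - k2 = F * (1 - \<rho>)\<^sup>2 / (2 * K * T)"
  proof -
    have "k1 - k2 = \<sigma> * (v\<^sup>2 + u\<^sup>2) / (u * v * d)"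
      using nz d by (simp add: k1_def k2_def field_simps power2_eq_square)
    also have "v\<^sup>2 + u\<^sup>2 = (9 + d\<^sup>2) / 2" unfolding uv by (simp add: power2_eq_square field_simps)
    finally have "k1 - k2 = \<sigma> * (9 + d\<^sup>2) / (2 * (u * v) * d)" by simp
    thus ?thesis unfolding Q sq unfolding \<sigma>_def d_def gap_def T_def[symmetric] using pos \<rho>
      by (simp add: divide_simps) (simp add: power2_eq_square power3_eq_cube)
  qed
  have k1: "k1 = ((k1 + k2) + (k1 - k2)) / 2" and k2: "k2 = ((k1 + k2) - (k1 - k2)) / 2" by simp_all
  have w: "3 * a - 1 = - w" by (simp add: a_def field_simps)
  have "((1 - x) / u * (a * (v * \<sigma>)) / (1 - w * x) - (1 - y) / v * (a * (u * \<sigma>)) / (1 - w * y)) / d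
      = a * (k1 * ((1 - x) * (1 - w * y)) + k2 * ((1 - y) * (1 - w * x))) / ((1 - w * x) * (1 - w * y))"
    using nz d wx wy by (simp add: k1_def k2_def divide_simps) (simp add: algebra_simps)
  also have "k1 * ((1 - x) * (1 - w * y)) + k2 * ((1 - y) * (1 - w * x))
      = (k1 + k2) / 2 * (2 - w * (x + y - 2 * x * y) - (x + y)) + (k1 - k2) / 2 * (3 * a * (y - x))"
    unfolding a_def by (simp add: field_simps)
  also have "\<dots> = 3 * ((2 - w * (x + y - 2 * x * y) - (x + y)) * (1 - \<rho>) * (1 + \<rho>) * T + a * (y - x) * F)
      * (1 - \<rho>)\<^sup>2 / (4 * K * T)"
    unfolding plus minus using pos by (simp add: divide_simps) (simp add: algebra_simps power2_eq_square power3_eq_cube)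
  finally have *: "((1 - x) / u * (a * (v * \<sigma>)) / (1 - w * x) - (1 - y) / v * (a * (u * \<sigma>)) / (1 - w * y)) / d
    = a * (3 * ((2 - w * (x + y - 2 * x * y) - (x + y)) * (1 - \<rho>) * (1 + \<rho>) * T + a * (y - x) * F)
      * (1 - \<rho>)\<^sup>2 / (4 * K * T)) / ((1 - w * x) * (1 - w * y))" .
  have \<sigma>: "\<sigma> - e2_circ \<rho> * \<sigma> = v * \<sigma>" "\<sigma> - e1_circ \<rho> * \<sigma> = u * \<sigma>"
    by (simp_all add: u_def v_def algebra_simps)
  have minus_w: "1 + - w * z = 1 - w * z" "2 + - w * z = 2 - w * z" for z by simp_all
  have regroup: "a * (3 * E * p / (4 * K * T)) / (A * B) = 3 * a * E * p / (4 * A * B * K * T)"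
    for E p A B :: real
    by (simp add: mult_ac)
  show ?thesis
    unfolding w K_def[symmetric] F_def[symmetric] d_def[symmetric] \<sigma> u_def[symmetric] v_def[symmetric] minus_w
    by (rule trans[OF * regroup])
qed

text \<open>The drift is (r1 - r2) / gap for the two eigenfunctions. At \<rho> = 1 the gap is 0 and
  this decomposition breaks down, but then the drift vanishes and both sides are 0.\<close>

lemma period_mean_eq:
  assumes N: "2 \<le> CARD('n::finite)" and r: "1 \<le> r" and s: "1 \<le> s" and \<rho>: "0 < \<rho>"
  shows "period_mean TYPE('n::finite) \<rho> r s = real (r + s) * mean_param CARD('n::finite) \<rho> r s"
proof (cases "\<rho> = 1")
  case True
  have "drift \<rho> = (\<lambda>_. 0)" by (simp add: fun_eq_iff drift_def win_prob_def True)
  hence "B_dot \<rho> *v (1 :: real^('n \<Rightarrow> 3)) = 0" by (simp add: B_dot_one player_sum_const)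
  thus ?thesis
    by (simp add: period_mean_def period_profit_def mean_param_def E_param_def Let_def True)
next
  case False
  let ?N = "real CARD('n)"
  let ?\<pi> = "stat_vec \<rho> r s :: real^('n \<Rightarrow> 3)"
  define r1 where "r1 = (\<lambda>j. single_B \<rho> (drift \<rho>) j - e2_circ \<rho> * drift \<rho> j)"
  define r2 where "r2 = (\<lambda>j. single_B \<rho> (drift \<rho>) j - e1_circ \<rho> * drift \<rho> j)"
  define w where "w = (1 - 3 / ?N) ^ r"
  define x where "x = e1 CARD('n) \<rho> ^ s"
  define y where "y = e2 CARD('n) \<rho> ^ s"
  define \<sigma> where "\<sigma> = (1 - \<rho>) ^ 3 / ((1 + \<rho>) * (1 + \<rho>\<^sup>2))"
  define a where "a = a_param CARD('n) r"
  define m where "m = (\<lambda>f. ?\<pi> \<bullet> (matpow A_mat r *v (\<Sum>v<s. matpow (B_mat \<rho>) v *v player_sum f)))"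
  have gap: "gap \<rho> \<noteq> 0" using False \<rho> T_param_pos[OF \<rho>] one_plus_square_nonzero[of \<rho>] by (simp add: gap_def)
  have "drift \<rho> = (\<lambda>j. 1 / gap \<rho> * r1 j + - (1 / gap \<rho>) * r2 j)"
    using gap by (simp add: fun_eq_iff r1_def r2_def e_circ_gap field_simps)
  hence "B_dot \<rho> *v (1 :: real^('n \<Rightarrow> 3)) = (1 / ?N) *\<^sub>R ((1 / gap \<rho>) *\<^sub>R player_sum r1 + (- (1 / gap \<rho>)) *\<^sub>R player_sum r2)"
    by (metis B_dot_one player_sum_linear)
  hence 1: "period_mean TYPE('n) \<rho> r s = 1 / ?N * (1 / gap \<rho> * m r1 + - (1 / gap \<rho>) * m r2)"
    by (simp add: period_mean_def period_profit_def m_def matrix_vector_mult_scaleR matrix_vector_right_distrib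
       matrix_vector_mult_diff_distrib sum_subtractf inner_diff_right flip: scaleR_sum_right)
  have e: "1 - e1 CARD('n) \<rho> = (1 - e1_circ \<rho>) / ?N" "1 - e2 CARD('n) \<rho> = (1 - e2_circ \<rho>) / ?N"
    by (simp_all add: e1_def e2_def)
  have pos: "0 < 1 - w * x" "0 < 1 - w * y"
    using one_minus_we_pos[OF N \<rho> r, of s] by (simp_all add: w_def x_def y_def)
  have sum1: "(\<Sum>k\<in>UNIV. r1 k) = \<sigma> - e2_circ \<rho> * \<sigma>" and sum2: "(\<Sum>k\<in>UNIV. r2 k) = \<sigma> - e1_circ \<rho> * \<sigma>"
    by (simp_all add: r1_def r2_def sum_subtractf sum_single_B_drift sum_drift[OF \<rho>] \<sigma>_def flip: sum_distrib_left)
  \<comment> \<open>One factor N comes from 1 - e = (1 - e_circ) / N, the other from the constant N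
    a_r produced by the transfers.\<close>
  have m1: "m r1 = ?N * ?N * ((1 - x) / (1 - e1_circ \<rho>) * (a * (\<sigma> - e2_circ \<rho> * \<sigma>)) / (1 - w * x))"
    unfolding m_def
    by (subst eigenfunction_mean[OF N s \<rho> B_mat_eigen(1)[OF \<rho>, folded r1_def]])
       (use e_bounds[OF N \<rho>] pos in \<open>auto simp: e sum1 a_def w_def x_def\<close>)
  have m2: "m r2 = ?N * ?N * ((1 - y) / (1 - e2_circ \<rho>) * (a * (\<sigma> - e1_circ \<rho> * \<sigma>)) / (1 - w * y))"
    unfolding m_def
    by (subst eigenfunction_mean[OF N s \<rho> B_mat_eigen(2)[OF \<rho>, folded r2_def]])
       (use e_bounds[OF N \<rho>] pos in \<open>auto simp: e sum2 a_def w_def y_def\<close>)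
  have a: "a = (1 - w) / 3" by (simp add: a_def a_param_def w_def)
  have "period_mean TYPE('n) \<rho> r s = ?N *
      (((1 - x) / (1 - e1_circ \<rho>) * (a * (\<sigma> - e2_circ \<rho> * \<sigma>)) / (1 - w * x)
        - (1 - y) / (1 - e2_circ \<rho>) * (a * (\<sigma> - e1_circ \<rho> * \<sigma>)) / (1 - w * y)) / gap \<rho>)"
  proof -
    have "1 / M * (1 / d * (M * M * A) + - (1 / d) * (M * M * B)) = M * ((A - B) / d)"
      if "M \<noteq> 0" "d \<noteq> 0" for M d A B :: real
      using that by (simp add: field_simps)
    thus ?thesis unfolding 1 m1 m2 by this (use gap in simp_all)
  qed
  also have "\<dots> = ?N * ((3 * a * ((2 + (3 * a - 1) * (x + y - 2 * x * y) - (x + y)) * (1 - \<rho>) * (1 + \<rho>) * T_param \<rho>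
         + a * (y - x) * (5 * (1 + \<rho>)\<^sup>2 * (1 + \<rho>\<^sup>2) - 4 * \<rho>\<^sup>2)) * (1 - \<rho>)\<^sup>2)
      / (4 * (1 + (3 * a - 1) * x) * (1 + (3 * a - 1) * y) * (1 + \<rho> + \<rho>\<^sup>2)\<^sup>2 * T_param \<rho>))"
    using mean_algebra[OF \<rho> False, of w x y] pos unfolding a \<sigma>_def by simp
  also have "\<dots> = real (r + s) * mean_param CARD('n) \<rho> r s"
  proof -
    have "M * (E / (4 * A * B * K * T)) = n * (M * E / (4 * n * A * B * K * T))"
      if "n \<noteq> 0" for M E A B K T n :: real
    proof -
      have "4 * n * A * B * K * T = n * (4 * A * B * K * T)" by (simp only: mult_ac)
      thus ?thesis using that by simp
    qed
    thus ?thesis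
      unfolding mean_param_def E_param_def D_param_def Let_def a_def[symmetric] x_def[symmetric] y_def[symmetric]
      by this (use s in simp)
  qed
  finally show ?thesis .
qed

subsection \<open>The law of profit and residues\<close>

lemma distr_countable_is_pmf:
  fixes Y :: "'a \<Rightarrow> 'b::countable"
  assumes M: "prob_space M" and Y: "Y \<in> M \<rightarrow>\<^sub>M count_space UNIV"
  shows "\<exists>p. distr M (count_space UNIV) Y = measure_pmf p"
proof -
  let ?D = "distr M (count_space UNIV) Y"
  interpret D: prob_space ?D using M Y by (rule prob_space.prob_space_distr)
  have "(\<Union>x\<in>{x. measure ?D {x} = 0}. {x}) \<in> null_sets ?D"
    by (rule null_sets_UN') (auto simp: null_sets_def D.emeasure_eq_measure)
  moreover have "(\<Union>x\<in>{x. measure ?D {x} = 0}. {x}) = {x. measure ?D {x} = 0}" by auto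
  ultimately have "AE x in ?D. measure ?D {x} \<noteq> 0"
    by (auto intro!: AE_I')
  hence "measure_pmf (Abs_pmf ?D) = ?D"
    by (intro Abs_pmf_inverse) (auto simp: D.prob_space_axioms)
  thus ?thesis by metis
qed

definition transfer_kernel :: "int \<times> ('n::finite \<Rightarrow> 3) \<Rightarrow> (int \<times> ('n \<Rightarrow> 3)) pmf" where
  "transfer_kernel = (\<lambda>(S, R). pmf_of_set {(i, j). i \<noteq> j} \<bind>
     (\<lambda>(i, j). return_pmf (S, R(i := R i - 1, j := R j + 1))))"

definition bet_kernel :: "real \<Rightarrow> int \<times> ('n::finite \<Rightarrow> 3) \<Rightarrow> (int \<times> ('n \<Rightarrow> 3)) pmf" where
  "bet_kernel \<rho> = (\<lambda>(S, R). pmf_of_set UNIV \<bind> (\<lambda>i. bernoulli_pmf (win_prob \<rho> (R i)) \<bind>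
     (\<lambda>win. return_pmf (if win then (S + 1, R(i := R i + 1)) else (S - 1, R(i := R i - 1))))))"

definition turn_kernel ::
  "real \<Rightarrow> nat \<Rightarrow> nat \<Rightarrow> nat \<Rightarrow> int \<times> ('n::finite \<Rightarrow> 3) \<Rightarrow> (int \<times> ('n \<Rightarrow> 3)) pmf" where
  "turn_kernel \<rho> r s n = (if n mod (r + s) < r then transfer_kernel else bet_kernel \<rho>)"

text \<open>\<open>c\<close> is the initial total capital; it may be random and is therefore a
  parameter.\<close>

definition profit_residues :: "int \<Rightarrow> ('n::finite \<Rightarrow> int) \<Rightarrow> int \<times> ('n \<Rightarrow> 3)" where
  "profit_residues c x = ((\<Sum>i\<in>UNIV. x i) - c, \<lambda>i. of_int (x i))"

lemma of_int_fun_upd: "(\<lambda>i. of_int ((x(k := v)) i)) = (\<lambda>i. of_int (x i) :: 3)(k := of_int v)"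
  by auto

text \<open>Lumpability: win probabilities depend on residues only, and the resulting kernel does
  not involve \<open>c\<close>, so the pair is Markov whatever the initial total.\<close>

lemma profit_residues_turn:
  fixes x :: "'n::finite \<Rightarrow> int"
  assumes "2 \<le> CARD('n)"
  shows "map_pmf (profit_residues c) (turn \<rho> r s n x) = turn_kernel \<rho> r s n (profit_residues c x)"
proof -
  have "\<exists>i j :: 'n. i \<noteq> j"
  proof (rule ccontr)
    assume "\<not> ?thesis"
    hence "card {(i, j :: 'n). i \<noteq> j} = 0" by auto
    thus False using assms by (simp add: card_offdiagonal)
  qed
  hence "{(i, j :: 'n). i \<noteq> j} \<noteq> {}" by auto
  hence pairs: "set_pmf (pmf_of_set {(i, j :: 'n). i \<noteq> j}) = {(i, j). i \<noteq> j}"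
    by (simp add: set_pmf_of_set)
  have A: "map_pmf (profit_residues c) (game_A' x) = transfer_kernel (profit_residues c x)"
    unfolding game_A'_def transfer_kernel_def
    by (auto simp: map_bind_pmf profit_residues_def sum_fun_upd[of "\<lambda>v. v"] of_int_fun_upd
        intro!: bind_pmf_cong simp del: fun_upd_apply)
       (auto simp: fun_eq_iff pairs)
  have B: "map_pmf (profit_residues c) (game_B \<rho> x) = bet_kernel \<rho> (profit_residues c x)"
    unfolding game_B_def bet_kernel_def
    by (auto simp: map_bind_pmf profit_residues_def sum_fun_upd[of "\<lambda>v. v"] of_int_fun_upd
        intro!: bind_pmf_cong simp del: fun_upd_apply)
  show ?thesis by (simp add: turn_def turn_kernel_def A B)
qed

text \<open>Laws of whole paths are kept, not just of \<open>X n\<close>, because the profit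
  compares \<open>X n\<close> with a possibly random \<open>X 0\<close>, and because the Markov
  property is given for paths.\<close>

lemma path_law:
  fixes X :: "nat \<Rightarrow> 'a \<Rightarrow> 'n::finite \<Rightarrow> int"
  assumes "pattern_process M \<rho> r s X"
  obtains P where
    "\<And>n. distr M (count_space UNIV) (\<lambda>\<omega>. map (\<lambda>k. X k \<omega>) [0..<Suc n]) = measure_pmf (P n)"
    "\<And>n. P (Suc n) = P n \<bind> (\<lambda>xs. map_pmf (\<lambda>y. xs @ [y]) (turn \<rho> r s n (last xs)))"
    "\<And>n xs. xs \<in> set_pmf (P n) \<Longrightarrow> length xs = Suc n"
    "\<And>n. (\<lambda>\<omega>. map (\<lambda>k. X k \<omega>) [0..<Suc n]) \<in> M \<rightarrow>\<^sub>M count_space UNIV"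
proof -
  let ?W = "\<lambda>n \<omega>. map (\<lambda>k. X k \<omega>) [0..<Suc n]"
  have M: "prob_space M" and X: "\<And>n. X n \<in> M \<rightarrow>\<^sub>M count_space UNIV"
    and markov: "\<And>n x. measure M {\<omega> \<in> space M. \<forall>k\<le>Suc n. X k \<omega> = x k} =
            measure M {\<omega> \<in> space M. \<forall>k\<le>n. X k \<omega> = x k} * pmf (turn \<rho> r s n (x n)) (x (Suc n))"
    using assms by (auto simp: pattern_process_def)
  have W: "?W n \<in> M \<rightarrow>\<^sub>M count_space UNIV" for n
  proof (rule measurable_count_space_eq_countable[THEN iffD2])
    show "countable (UNIV :: ('n \<Rightarrow> int) list set)" by simp
    have "?W n -` {xs} \<inter> space M \<in> sets M" for xs
    proof (cases "length xs = Suc n")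
      case True
      hence "?W n -` {xs} \<inter> space M = (\<Inter>k\<in>{..n}. X k -` {xs ! k} \<inter> space M)"
        by (auto simp: list_eq_iff_nth_eq less_Suc_eq_le simp del: upt_Suc)
      also have "\<dots> \<in> sets M"
        using X by (intro sets.finite_INT) (auto intro: measurable_sets)
      finally show ?thesis .
    next
      case False
      hence "?W n -` {xs} \<inter> space M = {}" by (auto simp del: upt_Suc)
      thus ?thesis by simp
    qed
    thus "?W n \<in> space M \<rightarrow> UNIV \<and> (\<forall>a\<in>UNIV. ?W n -` {a} \<inter> space M \<in> sets M)" by simp
  qed
  have "\<exists>p. distr M (count_space UNIV) (?W n) = measure_pmf p" for n
    by (rule distr_countable_is_pmf[OF M W])
  then obtain P where P: "\<And>n. distr M (count_space UNIV) (?W n) = measure_pmf (P n)" by metis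
  have pmf_P: "pmf (P n) xs = measure M (?W n -` {xs} \<inter> space M)" for n xs
    by (simp add: pmf.rep_eq measure_distr[OF W] del: upt_Suc flip: P)
  have pmf_0: "pmf (P n) xs = 0" if "length xs \<noteq> Suc n" for n xs
  proof -
    have "?W n -` {xs} \<inter> space M = {}" using that by (auto simp del: upt_Suc)
    thus ?thesis by (simp add: pmf_P)
  qed
  have pmf_len: "pmf (P n) xs = measure M {\<omega> \<in> space M. \<forall>k\<le>n. X k \<omega> = xs ! k}" if "length xs = Suc n" for n xs
    unfolding pmf_P
    by (rule arg_cong[of _ _ "measure M"])
       (use that in \<open>auto simp: list_eq_iff_nth_eq less_Suc_eq_le simp del: upt_Suc\<close>)
  show ?thesis
  proof (rule that)
    show "distr M (count_space UNIV) (?W n) = measure_pmf (P n)" for n by (rule P)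
    show "?W n \<in> M \<rightarrow>\<^sub>M count_space UNIV" for n by (rule W)
    show len: "length xs = Suc n" if "xs \<in> set_pmf (P n)" for n xs
      using that pmf_0 by (auto simp: set_pmf_iff)
    show "P (Suc n) = P n \<bind> (\<lambda>xs. map_pmf (\<lambda>y. xs @ [y]) (turn \<rho> r s n (last xs)))" (is "_ = ?R") for n
    proof (rule pmf_eqI)
      fix zs
      show "pmf (P (Suc n)) zs = pmf ?R zs"
      proof (cases "length zs = Suc (Suc n)")
        case False
        hence "zs \<notin> set_pmf ?R" using len by auto
        hence "pmf ?R zs = 0" by (rule pmf_eq_0_set_pmf[THEN iffD2])
        thus ?thesis using False by (simp add: pmf_0)
      next
        case True
        then obtain xs y where zs: "zs = xs @ [y]" and xs: "length xs = Suc n"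
          by (metis append_butlast_last_id length_butlast diff_Suc_1 list.size(3) nat.distinct(1))
        have "pmf ?R zs = (\<integral>xs'. pmf (map_pmf (\<lambda>y. xs' @ [y]) (turn \<rho> r s n (last xs'))) zs \<partial>P n)"
          by (rule pmf_bind)
        also have "\<dots> = (\<integral>xs'. indicator {xs} xs' * pmf (turn \<rho> r s n (last xs)) y \<partial>P n)"
        proof (rule Bochner_Integration.integral_cong[OF refl])
          fix xs'
          show "pmf (map_pmf (\<lambda>y. xs' @ [y]) (turn \<rho> r s n (last xs'))) zs
              = indicator {xs} xs' * pmf (turn \<rho> r s n (last xs)) y"
          proof (cases "xs' = xs")
            case True
            thus ?thesis using pmf_map_inj'[of "\<lambda>y. xs @ [y]" "turn \<rho> r s n (last xs)" y]
              by (simp add: zs inj_def)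
          next
            case False
            hence "zs \<notin> set_pmf (map_pmf (\<lambda>y. xs' @ [y]) (turn \<rho> r s n (last xs')))" by (auto simp: zs)
            hence "pmf (map_pmf (\<lambda>y. xs' @ [y]) (turn \<rho> r s n (last xs'))) zs = 0"
              by (rule pmf_eq_0_set_pmf[THEN iffD2])
            thus ?thesis using False by simp
          qed
        qed
        also have "\<dots> = pmf (P n) xs * pmf (turn \<rho> r s n (last xs)) y"
          by (simp add: measure_pmf_single)
        also have "\<dots> = measure M {\<omega> \<in> space M. \<forall>k\<le>n. X k \<omega> = zs ! k} * pmf (turn \<rho> r s n (zs ! n)) (zs ! Suc n)"
        proof -
          have "zs ! k = xs ! k" if "k \<le> n" for k using that xs by (simp add: zs nth_append)
          moreover have "zs ! Suc n = y" using xs by (simp add: zs nth_append)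
          moreover have "last xs = xs ! n" using xs by (metis diff_Suc_1 last_conv_nth list.size(3) nat.distinct(1))
          ultimately show ?thesis using xs by (simp add: pmf_len cong: conj_cong)
        qed
        also have "\<dots> = pmf (P (Suc n)) zs" using True by (simp add: pmf_len markov)
        finally show ?thesis by simp
      qed
    qed
  qed
qed

text \<open>The supports are finite even if the initial capitals are unbounded: the profit starts at
  0, there are finitely many residue vectors, and each turn has finitely many outcomes.\<close>

lemma profit_residues_law:
  fixes X :: "nat \<Rightarrow> 'a \<Rightarrow> 'n::finite \<Rightarrow> int"
  assumes N: "2 \<le> CARD('n)" and X: "pattern_process M \<rho> r s X"
  obtains Q :: "nat \<Rightarrow> (int \<times> ('n \<Rightarrow> 3)) pmf" where
    "\<And>n. cumulative_profit X n \<in> M \<rightarrow>\<^sub>M count_space UNIV"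
    "\<And>n. distr M (count_space UNIV) (cumulative_profit X n) = measure_pmf (map_pmf fst (Q n))"
    "\<And>n. Q (Suc n) = Q n \<bind> turn_kernel \<rho> r s n"
    "\<And>n. finite (set_pmf (Q n))"
    "\<And>y. y \<in> set_pmf (Q 0) \<Longrightarrow> fst y = 0"
proof -
  obtain P where
    P: "\<And>n. distr M (count_space UNIV) (\<lambda>\<omega>. map (\<lambda>k. X k \<omega>) [0..<Suc n]) = measure_pmf (P n)"
    and P_Suc: "\<And>n. P (Suc n) = P n \<bind> (\<lambda>xs. map_pmf (\<lambda>y. xs @ [y]) (turn \<rho> r s n (last xs)))"
    and len: "\<And>n xs. xs \<in> set_pmf (P n) \<Longrightarrow> length xs = Suc n"
    and W: "\<And>n. (\<lambda>\<omega>. map (\<lambda>k. X k \<omega>) [0..<Suc n]) \<in> M \<rightarrow>\<^sub>M count_space UNIV"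
    by (rule path_law[OF X]) blast
  define F :: "('n \<Rightarrow> int) list \<Rightarrow> _" where "F = (\<lambda>xs. profit_residues (\<Sum>i\<in>UNIV. hd xs i) (last xs))"
  define Q where "Q = (\<lambda>n. map_pmf F (P n))"
  have "Q (Suc n) = Q n \<bind> turn_kernel \<rho> r s n" for n
  proof -
    have "Q (Suc n) = P n \<bind> (\<lambda>xs. map_pmf (\<lambda>y. F (xs @ [y])) (turn \<rho> r s n (last xs)))"
      by (simp add: Q_def P_Suc map_bind_pmf pmf.map_comp o_def)
    also have "\<dots> = P n \<bind> (\<lambda>xs. turn_kernel \<rho> r s n (F xs))"
    proof (rule bind_pmf_cong[OF refl])
      fix xs assume "xs \<in> set_pmf (P n)"
      hence "xs \<noteq> []" using len by force
      hence "(\<lambda>y. F (xs @ [y])) = profit_residues (\<Sum>i\<in>UNIV. hd xs i)" by (simp add: F_def fun_eq_iff)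
      thus "map_pmf (\<lambda>y. F (xs @ [y])) (turn \<rho> r s n (last xs)) = turn_kernel \<rho> r s n (F xs)"
        by (simp add: profit_residues_turn[OF N] F_def)
    qed
    finally show ?thesis by (simp add: Q_def bind_map_pmf)
  qed
  moreover have zero: "fst y = 0" if y: "y \<in> set_pmf (Q 0)" for y
  proof -
    obtain xs where "xs \<in> set_pmf (P 0)" "y = F xs" using y unfolding Q_def set_map_pmf by blast
    thus ?thesis using len[of xs 0] by (cases xs) (auto simp: F_def profit_residues_def)
  qed
  moreover have "finite (set_pmf (Q n))" for n
  proof (induction n)
    case 0
    have "set_pmf (Q 0) \<subseteq> {0} \<times> UNIV" using zero by force
    thus ?case by (rule finite_subset) simp
  next
    case (Suc n)
    have "finite (set_pmf (turn_kernel \<rho> r s n y))" for y :: "int \<times> ('n \<Rightarrow> 3)"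
      by (cases y) (auto simp: turn_kernel_def transfer_kernel_def bet_kernel_def split_beta)
    thus ?case using Suc calculation(1) by simp
  qed
  moreover have profit: "(fst \<circ> F) \<circ> (\<lambda>\<omega>. map (\<lambda>k. X k \<omega>) [0..<Suc n]) = cumulative_profit X n" for n
    by (simp add: fun_eq_iff F_def profit_residues_def cumulative_profit_def hd_map last_map del: upt_Suc)
  moreover have "cumulative_profit X n \<in> M \<rightarrow>\<^sub>M count_space UNIV" for n
    unfolding profit[symmetric] by (rule measurable_comp[OF W]) simp
  moreover have "distr M (count_space UNIV) (cumulative_profit X n) = measure_pmf (map_pmf fst (Q n))" for n
  proof -
    have "measure_pmf (map_pmf fst (Q n)) = distr (distr M (count_space UNIV)
        (\<lambda>\<omega>. map (\<lambda>k. X k \<omega>) [0..<Suc n])) (count_space UNIV) (fst \<circ> F)"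
      by (simp add: Q_def pmf.map_comp map_pmf_rep_eq P del: upt_Suc)
    also have "\<dots> = distr M (count_space UNIV) (cumulative_profit X n)"
      unfolding profit[symmetric] by (rule distr_distr) (use W in auto)
    finally show ?thesis ..
  qed
  ultimately show ?thesis by (intro that)
qed

subsection \<open>Generating functions\<close>

lemma expectation_transfer_kernel:
  fixes f :: "('n::finite \<Rightarrow> 3) \<Rightarrow> complex"
  assumes N: "2 \<le> CARD('n)"
  shows "measure_pmf.expectation (transfer_kernel (S, R)) (\<lambda>(S, R). exp (z * of_int S) * f R)
    = exp (z * of_int S) * transfer f R"
proof -
  have "card {(i, j :: 'n). i \<noteq> j} \<noteq> 0" using N by (simp add: card_offdiagonal)
  hence ne: "{(i, j :: 'n). i \<noteq> j} \<noteq> {}" by (metis card.empty)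
  show ?thesis
    unfolding transfer_kernel_def prod.case
    by (subst pmf_expectation_bind_pmf_of_set[OF ne])
       (auto simp: transfer_def case_prod_unfold scaleR_sum_right sum_distrib_left)
qed

lemma expectation_bet_kernel:
  fixes f :: "('n::finite \<Rightarrow> 3) \<Rightarrow> complex"
  assumes \<rho>: "0 < \<rho>"
  shows "measure_pmf.expectation (bet_kernel \<rho> (S, R)) (\<lambda>(S, R). exp (z * of_int S) * f R)
    = exp (z * of_int S) * bet \<rho> (exp z) (exp (- z)) f R"
proof -
  let ?g = "\<lambda>(S, R). exp (z * of_int S) * f R"
  let ?u = "\<lambda>i. (S + 1, R(i := R i + 1))" and ?d = "\<lambda>i. (S - 1, R(i := R i - 1))"
  have step: "measure_pmf.expectation (bernoulli_pmf p \<bind> (\<lambda>win. return_pmf (if win then a else b))) h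
      = p *\<^sub>R h a + (1 - p) *\<^sub>R h b" if "0 \<le> p" "p \<le> 1"
    for p and a b :: "int \<times> ('n \<Rightarrow> 3)" and h :: "_ \<Rightarrow> complex"
    using that by (subst pmf_expectation_bind[of UNIV]) (auto simp: UNIV_bool)
  have "measure_pmf.expectation (bet_kernel \<rho> (S, R)) ?g
    = (\<Sum>i\<in>UNIV. (win_prob \<rho> (R i) *\<^sub>R ?g (?u i) + (1 - win_prob \<rho> (R i)) *\<^sub>R ?g (?d i)) /\<^sub>R real CARD('n))"
    unfolding bet_kernel_def prod.case
    by (subst pmf_expectation_bind_pmf_of_set)
       (use win_prob_bounds[OF \<rho>] in \<open>auto simp: step less_imp_le\<close>)
  also have "\<dots> = exp (z * of_int S) * bet \<rho> (exp z) (exp (- z)) f R"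
    unfolding bet_def
    by (simp add: scaleR_sum_right sum_distrib_left algebra_simps exp_add exp_diff exp_minus divide_inverse)
  finally show ?thesis .
qed

locale profit_chain =
  fixes Q :: "nat \<Rightarrow> (int \<times> ('n::finite \<Rightarrow> 3)) pmf" and \<rho> :: real and r s :: nat
  assumes N: "2 \<le> CARD('n)" and r: "1 \<le> r" and s: "1 \<le> s" and \<rho>: "0 < \<rho>"
    and Q_Suc: "\<And>n. Q (Suc n) = Q n \<bind> turn_kernel \<rho> r s n"
    and finite_Q: "\<And>n. finite (set_pmf (Q n))"
    and Q_0: "\<And>y. y \<in> set_pmf (Q 0) \<Longrightarrow> fst y = 0"
begin

definition tilted :: "nat \<Rightarrow> complex \<Rightarrow> (('n \<Rightarrow> 3) \<Rightarrow> complex) \<Rightarrow> complex" where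
  "tilted n z f = measure_pmf.expectation (Q n) (\<lambda>(S, R). exp (z * of_int S) * f R)"

definition mgf :: "nat \<Rightarrow> real \<Rightarrow> real" where
  "mgf n a = measure_pmf.expectation (Q n) (\<lambda>(S, R). exp (a * of_int S))"

lemma integrable_Q: "integrable (measure_pmf (Q n)) (f :: _ \<Rightarrow> 'b::{banach, second_countable_topology})"
  by (rule integrable_measure_pmf_finite) (rule finite_Q)

lemma tilted_Suc:
  "tilted (Suc n) z f = tilted n z (if n mod (r + s) < r then transfer f else bet \<rho> (exp z) (exp (- z)) f)"
proof -
  let ?g = "\<lambda>(S, R). exp (z * of_int S) * f R"
  have fin: "finite (set_pmf (turn_kernel \<rho> r s n y))" for y :: "int \<times> ('n \<Rightarrow> 3)"
    by (cases y) (auto simp: turn_kernel_def transfer_kernel_def bet_kernel_def split_beta)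
  have ker: "measure_pmf.expectation (turn_kernel \<rho> r s n y) ?g = (case y of (S, R) \<Rightarrow> exp (z * of_int S) *
      (if n mod (r + s) < r then transfer f else bet \<rho> (exp z) (exp (- z)) f) R)" for y
    by (cases y) (simp add: turn_kernel_def expectation_transfer_kernel[OF N] expectation_bet_kernel[OF \<rho>])
  have "tilted (Suc n) z f = (\<Sum>y\<in>set_pmf (Q n). pmf (Q n) y *\<^sub>R measure_pmf.expectation (turn_kernel \<rho> r s n y) ?g)"
    unfolding tilted_def Q_Suc by (rule pmf_expectation_bind[OF finite_Q fin]) simp
  also have "\<dots> = measure_pmf.expectation (Q n) (\<lambda>y. measure_pmf.expectation (turn_kernel \<rho> r s n y) ?g)"
    by (rule integral_measure_pmf[symmetric, OF finite_Q]) auto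
  finally show ?thesis by (simp only: tilted_def ker)
qed

lemma tilted_diff: "tilted n z (\<lambda>R. f R - g R) = tilted n z f - tilted n z g"
  unfolding tilted_def
  by (subst Bochner_Integration.integral_diff[symmetric, OF integrable_Q integrable_Q])
     (simp add: case_prod_unfold algebra_simps)

lemma tilted_cmult: "tilted n z (\<lambda>R. c * f R) = c * tilted n z f"
  unfolding tilted_def
  by (subst integral_mult_right_zero[symmetric]) (simp add: case_prod_unfold algebra_simps)

lemma norm_tilted_le:
  assumes "\<And>R. norm (f R) \<le> c"
  shows "norm (tilted n z f) \<le> c * mgf n (Re z)"
proof -
  have "norm (tilted n z f) \<le> measure_pmf.expectation (Q n) (\<lambda>y. norm (case y of (S, R) \<Rightarrow> exp (z * of_int S) * f R))"
    unfolding tilted_def by (rule integral_norm_bound)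
  also have "\<dots> \<le> measure_pmf.expectation (Q n) (\<lambda>y. c * (case y of (S, R) \<Rightarrow> exp (Re z * of_int S)))"
    by (rule integral_mono[OF integrable_Q integrable_Q])
       (auto simp: norm_mult mult.commute[of c] intro!: mult_left_mono assms split: prod.splits)
  finally show ?thesis by (simp add: mgf_def)
qed

lemma norm_tilted_diff_le:
  assumes "\<And>R. norm (f R - g R) \<le> c"
  shows "norm (tilted n z f - tilted n z g) \<le> c * mgf n (Re z)"
  using norm_tilted_le[of "\<lambda>R. f R - g R" c n z] assms by (simp add: tilted_diff)

lemma mgf_nonneg: "0 \<le> mgf n a"
  by (auto simp: mgf_def case_prod_unfold intro!: integral_nonneg)

lemma mgf_0 [simp]: "mgf n 0 = 1"
  by (simp add: mgf_def case_prod_unfold)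

lemma tilted_of_real: "tilted n (of_real a) (\<lambda>_. 1) = of_real (mgf n a)"
proof -
  have "exp (complex_of_real a * of_int S) = complex_of_real (exp (a * of_int S))" for S
    by (metis exp_of_real of_real_mult of_real_of_int_eq)
  thus ?thesis unfolding tilted_def mgf_def
    by (simp add: case_prod_unfold integral_complex_of_real)
qed

lemma tilted_start: "tilted 0 z f = tilted 0 0 f"
  unfolding tilted_def
  by (rule integral_cong_AE) (auto simp: AE_measure_pmf_iff dest!: Q_0)

lemma mgf_start: "mgf 0 a = 1"
proof -
  have "mgf 0 a = mgf 0 0"
    unfolding mgf_def by (rule integral_cong_AE) (auto simp: AE_measure_pmf_iff dest!: Q_0)
  thus ?thesis by simp
qed

lemma tilted_transfers:
  "j \<le> r \<Longrightarrow> tilted (k * (r + s) + j) z f = tilted (k * (r + s)) z ((transfer ^^ j) f)"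
proof (induction j arbitrary: f)
  case (Suc j)
  have "(k * (r + s) + j) mod (r + s) = j" using Suc.prems s by simp
  thus ?case using Suc by (simp add: tilted_Suc funpow_swap1)
qed simp

lemma tilted_bets:
  "j \<le> s \<Longrightarrow> tilted (k * (r + s) + r + j) z f = tilted (k * (r + s) + r) z ((bet \<rho> (exp z) (exp (- z)) ^^ j) f)"
proof (induction j arbitrary: f)
  case (Suc j)
  have "(k * (r + s) + (r + j)) mod (r + s) = r + j" using Suc.prems by simp
  thus ?case using Suc by (simp add: tilted_Suc funpow_swap1 add.assoc)
qed simp

text \<open>The latest turn acts first on \<open>f\<close>, so the bets that end a period form the
  inner operator.\<close>

lemma tilted_period:
  "tilted (Suc k * (r + s)) z f
    = tilted (k * (r + s)) z ((transfer ^^ r) ((bet \<rho> (exp z) (exp (- z)) ^^ s) f))"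
proof -
  have "Suc k * (r + s) = k * (r + s) + r + s" by simp
  thus ?thesis by (simp only: tilted_bets tilted_transfers order_refl)
qed

lemma norm_bet_one_le:
  fixes u v :: complex
  assumes "norm u \<le> c" "norm v \<le> c"
  shows "norm (bet \<rho> u v (\<lambda>_. 1) (R :: 'n \<Rightarrow> 3)) \<le> c"
proof -
  have "norm (\<Sum>i\<in>UNIV. win_prob \<rho> (R i) *\<^sub>R u + (1 - win_prob \<rho> (R i)) *\<^sub>R v) \<le> (\<Sum>i\<in>(UNIV :: 'n set). c)"
  proof (rule sum_norm_le)
    fix i
    have "norm (win_prob \<rho> (R i) *\<^sub>R u + (1 - win_prob \<rho> (R i)) *\<^sub>R v)
        \<le> win_prob \<rho> (R i) * norm u + (1 - win_prob \<rho> (R i)) * norm v"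
      using win_prob_bounds[OF \<rho>, of "R i"] by (intro norm_triangle_le) simp
    also have "\<dots> \<le> win_prob \<rho> (R i) * c + (1 - win_prob \<rho> (R i)) * c"
      using win_prob_bounds[OF \<rho>, of "R i"] assms by (intro add_mono mult_left_mono) auto
    finally show "norm (win_prob \<rho> (R i) *\<^sub>R u + (1 - win_prob \<rho> (R i)) *\<^sub>R v) \<le> c"
      by (simp add: algebra_simps)
  qed
  thus ?thesis by (simp add: bet_def divide_simps mult.commute)
qed

text \<open>A turn changes the profit by at most 1. This crude bound serves for the incomplete
  period at the end.\<close>

lemma mgf_Suc_le: "mgf (Suc n) a \<le> exp \<bar>a\<bar> * mgf n a"
proof -
  let ?f = "\<lambda>_ :: 'n \<Rightarrow> 3. 1 :: complex"
  let ?g = "if n mod (r + s) < r then transfer ?f else bet \<rho> (exp (of_real a)) (exp (- of_real a)) ?f"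
  have "norm (?g R) \<le> exp \<bar>a\<bar>" for R
    by (auto simp: transfer_const[OF N] norm_exp_eq_Re intro!: norm_bet_one_le)
  hence "norm (tilted n (of_real a) ?g) \<le> exp \<bar>a\<bar> * mgf n (Re (of_real a))"
    by (rule norm_tilted_le)
  hence "norm (complex_of_real (mgf (Suc n) a)) \<le> exp \<bar>a\<bar> * mgf n a"
    by (simp add: tilted_Suc flip: tilted_of_real)
  thus ?thesis using mgf_nonneg[of "Suc n" a] by simp
qed

lemma mgf_add_le: "mgf (n + j) a \<le> exp (real j * \<bar>a\<bar>) * mgf n a"
proof (induction j)
  case (Suc j)
  have "mgf (n + Suc j) a \<le> exp \<bar>a\<bar> * mgf (n + j) a" using mgf_Suc_le[of "n + j" a] by simp
  also have "\<dots> \<le> exp \<bar>a\<bar> * (exp (real j * \<bar>a\<bar>) * mgf n a)" using Suc by (intro mult_left_mono) auto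
  finally show ?case by (simp add: exp_add algebra_simps)
qed simp

text \<open>A turn multiplies by factors within |\<theta>| of 1; this handles the incomplete last
  period of characteristic functions.\<close>

lemma char_Suc_diff:
  "norm (tilted (Suc n) (\<i> * of_real \<theta>) (\<lambda>_. 1) - tilted n (\<i> * of_real \<theta>) (\<lambda>_. 1)) \<le> \<bar>\<theta>\<bar>"
proof -
  let ?f = "\<lambda>_ :: 'n \<Rightarrow> 3. 1 :: complex" and ?z = "\<i> * of_real \<theta>"
  let ?g = "if n mod (r + s) < r then transfer ?f else bet \<rho> (exp ?z) (exp (- ?z)) ?f"
  have e: "norm (exp ?z - 1) \<le> \<bar>\<theta>\<bar>" "norm (exp (- ?z) - 1) \<le> \<bar>\<theta>\<bar>"
    using iexp_approx1[of \<theta> 0] iexp_approx1[of "- \<theta>" 0] by simp_all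
  have "norm (?g R - ?f R) \<le> \<bar>\<theta>\<bar>" for R
  proof (cases "n mod (r + s) < r")
    case False
    have "bet \<rho> (exp ?z) (exp (- ?z)) ?f R - 1 = bet \<rho> (exp ?z) (exp (- ?z)) ?f R - bet \<rho> 1 1 ?f R"
      by (simp add: bet_const)
    also have "\<dots> = bet \<rho> (exp ?z - 1) (exp (- ?z) - 1) ?f R"
      by (simp add: bet_def sum_subtractf sum.distrib scaleR_right_distrib scaleR_right_diff_distrib)
    finally show ?thesis using False norm_bet_one_le[OF e] by simp
  qed (simp add: transfer_const[OF N])
  hence "norm (tilted n ?z ?g - tilted n ?z ?f) \<le> \<bar>\<theta>\<bar> * mgf n (Re ?z)"
    by (rule norm_tilted_diff_le)
  thus ?thesis by (simp add: tilted_Suc)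
qed

lemma char_add_diff:
  "norm (tilted (n + j) (\<i> * of_real \<theta>) (\<lambda>_. 1) - tilted n (\<i> * of_real \<theta>) (\<lambda>_. 1)) \<le> real j * \<bar>\<theta>\<bar>"
proof (induction j)
  case (Suc j)
  show ?case using norm_triangle_mono[OF char_Suc_diff[of "n + j" \<theta>] Suc] by (simp add: algebra_simps)
qed simp

end

section \<open>Estimates from an approximate eigenvector, uniform in the residues\<close>

context profit_chain
begin

definition mean :: real where "mean = mean_param CARD('n) \<rho> r s"
definition var :: real where "var = variance_param TYPE('n) \<rho> r s"
abbreviation L :: nat where "L \<equiv> r + s"

text \<open>The condition \<open>c * \<delta> \<le> 1 / 2\<close> keeps \<open>w z\<close> within
  1/2 of 1, so exchanging it for 1 costs only a bounded factor.\<close>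

definition approximate_eigenvector ::
  "(complex \<Rightarrow> ('n \<Rightarrow> 3) \<Rightarrow> complex) \<Rightarrow> real \<Rightarrow> real \<Rightarrow> real \<Rightarrow> bool" where
  "approximate_eigenvector w C c \<delta> \<longleftrightarrow> 0 \<le> C \<and> 0 \<le> c \<and> 0 < \<delta> \<and> \<delta> \<le> 1 \<and> c * \<delta> \<le> 1 / 2 \<and>
     (\<forall>z R. norm z \<le> \<delta> \<longrightarrow> norm (w z R - 1) \<le> c * norm z) \<and>
     (\<forall>z R. z \<noteq> 0 \<longrightarrow> norm z \<le> \<delta> \<longrightarrow>
        norm ((transfer ^^ r) ((bet \<rho> (exp z) (exp (- z)) ^^ s) (w z)) R
          - exp (of_real (real L * mean) * z + of_real (real L * var / 2) * z\<^sup>2) * w z R) \<le> C * norm z ^ 3)"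

lemma approximate_eigenvector_exists:
  obtains w C c \<delta> where "approximate_eigenvector w C c \<delta>"
proof -
  let ?l = "\<lambda>z. exp (of_real (real L * mean) * z + of_real (real L * var / 2) * z\<^sup>2) :: complex"
  obtain h g :: "real^('n \<Rightarrow> 3)" where hg:
    "\<forall>x. (\<lambda>z. (transfer ^^ r) ((bet \<rho> (exp z) (exp (- z)) ^^ s)
          (\<lambda>x. 1 + of_real (h $ x) * z + of_real (g $ x) * z\<^sup>2)) x
        - ?l z * (1 + of_real (h $ x) * z + of_real (g $ x) * z\<^sup>2)) \<in> O[at 0](\<lambda>z::complex. z ^ 3)"
    using perturbed_eigenvector[OF N s \<rho>, of r, folded var_def,
        unfolded period_mean_eq[OF N r s \<rho>], folded mean_def]
    by (elim exE) (rule that)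
  define w where "w = (\<lambda>z x. 1 + of_real (h $ x) * z + of_real (g $ x) * z\<^sup>2 :: complex)"
  let ?err = "\<lambda>z x. norm ((transfer ^^ r) ((bet \<rho> (exp z) (exp (- z)) ^^ s) (w z)) x - ?l z * w z x)"
  have "\<exists>C>0. eventually (\<lambda>z. ?err z x \<le> C * norm (z ^ 3)) (at 0)" for x
  proof -
    have "(\<lambda>z. (transfer ^^ r) ((bet \<rho> (exp z) (exp (- z)) ^^ s) (w z)) x - ?l z * w z x) \<in> O[at 0](\<lambda>z. z ^ 3)"
      using hg[rule_format, of x] unfolding w_def .
    thus ?thesis unfolding bigo_def mem_Collect_eq .
  qed
  hence "\<exists>K. \<forall>x. 0 < K x \<and> eventually (\<lambda>z. ?err z x \<le> K x * norm (z ^ 3)) (at 0)"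
    by (intro choice allI)
  then obtain K where K': "\<forall>x. 0 < K x \<and> eventually (\<lambda>z. ?err z x \<le> K x * norm (z ^ 3)) (at 0)"
    by (elim exE) (rule that)
  have K: "0 < K x" "eventually (\<lambda>z. ?err z x \<le> K x * norm (z ^ 3)) (at 0)" for x
    using K'[rule_format, of x] by (rule conjunct1, rule conjunct2)
  define C where "C = sum K UNIV"
  define c where "c = (\<Sum>x\<in>UNIV. \<bar>h $ x\<bar> + \<bar>g $ x\<bar>)"
  have "eventually (\<lambda>z. \<forall>x. ?err z x \<le> K x * norm (z ^ 3)) (at 0)"
    by (rule eventually_all_finite) (rule K)
  then obtain d where d: "0 < d" "\<And>z x. z \<noteq> 0 \<Longrightarrow> norm z < d \<Longrightarrow> ?err z x \<le> K x * norm (z ^ 3)"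
    unfolding eventually_at by auto
  have c: "0 \<le> c" by (simp add: c_def sum_nonneg)
  \<comment> \<open>Halving \<open>d\<close> gives the strict inequality \<open>norm z < d\<close>;
    the \<open>+ 1\<close> covers c = 0 and also yields \<delta> \<le> 1.\<close>
  define \<delta> where "\<delta> = min (d / 2) (1 / (2 * (c + 1)))"
  have "approximate_eigenvector w C c \<delta>"
    unfolding approximate_eigenvector_def
  proof (intro conjI allI impI)
    show "0 \<le> C" using K(1) by (auto simp: C_def less_imp_le intro!: sum_nonneg)
    show "0 \<le> c" by (rule c)
    show "0 < \<delta>" using d c by (simp add: \<delta>_def)
    have "\<delta> \<le> 1 / (2 * (c + 1))" by (simp add: \<delta>_def)
    also have "\<dots> \<le> 1" using c by simp
    finally show \<delta>1: "\<delta> \<le> 1" .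
    have "c * \<delta> \<le> c * (1 / (2 * (c + 1)))" using c by (intro mult_left_mono) (simp_all add: \<delta>_def)
    also have "\<dots> \<le> 1 / 2" using c by (simp add: divide_simps)
    finally show "c * \<delta> \<le> 1 / 2" .
    show "norm (w z R - 1) \<le> c * norm z" if "norm z \<le> \<delta>" for z R
    proof -
      have z: "norm z \<le> 1" using that \<delta>1 by linarith
      have "norm (w z R - 1) \<le> \<bar>h $ R\<bar> * norm z + \<bar>g $ R\<bar> * norm z ^ 2"
        unfolding w_def by (auto intro!: norm_triangle_le simp: norm_mult norm_power)
      also have "\<dots> \<le> \<bar>h $ R\<bar> * norm z + \<bar>g $ R\<bar> * norm z"
        using z by (intro add_left_mono mult_left_mono) (auto simp: power2_eq_square mult_left_le)
      also have "\<dots> = (\<bar>h $ R\<bar> + \<bar>g $ R\<bar>) * norm z" by (simp add: algebra_simps)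
      also have "\<dots> \<le> c * norm z"
        unfolding c_def by (intro mult_right_mono member_le_sum) auto
      finally show ?thesis .
    qed
    show "?err z R \<le> C * norm z ^ 3" if "z \<noteq> 0" "norm z \<le> \<delta>" for z R
    proof -
      have "norm z < d" using that d(1) by (simp add: \<delta>_def)
      hence "?err z R \<le> K R * norm z ^ 3" using d(2)[of z R] that by (simp add: norm_power)
      also have "\<dots> \<le> C * norm z ^ 3"
        unfolding C_def using K(1) by (intro mult_right_mono member_le_sum) (auto simp: less_imp_le)
      finally show ?thesis .
    qed
  qed
  thus ?thesis by (rule that)
qed

lemma period_decomp: "n = (n div L) * L + n mod L" "n mod L \<le> L"
  using s by (simp_all only: div_mult_mod_eq) (simp add: less_imp_le)

text \<open>At period ends the generating function is at most twice |E[exp (a S) w(R)]|, which grows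
  per period by at most the factor exp (m a + C' a^2).\<close>

lemma mgf_bound:
  obtains K C \<delta> :: real where "0 < K" "0 \<le> C" "0 < \<delta>"
    "\<forall>a n. \<bar>a\<bar> \<le> \<delta> \<longrightarrow> mgf n a \<le> K * exp (real n * (mean * a + C * a\<^sup>2))"
proof -
  obtain w C c \<delta> where ev: "approximate_eigenvector w C c \<delta>" by (rule approximate_eigenvector_exists)
  note ev = ev[unfolded approximate_eigenvector_def]
  have C: "0 \<le> C" and c: "0 \<le> c" and \<delta>: "0 < \<delta>" "\<delta> \<le> 1" "c * \<delta> \<le> 1 / 2"
    using ev by blast+
  have w: "\<And>z R. norm z \<le> \<delta> \<Longrightarrow> norm (w z R - 1) \<le> c * norm z"
    using ev by blast
  have approx: "\<And>z R. z \<noteq> 0 \<Longrightarrow> norm z \<le> \<delta> \<Longrightarrow>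
      norm ((transfer ^^ r) ((bet \<rho> (exp z) (exp (- z)) ^^ s) (w z)) R
        - exp (of_real (real L * mean) * z + of_real (real L * var / 2) * z\<^sup>2) * w z R) \<le> C * norm z ^ 3"
    using ev by blast
  define m where "m = real L * mean"
  define V where "V = real L * var / 2"
  \<comment> \<open>The cubic error is absorbed through |a|^3 \<le> a^2;
    \<open>exp \<bar>m\<bar>\<close> pays for factoring out exp (m a).\<close>
  define C' where "C' = \<bar>V\<bar> + 2 * C * exp \<bar>m\<bar>"
  \<comment> \<open>3 = 2 * 3/2, from exchanging \<open>w\<close> and 1 at the last period end and
    at time 0; the exponential covers the incomplete period.\<close>
  define K where "K = 3 * exp (real L + \<bar>m\<bar>)"
  have C': "0 \<le> C'" using C by (simp add: C'_def)
  show ?thesis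
  proof (rule that[of K C' \<delta>])
    show "0 < K" by (simp add: K_def)
    show "0 \<le> C'" by (rule C')
    show "0 < \<delta>" by (rule \<delta>)
    show "\<forall>a n. \<bar>a\<bar> \<le> \<delta> \<longrightarrow> mgf n a \<le> K * exp (real n * (mean * a + C' * a\<^sup>2))"
    proof (intro allI impI)
      fix a :: real and n :: nat
      assume a: "\<bar>a\<bar> \<le> \<delta>"
      show "mgf n a \<le> K * exp (real n * (mean * a + C' * a\<^sup>2))"
      proof (cases "a = 0")
        case True
        have "1 \<le> exp (real L + \<bar>m\<bar>)" by simp
        hence "1 \<le> K" unfolding K_def by linarith
        thus ?thesis using True by simp
      next
        case False
        let ?z = "complex_of_real a"
        have z: "?z \<noteq> 0" "norm ?z \<le> \<delta>" using False a by simp_all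
        have a1: "\<bar>a\<bar> \<le> 1" using a \<delta> by linarith
        define A where "A = (\<lambda>k. norm (tilted (k * L) ?z (w ?z)))"
        have w_half: "norm (w ?z R - 1) \<le> 1 / 2" for R
        proof -
          have "norm (w ?z R - 1) \<le> c * \<bar>a\<bar>" using w[OF z(2)] by simp
          also have "\<dots> \<le> c * \<delta>" using c a by (rule mult_left_mono[rotated])
          finally show ?thesis using \<delta>(3) by linarith
        qed
        have diff: "norm (tilted n ?z (w ?z) - of_real (mgf n a)) \<le> 1 / 2 * mgf n a" for n
          using norm_tilted_diff_le[of "w ?z" "\<lambda>_. 1" "1 / 2" n ?z] w_half by (simp add: tilted_of_real)
        have mgf_A: "mgf (k * L) a \<le> 2 * A k" for k
          using norm_triangle_ineq2[of "of_real (mgf (k * L) a)" "tilted (k * L) ?z (w ?z)"] diff[of "k * L"]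
            mgf_nonneg[of "k * L" a]
          by (simp add: A_def norm_minus_commute)
        have A0: "A 0 \<le> 3 / 2"
          using norm_triangle_ineq2[of "tilted 0 ?z (w ?z)" "of_real (mgf 0 a)"] diff[of 0]
          by (simp add: A_def mgf_start)
        have step: "A (Suc k) \<le> exp (m * a + C' * a\<^sup>2) * A k" for k
        proof -
          let ?l = "exp (of_real (real L * mean) * ?z + of_real (real L * var / 2) * ?z\<^sup>2)"
          have l: "norm ?l = exp (m * a + V * a\<^sup>2)"
            by (simp add: norm_exp_eq_Re m_def V_def flip: of_real_power of_real_mult)
          have "norm (tilted (Suc k * L) ?z (w ?z) - ?l * tilted (k * L) ?z (w ?z)) \<le> C * norm ?z ^ 3 * mgf (k * L) (Re ?z)"
            unfolding tilted_period tilted_cmult[symmetric]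
            by (rule norm_tilted_diff_le) (rule approx[OF z])
          also have "\<dots> \<le> C * \<bar>a\<bar> ^ 3 * (2 * A k)"
            using C mgf_A by (intro mult_mono) (auto simp: mgf_nonneg)
          finally have "norm (tilted (Suc k * L) ?z (w ?z)) \<le> norm (?l * tilted (k * L) ?z (w ?z)) + C * \<bar>a\<bar> ^ 3 * (2 * A k)"
            by (rule order_trans[OF norm_triangle_sub add_left_mono])
          hence "A (Suc k) \<le> exp (m * a + V * a\<^sup>2) * A k + C * \<bar>a\<bar> ^ 3 * (2 * A k)"
            unfolding norm_mult l A_def .
          also have "\<dots> = (exp (m * a + V * a\<^sup>2) + 2 * C * \<bar>a\<bar> ^ 3) * A k" by (simp only: algebra_simps)
          also have "\<dots> \<le> exp (m * a + C' * a\<^sup>2) * A k"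
          proof (rule mult_right_mono)
            have 1: "exp (m * a + V * a\<^sup>2) \<le> exp (m * a) * exp (\<bar>V\<bar> * a\<^sup>2)"
              by (auto simp flip: exp_add intro!: mult_right_mono)
            have "\<bar>a\<bar> ^ 3 \<le> a\<^sup>2"
              using a1 by (simp add: power3_eq_cube power2_eq_square mult_left_le abs_mult_self_eq)
            moreover have "1 \<le> exp (m * a) * exp \<bar>m\<bar>"
            proof -
              have "\<bar>m * a\<bar> \<le> \<bar>m\<bar>" using a1 by (simp add: abs_mult mult_left_le)
              thus ?thesis by (simp flip: exp_add)
            qed
            ultimately have "2 * C * \<bar>a\<bar> ^ 3 * 1 \<le> 2 * C * a\<^sup>2 * (exp (m * a) * exp \<bar>m\<bar>)"
              using C by (intro mult_mono mult_left_mono) auto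
            also have "\<dots> \<le> exp (m * a) * exp (\<bar>V\<bar> * a\<^sup>2) * (2 * C * exp \<bar>m\<bar> * a\<^sup>2)"
            proof -
              have "2 * C * a\<^sup>2 * (exp (m * a) * exp \<bar>m\<bar>) * 1 \<le> 2 * C * a\<^sup>2 * (exp (m * a) * exp \<bar>m\<bar>) * exp (\<bar>V\<bar> * a\<^sup>2)"
                using C by (intro mult_left_mono) auto
              thus ?thesis by (simp add: mult_ac)
            qed
            finally have "exp (m * a + V * a\<^sup>2) + 2 * C * \<bar>a\<bar> ^ 3
                \<le> exp (m * a) * exp (\<bar>V\<bar> * a\<^sup>2) * (1 + 2 * C * exp \<bar>m\<bar> * a\<^sup>2)"
              using 1 by (simp add: algebra_simps)
            also have "\<dots> \<le> exp (m * a) * exp (\<bar>V\<bar> * a\<^sup>2) * exp (2 * C * exp \<bar>m\<bar> * a\<^sup>2)"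
              by (intro mult_left_mono exp_ge_add_one_self) auto
            also have "\<dots> = exp (m * a + C' * a\<^sup>2)"
              by (simp add: C'_def algebra_simps flip: exp_add)
            finally show "exp (m * a + V * a\<^sup>2) + 2 * C * \<bar>a\<bar> ^ 3 \<le> exp (m * a + C' * a\<^sup>2)" .
          qed (simp add: A_def)
          finally show ?thesis .
        qed
        have Ak: "A k \<le> 3 / 2 * exp (real k * (m * a + C' * a\<^sup>2))" for k
        proof (induction k)
          case (Suc k)
          have "A (Suc k) \<le> exp (m * a + C' * a\<^sup>2) * (3 / 2 * exp (real k * (m * a + C' * a\<^sup>2)))"
            by (rule order_trans[OF step mult_left_mono[OF Suc]]) simp
          thus ?case by (simp add: exp_add algebra_simps)
        qed (use A0 in simp)
        define k where "k = n div L"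
        define j where "j = n mod L"
        have n: "n = k * L + j" and j: "j \<le> L" using period_decomp[of n] by (simp_all add: k_def j_def)
        have "mgf n a \<le> exp (real j * \<bar>a\<bar>) * (2 * (3 / 2 * exp (real k * (m * a + C' * a\<^sup>2))))"
          using mgf_add_le[of "k * L" j a] mgf_A[of k] Ak[of k]
          by (smt (verit) n mult_left_mono exp_ge_zero)
        also have "\<dots> = 3 * exp (real j * \<bar>a\<bar> + real k * (m * a + C' * a\<^sup>2))"
          by (simp add: exp_add)
        also have "real j * \<bar>a\<bar> + real k * (m * a + C' * a\<^sup>2) \<le> real L + \<bar>m\<bar> + real n * (mean * a + C' * a\<^sup>2)"
        proof -
          have 1: "real j * \<bar>a\<bar> \<le> real L * 1" using j a1 by (intro mult_mono) auto
          have "real k \<le> real n" by (simp add: k_def)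
          hence 2: "real k * (C' * a\<^sup>2) \<le> real n * (C' * a\<^sup>2)" using C' by (intro mult_right_mono) auto
          have "\<bar>real j * (mean * a)\<bar> = real j * (\<bar>mean\<bar> * \<bar>a\<bar>)" by (simp only: abs_mult abs_of_nat)
          also have "\<dots> \<le> real L * (\<bar>mean\<bar> * 1)"
            using j a1 by (intro mult_mono order_refl) auto
          also have "\<dots> = \<bar>m\<bar>" by (simp only: m_def abs_mult abs_of_nat mult_1_right)
          finally have "\<bar>real j * (mean * a)\<bar> \<le> \<bar>m\<bar>" .
          hence 3: "- (real j * (mean * a)) \<le> \<bar>m\<bar>" by linarith
          have "real n = real k * real L + real j" using n by simp
          hence "real k * (m * a) = real n * (mean * a) - real j * (mean * a)"
            by (simp add: m_def algebra_simps)
          thus ?thesis using 1 2 3 by (simp add: algebra_simps)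
        qed
        finally show ?thesis by (simp add: K_def exp_add algebra_simps)
      qed
    qed
  qed
qed

text \<open>For imaginary z and nonnegative variance the multiplier of a period has modulus at most
  1, so the cubic errors of successive periods merely add up.\<close>

lemma char_bound:
  assumes var: "0 \<le> var"
  obtains C D \<delta> :: real where "0 < \<delta>"
    "\<forall>\<theta> n. \<bar>\<theta>\<bar> \<le> \<delta> \<longrightarrow>
      norm (tilted n (\<i> * of_real \<theta>) (\<lambda>_. 1) * exp (- (\<i> * of_real (\<theta> * (real n * mean))))
        - of_real (exp (- (real (n div L) * (real L * var / 2) * \<theta>\<^sup>2)))) \<le> real n * C * \<bar>\<theta>\<bar> ^ 3 + D * \<bar>\<theta>\<bar>"
proof -
  obtain w C c \<delta> where ev: "approximate_eigenvector w C c \<delta>" by (rule approximate_eigenvector_exists)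
  note ev = ev[unfolded approximate_eigenvector_def]
  have C: "0 \<le> C" and c: "0 \<le> c" and \<delta>: "0 < \<delta>" "\<delta> \<le> 1" "c * \<delta> \<le> 1 / 2"
    using ev by blast+
  have w: "\<And>z R. norm z \<le> \<delta> \<Longrightarrow> norm (w z R - 1) \<le> c * norm z"
    using ev by blast
  have approx: "\<And>z R. z \<noteq> 0 \<Longrightarrow> norm z \<le> \<delta> \<Longrightarrow>
      norm ((transfer ^^ r) ((bet \<rho> (exp z) (exp (- z)) ^^ s) (w z)) R
        - exp (of_real (real L * mean) * z + of_real (real L * var / 2) * z\<^sup>2) * w z R) \<le> C * norm z ^ 3"
    using ev by blast
  define m where "m = real L * mean"
  define V where "V = real L * var / 2"
  have V: "0 \<le> V" using var by (simp add: V_def)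
  show ?thesis
  \<comment> \<open>The term 2 c comes from exchanging \<open>w\<close> and 1 at both ends, L from
    the incomplete period, and |m| from centring at n times the mean instead of at complete
    periods.\<close>
  proof (rule that[of \<delta> C "2 * c + real L + \<bar>m\<bar>"])
    show "0 < \<delta>" by (rule \<delta>)
    show "\<forall>\<theta> n. \<bar>\<theta>\<bar> \<le> \<delta> \<longrightarrow>
      norm (tilted n (\<i> * of_real \<theta>) (\<lambda>_. 1) * exp (- (\<i> * of_real (\<theta> * (real n * mean))))
        - of_real (exp (- (real (n div L) * (real L * var / 2) * \<theta>\<^sup>2))))
        \<le> real n * C * \<bar>\<theta>\<bar> ^ 3 + (2 * c + real L + \<bar>m\<bar>) * \<bar>\<theta>\<bar>"
    proof (intro allI impI)
      fix \<theta> :: real and n :: nat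
      assume \<theta>: "\<bar>\<theta>\<bar> \<le> \<delta>"
      let ?z = "\<i> * complex_of_real \<theta>"
      define k where "k = n div L"
      define j where "j = n mod L"
      have n: "n = k * L + j" and j: "j \<le> L" using period_decomp[of n] by (simp_all add: k_def j_def)
      have one: "tilted 0 z (\<lambda>_. 1) = 1" for z
        using tilted_of_real[of 0 0] tilted_start[of z "\<lambda>_. 1"] by simp
      define l where "l = exp (of_real m * ?z + of_real V * ?z\<^sup>2)"
      have l_eq: "l = of_real (exp (- (V * \<theta>\<^sup>2))) * exp (\<i> * of_real (\<theta> * m))"
      proof -
        have "of_real m * ?z + of_real V * ?z\<^sup>2 = of_real (- (V * \<theta>\<^sup>2)) + \<i> * of_real (\<theta> * m)"
          by (simp add: power_mult_distrib)
        thus ?thesis unfolding l_def by (simp only: exp_add exp_of_real)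
      qed
      have l1: "norm l \<le> 1" using V by (simp add: l_eq norm_mult norm_exp_eq_Re)
      define b where "b = (\<lambda>k. tilted (k * L) ?z (w ?z))"
      have step: "norm (b (Suc k) - l * b k) \<le> C * \<bar>\<theta>\<bar> ^ 3" if "\<theta> \<noteq> 0" for k
      proof -
        have "norm (b (Suc k) - l * b k) \<le> C * norm ?z ^ 3 * mgf (k * L) (Re ?z)"
          unfolding b_def tilted_period tilted_cmult[symmetric] l_def m_def V_def
          by (rule norm_tilted_diff_le, rule approx) (use that \<theta> in \<open>simp_all add: norm_mult\<close>)
        thus ?thesis by (simp add: norm_mult)
      qed
      have iter: "norm (b k - l ^ k * b 0) \<le> real k * (C * \<bar>\<theta>\<bar> ^ 3)" if "\<theta> \<noteq> 0" for k
      proof (induction k)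
        case (Suc k)
        have 1: "norm (l * (b k - l ^ k * b 0)) \<le> 1 * (real k * (C * \<bar>\<theta>\<bar> ^ 3))"
          unfolding norm_mult using Suc l1 by (intro mult_mono) auto
        have "b (Suc k) - l ^ Suc k * b 0 = (b (Suc k) - l * b k) + l * (b k - l ^ k * b 0)"
          by (simp add: algebra_simps)
        also have "norm \<dots> \<le> C * \<bar>\<theta>\<bar> ^ 3 + 1 * (real k * (C * \<bar>\<theta>\<bar> ^ 3))"
          by (intro norm_triangle_mono step[OF that] 1)
        finally show ?case by (simp add: algebra_simps)
      qed simp
      have b_one: "norm (b k - tilted (k * L) ?z (\<lambda>_. 1)) \<le> c * \<bar>\<theta>\<bar>" for k
        using norm_tilted_diff_le[of "w ?z" "\<lambda>_. 1" "c * \<bar>\<theta>\<bar>" "k * L" ?z] w[of ?z] \<theta>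
        by (simp add: b_def norm_mult)
      have main: "norm (tilted n ?z (\<lambda>_. 1) - l ^ k) \<le> real n * C * \<bar>\<theta>\<bar> ^ 3 + (2 * c + real L) * \<bar>\<theta>\<bar>"
      proof (cases "\<theta> = 0")
        case True
        thus ?thesis using tilted_of_real[of n 0] by (simp add: l_def)
      next
        case False
        have "norm (tilted n ?z (\<lambda>_. 1) - tilted (k * L) ?z (\<lambda>_. 1)) \<le> real j * \<bar>\<theta>\<bar>"
          using char_add_diff[of "k * L" j \<theta>] by (simp add: n)
        also have "\<dots> \<le> real L * \<bar>\<theta>\<bar>" using j by (intro mult_right_mono) auto
        finally have 1: "norm (tilted n ?z (\<lambda>_. 1) - tilted (k * L) ?z (\<lambda>_. 1)) \<le> real L * \<bar>\<theta>\<bar>" .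
        have 2: "norm (tilted (k * L) ?z (\<lambda>_. 1) - b k) \<le> c * \<bar>\<theta>\<bar>"
          using b_one[of k] by (simp add: norm_minus_commute)
        have "real k \<le> real n" by (simp add: k_def)
        hence "real k * (C * \<bar>\<theta>\<bar> ^ 3) \<le> real n * (C * \<bar>\<theta>\<bar> ^ 3)" using C by (intro mult_right_mono) auto
        hence 3: "norm (b k - l ^ k * b 0) \<le> real n * (C * \<bar>\<theta>\<bar> ^ 3)" using iter[OF False, of k] by linarith
        have "norm (l ^ k * b 0 - l ^ k) = norm l ^ k * norm (b 0 - 1)"
          by (metis norm_mult norm_power right_diff_distrib mult.right_neutral)
        also have "\<dots> \<le> 1 * (c * \<bar>\<theta>\<bar>)"
          using b_one[of 0] l1 by (intro mult_mono) (auto simp: one power_le_one)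
        finally have 4: "norm (l ^ k * b 0 - l ^ k) \<le> c * \<bar>\<theta>\<bar>" by simp
        have "tilted n ?z (\<lambda>_. 1) - l ^ k = (tilted n ?z (\<lambda>_. 1) - tilted (k * L) ?z (\<lambda>_. 1))
            + (tilted (k * L) ?z (\<lambda>_. 1) - b k) + (b k - l ^ k * b 0) + (l ^ k * b 0 - l ^ k)" by simp
        also have "norm \<dots> \<le> real L * \<bar>\<theta>\<bar> + c * \<bar>\<theta>\<bar> + real n * (C * \<bar>\<theta>\<bar> ^ 3) + c * \<bar>\<theta>\<bar>"
          by (intro norm_triangle_mono 1 2 3 4)
        finally show ?thesis by (simp add: algebra_simps)
      qed
      let ?e = "exp (- (\<i> * of_real (\<theta> * (real n * mean))))"
      let ?E = "exp (- (real k * V * \<theta>\<^sup>2))"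
      have e1: "norm ?e = 1" by (simp add: norm_exp_eq_Re)
      have "real n = real k * real L + real j" using n by simp
      hence "l ^ k * ?e = of_real ?E * exp (\<i> * of_real (- (\<theta> * (real j * mean))))"
        by (simp add: l_eq power_mult_distrib flip: exp_of_nat_mult exp_of_real exp_add)
           (simp add: m_def algebra_simps)
      hence "l ^ k * ?e - of_real ?E = of_real ?E * (exp (\<i> * of_real (- (\<theta> * (real j * mean)))) - 1)"
        by (simp add: algebra_simps)
      also have "norm \<dots> \<le> 1 * \<bar>\<theta> * (real j * mean)\<bar>"
        using iexp_approx1[of "- (\<theta> * (real j * mean))" 0] V
        by (simp only: norm_mult) (intro mult_mono, auto)
      also have "\<dots> = real j * (\<bar>mean\<bar> * \<bar>\<theta>\<bar>)" by (simp add: abs_mult)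
      also have "\<dots> \<le> real L * (\<bar>mean\<bar> * \<bar>\<theta>\<bar>)" using j by (intro mult_right_mono) auto
      also have "\<dots> = \<bar>m\<bar> * \<bar>\<theta>\<bar>" by (simp add: m_def abs_mult)
      finally have 5: "norm (l ^ k * ?e - of_real ?E) \<le> \<bar>m\<bar> * \<bar>\<theta>\<bar>" .
      have "tilted n ?z (\<lambda>_. 1) * ?e - of_real ?E
          = (tilted n ?z (\<lambda>_. 1) - l ^ k) * ?e + (l ^ k * ?e - of_real ?E)" by (simp add: algebra_simps)
      also have "norm \<dots> \<le> (real n * C * \<bar>\<theta>\<bar> ^ 3 + (2 * c + real L) * \<bar>\<theta>\<bar>) + \<bar>m\<bar> * \<bar>\<theta>\<bar>"
        using main 5 by (intro norm_triangle_mono) (simp_all add: norm_mult e1)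
      finally show "norm (tilted n ?z (\<lambda>_. 1) * ?e
          - of_real (exp (- (real (n div L) * (real L * var / 2) * \<theta>\<^sup>2))))
          \<le> real n * C * \<bar>\<theta>\<bar> ^ 3 + (2 * c + real L + \<bar>m\<bar>) * \<bar>\<theta>\<bar>"
        by (simp add: k_def V_def algebra_simps)
    qed
  qed
qed

end

subsection \<open>The limit theorems\<close>

context profit_chain
begin

text \<open>Exponential Markov inequality; the sign of \<open>b\<close> selects the upper or the
  lower tail.\<close>

lemma chernoff:
  assumes "b \<noteq> 0" and bound: "mgf n b \<le> K * exp (real n * (mean * b + C * b\<^sup>2))"
  shows "measure_pmf.prob (Q n) {y. \<bar>b\<bar> * (\<epsilon> * real n) \<le> b * (of_int (fst y) - real n * mean)}
    \<le> K * exp (real n * (C * b\<^sup>2 - \<bar>b\<bar> * \<epsilon>))" (is "measure_pmf.prob _ ?A \<le> _")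
proof -
  let ?c = "exp (- (\<bar>b\<bar> * (\<epsilon> * real n) + b * (real n * mean)))"
  have "measure_pmf.prob (Q n) ?A = measure_pmf.expectation (Q n) (indicator ?A)" by simp
  also have "\<dots> \<le> measure_pmf.expectation (Q n) (\<lambda>y. ?c * (case y of (S, R) \<Rightarrow> exp (b * of_int S)))"
  proof (rule integral_mono[OF integrable_Q integrable_Q])
    fix y :: "int \<times> ('n \<Rightarrow> 3)"
    show "indicator ?A y \<le> ?c * (case y of (S, R) \<Rightarrow> exp (b * of_int S))"
      by (cases y) (auto simp: indicator_def algebra_simps simp flip: exp_add)
  qed
  also have "\<dots> = ?c * mgf n b" by (simp add: mgf_def)
  also have "\<dots> \<le> ?c * (K * exp (real n * (mean * b + C * b\<^sup>2)))"
    by (intro mult_left_mono bound) simp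
  also have "\<dots> = K * exp (real n * (C * b\<^sup>2 - \<bar>b\<bar> * \<epsilon>))"
    by (simp add: mult.left_commute[of _ K] flip: exp_add) (simp add: algebra_simps)
  finally show ?thesis .
qed

lemma large_deviation:
  assumes "0 < \<epsilon>"
  obtains K q :: real where "0 \<le> q" "q < 1"
    "\<forall>n. measure_pmf.prob (Q n) {y. \<epsilon> * real n \<le> \<bar>of_int (fst y) - real n * mean\<bar>} \<le> K * q ^ n"
proof -
  obtain K C \<delta> where K: "0 < K" and C: "0 \<le> C" and \<delta>: "0 < \<delta>"
    and bound: "\<forall>a n. \<bar>a\<bar> \<le> \<delta> \<longrightarrow> mgf n a \<le> K * exp (real n * (mean * a + C * a\<^sup>2))"
    by (rule mgf_bound)
  \<comment> \<open>Small enough that the quadratic term C a^2 uses up at most half of the linear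
    gain a \<epsilon>.\<close>
  define a where "a = min \<delta> (\<epsilon> / (2 * (C + 1)))"
  have a: "0 < a" "a \<le> \<delta>" using \<delta> C assms by (auto simp: a_def)
  have "C * a \<le> C * (\<epsilon> / (2 * (C + 1)))" using C by (intro mult_left_mono) (simp_all add: a_def)
  also have "\<dots> \<le> \<epsilon> / 2" using C assms by (simp add: divide_simps)
  finally have "C * a \<le> \<epsilon> / 2" .
  hence exponent: "C * a\<^sup>2 - a * \<epsilon> \<le> - (a * \<epsilon> / 2)"
    using mult_left_mono[of "C * a" "\<epsilon> / 2" a] a(1) by (simp add: power2_eq_square algebra_simps)
  define q where "q = exp (- (a * \<epsilon> / 2))"
  show ?thesis
  proof (rule that[of q "2 * K"])
    show "0 \<le> q" "q < 1" using a(1) assms by (simp_all add: q_def)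
    show "\<forall>n. measure_pmf.prob (Q n) {y. \<epsilon> * real n \<le> \<bar>of_int (fst y) - real n * mean\<bar>} \<le> 2 * K * q ^ n"
    proof
      fix n
      have tail: "measure_pmf.prob (Q n) {y. a * (\<epsilon> * real n) \<le> b * (of_int (fst y) - real n * mean)} \<le> K * q ^ n"
        if b: "\<bar>b\<bar> = a" for b
      proof -
        have "b\<^sup>2 = a\<^sup>2" using b by (metis power2_abs)
        moreover have "b \<noteq> 0" using b a(1) by auto
        ultimately have "measure_pmf.prob (Q n) {y. a * (\<epsilon> * real n) \<le> b * (of_int (fst y) - real n * mean)}
            \<le> K * exp (real n * (C * a\<^sup>2 - a * \<epsilon>))"
          using chernoff[OF _ bound[rule_format], of b n \<epsilon>] a(2) by (simp add: b)
        also have "\<dots> \<le> K * exp (real n * (- (a * \<epsilon> / 2)))"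
          using K mult_left_mono[OF exponent, of "real n"] by (intro mult_left_mono) auto
        also have "exp (real n * (- (a * \<epsilon> / 2))) = q ^ n"
          unfolding q_def by (rule exp_of_nat_mult)
        finally show ?thesis .
      qed
      have E: "{y. \<epsilon> * real n \<le> \<bar>of_int (fst y) - real n * mean\<bar>}
        = {y. a * (\<epsilon> * real n) \<le> a * (of_int (fst y) - real n * mean)}
          \<union> {y. a * (\<epsilon> * real n) \<le> - a * (of_int (fst y) - real n * mean)}" (is "?E = ?E1 \<union> ?E2")
      proof -
        have "\<epsilon> * real n \<le> \<bar>x\<bar> \<longleftrightarrow> a * (\<epsilon> * real n) \<le> a * x \<or> a * (\<epsilon> * real n) \<le> - a * x" for x
          using a(1) mult_le_cancel_left_pos[OF a(1), of "\<epsilon> * real n" x]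
            mult_le_cancel_left_pos[OF a(1), of "\<epsilon> * real n" "- x"] by (auto simp: abs_if)
        thus ?thesis by blast
      qed
      have "measure_pmf.prob (Q n) ?E \<le> measure_pmf.prob (Q n) ?E1 + measure_pmf.prob (Q n) ?E2"
        unfolding E by (rule measure_Un_le) simp_all
      also have "\<dots> \<le> K * q ^ n + K * q ^ n"
        using a(1) by (intro add_mono tail) auto
      finally show "measure_pmf.prob (Q n) ?E \<le> 2 * K * q ^ n" by simp
    qed
  qed
qed

text \<open>With \<theta> = t / sqrt (n var) the term n |\<theta>|^3 equals |\<theta>| t^2 / var and
  tends to 0, while the complete periods cover a fraction of the n turns that tends to 1.\<close>

lemma char_limit:
  assumes var: "0 < var"
  shows "(\<lambda>n. tilted n (\<i> * of_real (t / sqrt (real n * var))) (\<lambda>_. 1)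
      * exp (- (\<i> * of_real (t / sqrt (real n * var) * (real n * mean)))))
    \<longlonglongrightarrow> of_real (exp (- (t\<^sup>2 / 2)))"
proof -
  obtain C D \<delta> where \<delta>: "0 < \<delta>"
    and bound: "\<forall>\<theta> n. \<bar>\<theta>\<bar> \<le> \<delta> \<longrightarrow>
      norm (tilted n (\<i> * of_real \<theta>) (\<lambda>_. 1) * exp (- (\<i> * of_real (\<theta> * (real n * mean))))
        - of_real (exp (- (real (n div L) * (real L * var / 2) * \<theta>\<^sup>2)))) \<le> real n * C * \<bar>\<theta>\<bar> ^ 3 + D * \<bar>\<theta>\<bar>"
    by (rule char_bound[OF less_imp_le[OF var]])
  define \<theta> where "\<theta> = (\<lambda>n. t / sqrt (real n * var))"
  let ?f = "\<lambda>n. tilted n (\<i> * of_real (\<theta> n)) (\<lambda>_. 1) * exp (- (\<i> * of_real (\<theta> n * (real n * mean))))"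
  let ?g = "\<lambda>n. exp (- (real (n div L) * (real L * var / 2) * (\<theta> n)\<^sup>2))"
  have \<theta>0: "\<theta> \<longlonglongrightarrow> 0"
  proof -
    have "filterlim (\<lambda>n. real n * var) at_top sequentially"
      by (rule filterlim_at_top_mult_tendsto_pos[OF tendsto_const var filterlim_real_sequentially])
    hence "filterlim (\<lambda>n. sqrt (real n * var)) at_top sequentially"
      by (rule filterlim_compose[OF sqrt_at_top])
    thus ?thesis
      unfolding \<theta>_def by (intro tendsto_divide_0[OF tendsto_const] filterlim_at_top_imp_at_infinity)
  qed
  have \<theta>sq: "(\<theta> n)\<^sup>2 = t\<^sup>2 / (real n * var)" for n
    using var by (simp add: \<theta>_def power_divide)
  have \<theta>3: "(\<lambda>n. real n * C * \<bar>\<theta> n\<bar> ^ 3 + D * \<bar>\<theta> n\<bar>) \<longlonglongrightarrow> 0"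
  proof -
    have "(\<lambda>n. t\<^sup>2 / var * C * \<bar>\<theta> n\<bar> + D * \<bar>\<theta> n\<bar>) \<longlonglongrightarrow> t\<^sup>2 / var * C * \<bar>0\<bar> + D * \<bar>0\<bar>"
      by (intro tendsto_intros \<theta>0)
    hence "(\<lambda>n. t\<^sup>2 / var * C * \<bar>\<theta> n\<bar> + D * \<bar>\<theta> n\<bar>) \<longlonglongrightarrow> 0" by simp
    moreover have "eventually (\<lambda>n. t\<^sup>2 / var * C * \<bar>\<theta> n\<bar> + D * \<bar>\<theta> n\<bar> = real n * C * \<bar>\<theta> n\<bar> ^ 3 + D * \<bar>\<theta> n\<bar>) sequentially"
      using eventually_gt_at_top[of 0]
    proof eventually_elim
      case (elim n)
      have "real n * \<bar>\<theta> n\<bar> ^ 3 = real n * (\<theta> n)\<^sup>2 * \<bar>\<theta> n\<bar>"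
        by (simp add: power3_eq_cube power2_eq_square)
      also have "real n * (\<theta> n)\<^sup>2 = t\<^sup>2 / var" using elim by (simp add: \<theta>sq)
      finally show ?case by (metis mult.assoc mult.commute)
    qed
    ultimately show ?thesis by (rule Lim_transform_eventually)
  qed
  have "(\<lambda>n. ?f n - of_real (?g n)) \<longlonglongrightarrow> 0"
  proof (rule Lim_null_comparison[OF _ \<theta>3])
    have "eventually (\<lambda>n. dist (\<theta> n) 0 < \<delta>) sequentially"
      using \<theta>0 \<delta> by (rule tendstoD)
    thus "eventually (\<lambda>n. norm (?f n - of_real (?g n)) \<le> real n * C * \<bar>\<theta> n\<bar> ^ 3 + D * \<bar>\<theta> n\<bar>) sequentially"
      by eventually_elim (rule bound[rule_format], simp)
  qed
  moreover have "(\<lambda>n. complex_of_real (?g n)) \<longlonglongrightarrow> of_real (exp (- (t\<^sup>2 / 2)))"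
  proof -
    have div: "(\<lambda>n. real (n div L) * real L / real n) \<longlonglongrightarrow> 1"
    proof -
      have "(\<lambda>n. 1 - real (n mod L) / real n) \<longlonglongrightarrow> 1 - 0"
      proof (intro tendsto_intros)
        show "(\<lambda>n. real (n mod L) / real n) \<longlonglongrightarrow> 0"
        proof (rule Lim_null_comparison[OF always_eventually])
          show "\<forall>n. norm (real (n mod L) / real n) \<le> real L / real n"
          proof
            fix n
            have "real (n mod L) \<le> real L" using period_decomp(2)[of n] by (rule of_nat_mono)
            hence "real (n mod L) / real n \<le> real L / real n" by (rule divide_right_mono) simp
            thus "norm (real (n mod L) / real n) \<le> real L / real n" by simp
          qed
          show "(\<lambda>n. real L / real n) \<longlonglongrightarrow> 0" by (rule lim_const_over_n)
        qed
      qed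
      moreover have "eventually (\<lambda>n. 1 - real (n mod L) / real n = real (n div L) * real L / real n) sequentially"
        using eventually_gt_at_top[of 0]
      proof eventually_elim
        case (elim n)
        have "real n = real (n div L) * real L + real (n mod L)"
          by (metis of_nat_add of_nat_mult period_decomp(1))
        thus ?case using elim by (simp add: field_simps)
      qed
      ultimately show ?thesis by (simp add: filterlim_cong[OF refl refl])
    qed
    have "real (n div L) * (real L * var / 2) * (\<theta> n)\<^sup>2 = real (n div L) * real L / real n * (t\<^sup>2 / 2)" for n
      using var by (simp add: \<theta>sq)
    hence "(\<lambda>n. real (n div L) * (real L * var / 2) * (\<theta> n)\<^sup>2) \<longlonglongrightarrow> 1 * (t\<^sup>2 / 2)"
      by (simp only:) (intro tendsto_mult div tendsto_const)
    hence "?g \<longlonglongrightarrow> exp (- (1 * (t\<^sup>2 / 2)))" by (intro tendsto_exp tendsto_minus)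
    thus ?thesis by (intro tendsto_of_real) simp
  qed
  ultimately have "(\<lambda>n. (?f n - of_real (?g n)) + of_real (?g n)) \<longlonglongrightarrow> 0 + of_real (exp (- (t\<^sup>2 / 2)))"
    by (rule tendsto_add)
  thus ?thesis by (simp add: \<theta>_def)
qed

end

theorem theorem8:
  fixes M :: "'a measure"
    and X :: "nat \<Rightarrow> 'a \<Rightarrow> 'n::finite \<Rightarrow> int"
    and \<rho> :: real and r s :: nat
  assumes "2 \<le> CARD('n)" and "1 \<le> r" and "1 \<le> s" and "0 < \<rho>"
    and "pattern_process M \<rho> r s X"
  shows "(AE \<omega> in M. (\<lambda>n. real_of_int (cumulative_profit X n \<omega>) / real n)
            \<longlonglongrightarrow> mean_param CARD('n) \<rho> r s) \<and>
         (0 < variance_param TYPE('n) \<rho> r s \<longrightarrow>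
           weak_conv_m
             (\<lambda>n. distr M borel (\<lambda>\<omega>.
                (real_of_int (cumulative_profit X n \<omega>) - real n * mean_param CARD('n) \<rho> r s)
                / sqrt (real n * variance_param TYPE('n) \<rho> r s)))
             std_normal_distribution)"
proof -
  interpret prob_space M using assms(5) by (simp add: pattern_process_def)
  obtain Q :: "nat \<Rightarrow> (int \<times> ('n \<Rightarrow> 3)) pmf" where
    meas: "\<And>n. cumulative_profit X n \<in> M \<rightarrow>\<^sub>M count_space UNIV"
    and law: "\<And>n. distr M (count_space UNIV) (cumulative_profit X n) = measure_pmf (map_pmf fst (Q n))"
    and Q: "\<And>n. Q (Suc n) = Q n \<bind> turn_kernel \<rho> r s n" "\<And>n. finite (set_pmf (Q n))"
      "\<And>y. y \<in> set_pmf (Q 0) \<Longrightarrow> fst y = 0"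
    by (rule profit_residues_law[OF assms(1,5)]) blast
  interpret profit_chain Q \<rho> r s using assms Q by unfold_locales
  let ?S = "cumulative_profit X"
  have meas': "(\<lambda>\<omega>. f (?S n \<omega>)) \<in> borel_measurable M" for f :: "int \<Rightarrow> 'b::topological_space" and n
    by (rule measurable_compose[OF meas]) simp
  have prob_eq: "prob {\<omega> \<in> space M. P (?S n \<omega>)} = measure_pmf.prob (Q n) {y. P (fst y)}" for P n
  proof -
    have "prob {\<omega> \<in> space M. P (?S n \<omega>)} = measure (distr M (count_space UNIV) (?S n)) {k. P k}"
      by (subst measure_distr[OF meas]) (auto intro!: arg_cong[of _ _ prob])
    thus ?thesis by (simp add: law vimage_def)
  qed
  have "AE \<omega> in M. (\<lambda>n. real_of_int (?S n \<omega>) / real n) \<longlonglongrightarrow> mean"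
  proof -
    have "AE \<omega> in M. eventually (\<lambda>n. \<bar>of_int (?S n \<omega>) - real n * mean\<bar> < \<epsilon> * real n) sequentially"
      if "0 < \<epsilon>" for \<epsilon>
    proof -
      obtain K q where q: "0 \<le> q" "q < 1"
        "\<forall>n. measure_pmf.prob (Q n) {y. \<epsilon> * real n \<le> \<bar>of_int (fst y) - real n * mean\<bar>} \<le> K * q ^ n"
        by (rule large_deviation[OF \<open>0 < \<epsilon>\<close>])
      define A where "A = (\<lambda>n. {\<omega> \<in> space M. \<epsilon> * real n \<le> \<bar>of_int (?S n \<omega>) - real n * mean\<bar>})"
      have A: "A n \<in> events" for n
        unfolding A_def using meas'[of "\<lambda>k. \<bar>of_int k - real n * mean\<bar>" n] by measurable
      have "summable (\<lambda>n. prob (A n))"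
      proof (rule summable_comparison_test'[of "\<lambda>n. K * q ^ n"])
        show "summable (\<lambda>n. K * q ^ n)" using q by (intro summable_mult summable_geometric) simp
        show "norm (prob (A n)) \<le> K * q ^ n" for n
          unfolding A_def using q(3)
          by (simp add: prob_eq[of "\<lambda>k. \<epsilon> * real n \<le> \<bar>of_int k - real n * mean\<bar>" n])
      qed
      from borel_cantelli_AE1[OF A _ this]
      have "AE \<omega> in M. eventually (\<lambda>n. \<omega> \<in> space M - A n) sequentially"
        by (simp add: emeasure_eq_measure)
      thus ?thesis by eventually_elim (auto simp: A_def not_le elim!: eventually_mono)
    qed
    \<comment> \<open>Only countably many null sets may be united, hence the sequence 1 / (k + 1) in
      place of all \<epsilon>.\<close>
    hence "AE \<omega> in M. \<forall>k. eventually (\<lambda>n. \<bar>of_int (?S n \<omega>) - real n * mean\<bar> < inverse (real (Suc k)) * real n) sequentially"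
      by (subst AE_all_countable) simp
    thus ?thesis
    proof eventually_elim
      case (elim \<omega>)
      show ?case
      proof (rule tendstoI)
        fix e :: real assume "0 < e"
        then obtain k where k: "inverse (real (Suc k)) < e" using reals_Archimedean by blast
        have "eventually (\<lambda>n. \<bar>of_int (?S n \<omega>) - real n * mean\<bar> < inverse (real (Suc k)) * real n) sequentially"
          using elim by blast
        thus "eventually (\<lambda>n. dist (real_of_int (?S n \<omega>) / real n) mean < e) sequentially"
          using eventually_gt_at_top[of 0]
        proof eventually_elim
          case (elim n)
          have "dist (real_of_int (?S n \<omega>) / real n) mean = \<bar>of_int (?S n \<omega>) - real n * mean\<bar> / real n"
            using elim(2) by (simp add: dist_real_def divide_simps abs_divide[symmetric] mult.commute)
          also have "\<dots> < inverse (real (Suc k))" using elim by (simp add: divide_less_eq)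
          finally show ?case using k by linarith
        qed
      qed
    qed
  qed
  moreover have "weak_conv_m (\<lambda>n. distr M borel (\<lambda>\<omega>. (real_of_int (?S n \<omega>) - real n * mean) / sqrt (real n * var)))
      std_normal_distribution" if var: "0 < var"
  proof (rule levy_continuity)
    let ?F = "\<lambda>n k. (real_of_int k - real n * mean) / sqrt (real n * var)"
    show "real_distribution (distr M borel (\<lambda>\<omega>. ?F n (?S n \<omega>)))" for n
      by (rule real_distribution_distr) (rule meas')
    show "real_distribution std_normal_distribution" by (rule real_dist_normal_dist)
    fix t :: real
    \<comment> \<open>The centring is a deterministic phase that factors out. At n = 0 both sides
      are 1, since division by zero yields 0.\<close>
    have "char (distr M borel (\<lambda>\<omega>. ?F n (?S n \<omega>))) t = tilted n (\<i> * of_real (t / sqrt (real n * var))) (\<lambda>_. 1)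
      * exp (- (\<i> * of_real (t / sqrt (real n * var) * (real n * mean))))" for n
    proof -
      let ?d = "sqrt (real n * var)"
      have "char (distr M borel (\<lambda>\<omega>. ?F n (?S n \<omega>))) t = (\<integral>\<omega>. iexp (t * ?F n (?S n \<omega>)) \<partial>M)"
        unfolding char_def by (rule integral_distr) (auto intro: meas')
      also have "\<dots> = (\<integral>k. iexp (t * ?F n k) \<partial>distr M (count_space UNIV) (?S n))"
        by (rule integral_distr[symmetric, OF meas]) simp
      also have "\<dots> = measure_pmf.expectation (Q n) (\<lambda>y. iexp (t * ?F n (fst y)))"
        by (simp add: law)
      also have "\<dots> = measure_pmf.expectation (Q n) (\<lambda>y. exp (- (\<i> * of_real (t / ?d * (real n * mean))))
          * (case y of (S, R) \<Rightarrow> exp (\<i> * of_real (t / ?d) * of_int S) * 1))"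
        by (rule Bochner_Integration.integral_cong[OF refl])
           (simp add: case_prod_unfold diff_divide_distrib algebra_simps flip: exp_add)
      finally show ?thesis by (simp add: tilted_def mult.commute)
    qed
    thus "(\<lambda>n. char (distr M borel (\<lambda>\<omega>. ?F n (?S n \<omega>))) t) \<longlonglongrightarrow> char std_normal_distribution t"
      using char_limit[OF var, of t] by (simp add: char_std_normal_distribution)
  qed
  ultimately show ?thesis unfolding mean_def var_def by blast
qed

end
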